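(* Let $K=\mathbb{Q}(\sqrt{-D})$ with $D\neq 1,3$, and let $L\subset\mathbb{C}$ be a lattice whose ring of multipliers $\{m\in\mathbb{C}: mL\subset L\}$ equals the ring of integers $\mathcal{O}_K$. Then the graph of the normalized elliptic Dedekind sum, $$\{(\alpha,\tilde D(\alpha)) : \alpha\in K\},$$ is dense in $\mathbb{C}\times\mathbb{R}$.
   Context: Here $D>0$ is a squarefree integer and $d_K$ denotes the discriminant of $K$. For $z\in\mathbb{C}$ and integer $k\ge 1$ define $$E_k(z)=\sum_{\substack{x\in L\\ x+z\neq 0}}(x+z)^{-k}|x+z|^{-s}\Big|_{s=0},$$ where the value at $s=0$ is obtained by analytic continuation in $s$. For $a,c\in\mathcal{O}_K$ with $c\neq 0$, the elliptic Dedekind sum (of Sczech) is $$D(a,c)=\frac{1}{c}\sum_{\mu\in L/cL}E_1\Big(\frac{a\mu}{c}\Big)E_1\Big(\frac{\mu}{c}\Big),$$ and the normalized elliptic Dedekind sum is $\tilde D(a,c)=\big(i\sqrt{|d_K|}\,E_2(0)\big)^{-1}D(a,c)$, which is real-valued. It satisfies $\tilde D(\lambda a,\lambda c)=\tilde D(a,c)$ for all nonzero $\lambda\in\mathcal{O}_K$. For $\alpha\in K$ one writes $\alpha=a/c$ with $a,c\in\mathcal{O}_K$, $c\neq0$ (any representative; the value does not depend on the choice) and sets $\tilde D(\alpha)=\tilde D(a,c)$. *)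

theory Defs
  imports "HOL-Complex_Analysis.Complex_Analysis" "HOL-Computational_Algebra.Computational_Algebra"
begin

definition quadK :: "nat \<Rightarrow> complex set" where
  "quadK D = {of_rat p + of_rat q * (\<i> * complex_of_real (sqrt (real D))) | p q. True}"

definition alg_integer :: "complex \<Rightarrow> bool" where
  "alg_integer x \<longleftrightarrow> (\<exists>p :: int poly. lead_coeff p = 1 \<and> poly (map_poly of_int p) x = 0)"

definition ringOK :: "nat \<Rightarrow> complex set" where
  "ringOK D = {x \<in> quadK D. alg_integer x}"

text \<open>Discriminant of K = Q(sqrt(-D)), D squarefree.\<close>
definition discK :: "nat \<Rightarrow> int" where
  "discK D = (if D mod 4 = 3 then - int D else - 4 * int D)"

definition lattice :: "complex set \<Rightarrow> bool" where
  "lattice L \<longleftrightarrow> (\<exists>w1 w2. w1 \<noteq> 0 \<and> Im (w2 / w1) \<noteq> 0 \<and>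
      L = {of_int m * w1 + of_int n * w2 | m n. True})"

definition multipliers :: "complex set \<Rightarrow> complex set" where
  "multipliers L = {m. (\<lambda>x. m * x) ` L \<subseteq> L}"

text \<open>The series defining E_k, for s in its half-plane of absolute convergence.\<close>
definition eis_series :: "complex set \<Rightarrow> nat \<Rightarrow> complex \<Rightarrow> complex \<Rightarrow> complex" where
  "eis_series L k z s =
     infsum (\<lambda>x. inverse ((x + z) ^ k) * (complex_of_real (cmod (x + z)) powr (- s)))
            {x \<in> L. x + z \<noteq> 0}"

definition eisE :: "complex set \<Rightarrow> nat \<Rightarrow> complex \<Rightarrow> complex" where
  "eisE L k z = (THE v. \<exists>f. f holomorphic_on UNIV \<and>
       (\<forall>s. Re s > 2 - real k \<longrightarrow> f s = eis_series L k z s) \<and> v = f 0)"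

definition lattice_classes :: "complex set \<Rightarrow> complex \<Rightarrow> complex set set" where
  "lattice_classes L c = {{y \<in> L. x - y \<in> (\<lambda>w. c * w) ` L} | x. x \<in> L}"

definition ellDsum :: "complex set \<Rightarrow> complex \<Rightarrow> complex \<Rightarrow> complex" where
  "ellDsum L a c = (1 / c) * (\<Sum>C \<in> lattice_classes L c.
       (let \<mu> = (SOME \<mu>. \<mu> \<in> C) in eisE L 1 (a * \<mu> / c) * eisE L 1 (\<mu> / c)))"

definition normDsum :: "nat \<Rightarrow> complex set \<Rightarrow> complex \<Rightarrow> complex \<Rightarrow> complex" where
  "normDsum D L a c = ellDsum L a c /
     (\<i> * complex_of_real (sqrt (real_of_int \<bar>discK D\<bar>)) * eisE L 2 0)"

definition normDsum_at :: "nat \<Rightarrow> complex set \<Rightarrow> complex \<Rightarrow> complex" where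
  "normDsum_at D L \<alpha> = (case (SOME (a, c). a \<in> ringOK D \<and> c \<in> ringOK D \<and> c \<noteq> 0 \<and> \<alpha> = a / c)
      of (a, c) \<Rightarrow> normDsum D L a c)"

end

(* The Dedekind sum D(a,c) is, up to a factor, the mean over x in L of E_1(x/c) E_1(ax/c). The identity
   (E_1(u) + E_1(v) + E_1(w))^2 = E_2(u) + E_2(v) + E_2(w) - 3 E_2(0) for u + v + w = 0, averaged over suitable
   torsion triples attached to matrices A, B in SL_2(O_K), gives a three-term relation
     D(AB) = D(A) + D(B) + E_2(0) (conj X - X)
   with X an explicit rational expression in the lower left entries. If P_m and Q_m are the parabolic elements
   obtained by conjugating the translations by the integers m and -m with matrices sending infinity to a/c and
   p/q, then P_m Q_m sends infinity to points tending to a/c, and the relation shows that the normalized sums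
   there tend to 2 Im (a/c - p/q) / sqrt |d_K|. As a/c and p/q range over a dense set, the graph is dense.

   Two analytic inputs are needed. The continuation of the series defining E_k uses complex multiplication:
   scaling L by m in O_K expresses (m^k |m|^s - |m|^2) E_k(0,s) through values further to the right, and for every s
   some m makes the factor nonzero, apart from a simple pole when k = 0. That E_2(0) is nonzero when D is not 1 or 3
   follows from its expansion in q = exp(2 pi i tau) at a reduced basis: a zero forces q to be real and
   then, by comparison with tau = i and tau = exp(pi i / 3), forces a unit of O_K other than 1 and -1. *)

theory Submission
  imports Defs
begin

section \<open>Holomorphic sums and gluing of extensions\<close>

text \<open>Class groups shape two choices. L need not be free over O_K, so all sums run over L
  modulo a rational integer N, where integer coordinates exist; every nonzero multiplier divides
  such an N. And a/c is the image of infinity under SL_2(O_K) only if a and c generate the unit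
  ideal; the fractions (1 + 2e)/2^j always qualify and are still dense. The Taylor coefficients in z
  and cnj z of the series at z are again series of this kind, with other integer weights, so all
  weights are continued together. The pole in weight 0 meets a vanishing coefficient; the finite
  product is the cnj z term that makes E_1 periodic but not holomorphic. Since E_1 is 0 on L, the
  squared identity fails for triples meeting L. The resulting indicator terms, together with the
  mean of E_1^2, produce the multiple of E_2(0) in the three-term relation. In X the lower left
  entry of P_m Q_m grows like m^2, as does the product of the entries of the two factors. Their
  quotient alone survives in the limit and gives the difference of the two fixed points. In the
  study of E_2(0) only differences between two zeros are estimated, so the constant term of the
  q-expansion cancels.\<close>

lemma deriv_sum_on:
  assumes "\<And>i. i \<in> X \<Longrightarrow> f i field_differentiable at z"
  shows "deriv (\<lambda>w. \<Sum>i\<in>X. f i w) z = (\<Sum>i\<in>X. deriv (f i) z)"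
  using assms by (auto intro!: DERIV_imp_deriv DERIV_sum simp: DERIV_deriv_iff_field_differentiable)

text \<open>Normal convergence. The domination is required only off a finite set \<open>B\<close> of
  indices, since the bounds for lattice terms hold only for lattice points far away compared with
  the argument; the finitely many others are split off. The clause on derivatives identifies zeta'
  and the derivative of the q-series.\<close>

lemma infsum_holomorphic_deriv:
  fixes f :: "'a \<Rightarrow> complex \<Rightarrow> complex"
  assumes S: "open S" and hol: "\<And>x. x \<in> A \<Longrightarrow> f x holomorphic_on S"
    and bd: "\<And>s. s \<in> S \<Longrightarrow> \<exists>r>0. \<exists>B M. finite B \<and> M summable_on (A - B) \<and>
               (\<forall>x\<in>A - B. \<forall>w\<in>ball s r \<inter> S. norm (f x w) \<le> M x)"
  shows "(\<lambda>s. infsum (\<lambda>x. f x s) A) holomorphic_on S"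
    and "s \<in> S \<Longrightarrow> (\<lambda>x. f x s) summable_on A"
    and "s \<in> S \<Longrightarrow> ((\<lambda>x. deriv (f x) s) has_sum deriv (\<lambda>s. infsum (\<lambda>x. f x s) A) s) A"
proof -
  have *: "(\<exists>r>0. ball s r \<subseteq> S \<and> (\<lambda>s. infsum (\<lambda>x. f x s) A) holomorphic_on ball s r) \<and>
      (\<lambda>x. f x s) summable_on A \<and>
      ((\<lambda>x. deriv (f x) s) has_sum deriv (\<lambda>s. infsum (\<lambda>x. f x s) A) s) A" if s: "s \<in> S" for s
  proof -
    obtain r0 B M where r0: "r0 > 0" and B: "finite B" and M: "M summable_on (A - B)"
      and le: "\<And>x w. x \<in> A - B \<Longrightarrow> w \<in> ball s r0 \<inter> S \<Longrightarrow> norm (f x w) \<le> M x"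
      using bd[OF s] by blast
    obtain r1 where r1: "r1 > 0" "cball s r1 \<subseteq> S" using S s open_contains_cball by blast
    define r where "r = min (r0/2) r1"
    have r: "r > 0" "cball s r \<subseteq> ball s r0 \<inter> S" using r0 r1 by (auto simp: r_def)
    have ul: "uniform_limit (cball s r) (\<lambda>X y. \<Sum>x\<in>X. f x y) (\<lambda>y. infsum (\<lambda>x. f x y) (A - B)) (finite_subsets_at_top (A - B))"
      by (rule Weierstrass_m_test_general[OF _ M]) (use le r in \<open>meson subsetD\<close>)
    have fin: "eventually (\<lambda>X. finite X \<and> X \<subseteq> A - B) (finite_subsets_at_top (A - B))"
      by (simp add: eventually_finite_subsets_at_top_weakI)
    have holX: "eventually (\<lambda>X. (\<lambda>y. \<Sum>x\<in>X. f x y) holomorphic_on S) (finite_subsets_at_top (A - B))"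
      using fin by eventually_elim (auto intro!: holomorphic_on_sum hol)
    have h1: "(\<lambda>y. infsum (\<lambda>x. f x y) (A - B)) holomorphic_on ball s r"
    proof (rule holomorphic_uniform_limit[OF _ ul])
      show "\<forall>\<^sub>F n in finite_subsets_at_top (A - B). continuous_on (cball s r) (\<lambda>y. \<Sum>x\<in>n. f x y) \<and>
              (\<lambda>y. \<Sum>x\<in>n. f x y) holomorphic_on ball s r"
        using holX
      proof eventually_elim
        case (elim X)
        have "ball s r \<subseteq> S" using r by auto
        then show ?case using elim r
          by (meson holomorphic_on_imp_continuous_on holomorphic_on_subset le_inf_iff)
      qed
    qed auto
    have sm: "(\<lambda>x. f x w) summable_on (A - B)" if "w \<in> ball s r" for w
    proof (rule abs_summable_summable, rule summable_on_comparison_test[OF M])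
      fix x assume "x \<in> A - B"
      moreover have "w \<in> ball s r0 \<inter> S" using that r(2) ball_subset_cball by blast
      ultimately show "norm (f x w) \<le> M x" using le by blast
    qed auto
    have AB: "A = (A \<inter> B) \<union> (A - B)" by auto
    have sm2: "(\<lambda>x. f x w) summable_on A" if "w \<in> ball s r" for w
      by (subst AB, rule summable_on_Un_disjoint) (use sm[OF that] B in auto)
    have split: "infsum (\<lambda>x. f x w) A = (\<Sum>x\<in>A\<inter>B. f x w) + infsum (\<lambda>x. f x w) (A - B)" if "w \<in> ball s r" for w
    proof -
      have "infsum (\<lambda>x. f x w) ((A \<inter> B) \<union> (A - B)) = infsum (\<lambda>x. f x w) (A \<inter> B) + infsum (\<lambda>x. f x w) (A - B)"
        by (rule infsum_Un_disjoint) (use sm[OF that] B in auto)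
      with AB show ?thesis using B by simp
    qed
    have sub: "ball s r \<subseteq> S" using r by auto
    have h2: "(\<lambda>w. (\<Sum>x\<in>A\<inter>B. f x w)) holomorphic_on ball s r"
      using sub by (auto intro!: holomorphic_on_sum holomorphic_on_subset[OF hol])
    have h3: "(\<lambda>w. (\<Sum>x\<in>A\<inter>B. f x w) + infsum (\<lambda>x. f x w) (A - B)) holomorphic_on ball s r"
      using h1 h2 by (rule holomorphic_on_add[rotated])
    have h4: "(\<lambda>w. infsum (\<lambda>x. f x w) A) holomorphic_on ball s r"
      by (rule holomorphic_transform[OF h3]) (use split in auto)
    have ev: "eventually (\<lambda>w. infsum (\<lambda>x. f x w) A = (\<Sum>x\<in>A\<inter>B. f x w) + infsum (\<lambda>x. f x w) (A - B)) (nhds s)"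
      using split eventually_nhds_in_open[of "ball s r" s] r(1) by (auto elim!: eventually_mono)
    have one: "(deriv ^^ 1) g = deriv g" for g :: "complex \<Rightarrow> complex" by simp
    have "((\<lambda>X. (deriv ^^ 1) (\<lambda>y. \<Sum>x\<in>X. f x y) s) \<longlongrightarrow> (deriv ^^ 1) (\<lambda>y. infsum (\<lambda>x. f x y) (A - B)) s)
             (finite_subsets_at_top (A - B))"
    proof (rule higher_deriv_complex_uniform_limit)
      show "uniform_limit (ball s r) (\<lambda>X y. \<Sum>x\<in>X. f x y) (\<lambda>y. infsum (\<lambda>x. f x y) (A - B)) (finite_subsets_at_top (A - B))"
        using ul by (rule uniform_limit_on_subset) auto
      show "\<forall>\<^sub>F n in finite_subsets_at_top (A - B). (\<lambda>y. \<Sum>x\<in>n. f x y) holomorphic_on ball s r"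
        using holX by eventually_elim (use sub in \<open>auto intro: holomorphic_on_subset\<close>)
    qed (use r in auto)
    moreover have "eventually (\<lambda>X. (deriv ^^ 1) (\<lambda>y. \<Sum>x\<in>X. f x y) s = (\<Sum>x\<in>X. deriv (f x) s)) (finite_subsets_at_top (A - B))"
      using fin
    proof eventually_elim
      case (elim X)
      have "f x field_differentiable at s" if "x \<in> X" for x
        using hol[of x] elim that s S by (auto intro: holomorphic_on_imp_differentiable_at)
      then have "deriv (\<lambda>y. \<Sum>x\<in>X. f x y) s = (\<Sum>x\<in>X. deriv (f x) s)" by (rule deriv_sum_on)
      then show ?case by simp
    qed
    ultimately have "((\<lambda>X. (\<Sum>x\<in>X. deriv (f x) s)) \<longlongrightarrow> deriv (\<lambda>y. infsum (\<lambda>x. f x y) (A - B)) s)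
             (finite_subsets_at_top (A - B))"
      unfolding one by (rule Lim_transform_eventually)
    then have d1: "((\<lambda>x. deriv (f x) s) has_sum deriv (\<lambda>y. infsum (\<lambda>x. f x y) (A - B)) s) (A - B)"
      by (simp add: has_sum_def)
    have d2: "((\<lambda>x. deriv (f x) s) has_sum (\<Sum>x\<in>A\<inter>B. deriv (f x) s)) (A \<inter> B)"
      using B by (intro has_sum_finite) auto
    have fd: "f x field_differentiable at s" if "x \<in> A" for x
        using hol[of x] that s S by (auto intro: holomorphic_on_imp_differentiable_at)
    have "deriv (\<lambda>s. infsum (\<lambda>x. f x s) A) s = deriv (\<lambda>w. (\<Sum>x\<in>A\<inter>B. f x w) + infsum (\<lambda>x. f x w) (A - B)) s"
      by (rule deriv_cong_ev[OF ev]) auto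
    also have "\<dots> = deriv (\<lambda>w. (\<Sum>x\<in>A\<inter>B. f x w)) s + deriv (\<lambda>w. infsum (\<lambda>x. f x w) (A - B)) s"
      by (intro deriv_add holomorphic_on_imp_differentiable_at[OF h2] holomorphic_on_imp_differentiable_at[OF h1]) (use r in auto)
    also have "deriv (\<lambda>w. (\<Sum>x\<in>A\<inter>B. f x w)) s = (\<Sum>x\<in>A\<inter>B. deriv (f x) s)"
      by (rule deriv_sum_on) (use fd in auto)
    finally have "((\<lambda>x. deriv (f x) s) has_sum deriv (\<lambda>s. infsum (\<lambda>x. f x s) A) s) ((A \<inter> B) \<union> (A - B))"
      using has_sum_Un_disjoint[OF d2 d1] by auto
    then have "((\<lambda>x. deriv (f x) s) has_sum deriv (\<lambda>s. infsum (\<lambda>x. f x s) A) s) A"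
      using AB by simp
    with h4 sub r(1) sm2[of s] show ?thesis by auto
  qed
  show "(\<lambda>s. infsum (\<lambda>x. f x s) A) holomorphic_on S"
    using * by (meson S analytic_at_ball analytic_imp_holomorphic analytic_on_analytic_at)
  show "s \<in> S \<Longrightarrow> (\<lambda>x. f x s) summable_on A"
    "s \<in> S \<Longrightarrow> ((\<lambda>x. deriv (f x) s) has_sum deriv (\<lambda>s. infsum (\<lambda>x. f x s) A) s) A"
    using * by blast+
qed

text \<open>The multipliers \<open>G m\<close> may vanish, but not simultaneously, so the quotients \<open>B m / G m\<close> glue.\<close>
lemma holomorphic_extension_glue:
  fixes f :: "complex \<Rightarrow> complex"
  assumes U: "open U" "connected U" and V: "open V" "V \<subseteq> U" "V \<noteq> {}"
    and G: "\<And>m. m \<in> I \<Longrightarrow> G m holomorphic_on U" and B: "\<And>m. m \<in> I \<Longrightarrow> B m holomorphic_on U"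
    and eq: "\<And>m s. m \<in> I \<Longrightarrow> s \<in> V \<Longrightarrow> f s * G m s = B m s"
    and nz: "\<And>s. s \<in> U \<Longrightarrow> \<exists>m\<in>I. G m s \<noteq> 0"
  shows "\<exists>F. F holomorphic_on U \<and> (\<forall>s\<in>V. F s = f s)"
proof -
  define ch where "ch s = (SOME m. m \<in> I \<and> G m s \<noteq> 0)" for s
  have ch: "ch s \<in> I" "G (ch s) s \<noteq> 0" if "s \<in> U" for s
    using someI_ex[of "\<lambda>m. m \<in> I \<and> G m s \<noteq> 0"] nz[OF that] by (auto simp: ch_def)
  define F where "F s = B (ch s) s / G (ch s) s" for s
  \<comment> \<open>Cross-multiplied, two quotients agree on \<open>V\<close>, hence on
    \<open>U\<close> by the identity theorem; so the chosen \<open>m\<close> does not affect the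
    value.\<close>
  have comp: "B m s * G n s = B n s * G m s" if "m \<in> I" "n \<in> I" "s \<in> U" for m n s
  proof (rule analytic_continuation_open[where s = V and s' = U and f = "\<lambda>s. B m s * G n s" and g = "\<lambda>s. B n s * G m s"])
    show "(\<lambda>s. B m s * G n s) holomorphic_on U" "(\<lambda>s. B n s * G m s) holomorphic_on U"
      using that by (auto intro!: holomorphic_intros G B)
    show "B m z * G n z = B n z * G m z" if "z \<in> V" for z
      using eq[OF \<open>m \<in> I\<close> that] eq[OF \<open>n \<in> I\<close> that] by (metis mult.assoc mult.commute)
  qed (use U V that in auto)
  have "F s = B m s / G m s" if "m \<in> I" "s \<in> U" "G m s \<noteq> 0" for m s
    using comp[OF that(1) ch(1)[OF that(2)] that(2)] that ch[OF that(2)]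
    by (simp add: F_def field_simps)
  note Fm = this
  have "F analytic_on {s}" if s: "s \<in> U" for s
  proof -
    obtain m where m: "m \<in> I" "G m s \<noteq> 0" using nz s by blast
    have "isCont (G m) s" using G[OF m(1)] s U(1)
      using continuous_on_eq_continuous_at holomorphic_on_imp_continuous_on by blast
    then have "((\<lambda>w. G m w) \<longlongrightarrow> G m s) (nhds s)"
      by (simp add: continuous_within tendsto_at_iff_tendsto_nhds)
    then have "eventually (\<lambda>w. G m w \<noteq> 0) (nhds s)" using m(2)
      by (rule tendsto_imp_eventually_ne)
    moreover have "eventually (\<lambda>w. w \<in> U) (nhds s)" using U s eventually_nhds_in_open by blast
    ultimately have ev: "eventually (\<lambda>w. F w = B m w / G m w) (nhds s)"
      by eventually_elim (use Fm m in auto)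
    have "(\<lambda>w. B m w / G m w) analytic_on {s}"
      using U(1) s m B[OF m(1)] G[OF m(1)] analytic_at by (intro analytic_on_divide) auto
    then show ?thesis using analytic_at_cong[OF ev refl] by blast
  qed
  then have "F holomorphic_on U"
    using U analytic_imp_holomorphic analytic_on_analytic_at by blast
  moreover have "F s = f s" if "s \<in> V" for s
  proof -
    have "s \<in> U" using that V by auto
    from ch[OF this] eq[OF ch(1)[OF this] that] show ?thesis by (simp add: F_def field_simps)
  qed
  ultimately show ?thesis by blast
qed

lemma open_halfplane_gt: "open {s::complex. Re s > c}"
  by (simp add: open_halfspace_Re_gt)

lemma convex_Re_gt: "convex {s::complex. Re s > c}"
  by (simp add: convex_halfspace_Re_gt)

text \<open>The extensions to larger and larger half-planes agree by the identity theorem. At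
  \<open>s\<close> one uses an index whose half-plane contains \<open>s\<close>; the
  \<open>+ 1\<close> in it makes the inequality strict.\<close>

lemma entire_extension:
  fixes g :: "complex \<Rightarrow> complex" and c :: real
  assumes "\<And>M::nat. \<exists>F. F holomorphic_on {s. Re s > c - M} \<and> (\<forall>s. Re s > c \<longrightarrow> F s = g s)"
  shows "\<exists>F. F holomorphic_on UNIV \<and> (\<forall>s. Re s > c \<longrightarrow> F s = g s)"
proof -
  have "\<exists>F :: nat \<Rightarrow> complex \<Rightarrow> complex. \<forall>M. F M holomorphic_on {s. Re s > c - M} \<and> (\<forall>s. Re s > c \<longrightarrow> F M s = g s)"
    by (rule choice) (use assms in blast)
  then obtain F :: "nat \<Rightarrow> complex \<Rightarrow> complex" where F: "\<And>M::nat. F M holomorphic_on {s. Re s > c - M}"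
    and Fg: "\<And>M s. Re s > c \<Longrightarrow> F M s = g s" by blast
  have comp: "F M s = F N s" if "M \<le> N" "Re s > c - M" for M N s
  proof (rule analytic_continuation_open[where s = "{s. Re s > c}" and s' = "{s. Re s > c - M}" and f = "F M" and g = "F N"])
    show "F N holomorphic_on {s. Re s > c - M}"
      using that by (intro holomorphic_on_subset[OF F[of N]]) auto
    show "{s. Re s > c} \<noteq> {}" by (auto intro: exI[of _ "complex_of_real (c+1)"])
    show "connected {s. Re s > c - M}" by (intro convex_connected convex_Re_gt)
  qed (use that F Fg open_halfplane_gt in auto)
  define G where "G s = F (nat \<lceil>c - Re s\<rceil> + 1) s" for s
  have Gdom: "Re s > c - (nat \<lceil>c - Re s\<rceil> + 1)" for s by linarith
  have GF: "G s = F M s" if "Re s > c - M" for M s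
    using comp[of M "nat \<lceil>c - Re s\<rceil> + 1" s] comp[of "nat \<lceil>c - Re s\<rceil> + 1" M s] that Gdom[of s]
    unfolding G_def by (cases "M \<le> nat \<lceil>c - Re s\<rceil> + 1") (metis, metis nat_le_linear)
  have "G analytic_on {s}" for s
  proof -
    define M where "M = nat \<lceil>c - Re s\<rceil> + 1"
    have M: "s \<in> {s. Re s > c - M}" unfolding M_def using Gdom[of s] by simp
    have "F M analytic_on {s}" using F[of M] M open_halfplane_gt
      by (meson analytic_at)
    have "eventually (\<lambda>w. w \<in> {s. Re s > c - M}) (nhds s)"
      using M open_halfplane_gt eventually_nhds_in_open by blast
    then have ev: "eventually (\<lambda>w. G w = F M w) (nhds s)"
      by eventually_elim (use GF in auto)
    show ?thesis using \<open>F M analytic_on {s}\<close> analytic_at_cong[OF ev refl] by blast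
  qed
  then have "G holomorphic_on UNIV"
    using analytic_imp_holomorphic analytic_on_analytic_at by blast
  moreover have "G s = g s" if "Re s > c" for s
    using GF[of 0 s] Fg that by auto
  ultimately show ?thesis by blast
qed

section \<open>The Kronecker-Eisenstein kernel and its Taylor expansion\<close>

lemma gbinomial_Suc_step:
  fixes a :: "'a::field_char_0"
  shows "a gchoose Suc n = (a gchoose n) * ((a - of_nat n) / of_nat (Suc n))"
proof -
  have "of_nat (Suc n) * (a gchoose Suc n) = (a gchoose n) * (a - of_nat n)"
    using gbinomial_mult_1[of a n] by (simp add: algebra_simps)
  moreover have "(of_nat (Suc n) :: 'a) \<noteq> 0" by (rule of_nat_neq_0)
  ultimately show ?thesis by (simp add: field_simps del: of_nat_Suc)
qed

text \<open>The right-hand side is the n-th coefficient of (1 - x) to the power - |a|, a quotient of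
  a rising factorial of |a|. It is a convergent majorant inside the unit disc, used below at x =
  1/2.\<close>

lemma norm_gbinomial_le:
  fixes a :: complex
  shows "norm (a gchoose n) \<le> (-1)^n * ((- norm a) gchoose n)"
proof (induction n)
  case (Suc n)
  have "norm (a gchoose Suc n) = norm (a gchoose n) * (norm (a - of_nat n) / real (Suc n))"
    by (simp add: gbinomial_Suc_step norm_mult norm_divide del: of_nat_Suc)
  also have "\<dots> \<le> ((-1)^n * ((- norm a) gchoose n)) * ((norm a + real n) / real (Suc n))"
    using norm_triangle_ineq4[of a "of_nat n"] Suc
    by (intro mult_mono divide_right_mono) (auto intro: order_trans[OF norm_ge_zero])
  also have "\<dots> = (-1)^(Suc n) * ((- norm a) gchoose (Suc n))"
    by (simp add: gbinomial_Suc_step field_simps del: of_nat_Suc)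
  finally show ?case .
qed auto

lemma sums_gbinomial_majorant:
  fixes a :: real
  shows "(\<lambda>n. ((-1)^n * ((-a) gchoose n)) * (1/2)^n) sums (2 powr a)"
proof -
  have "(\<lambda>n. ((-a) gchoose n) * (-1/2)^n) sums (1 + (-1/2)) powr (-a)"
    by (rule gen_binomial_real) simp
  moreover have "(-1/2 :: real)^n = (-1)^n * (1/2)^n" for n
    by (metis mult.right_neutral power_mult_distrib times_divide_eq_right)
  moreover have "(1 + (-1/2)) powr (-a) = (2::real) powr a"
    using powr_minus_divide[of "1/2" a] powr_divide[of 1 2 a] by (simp)
  ultimately show ?thesis by (simp add: mult_ac)
qed

text \<open>As t = 2t * (1/2), the part of degree n is at most (2t)^n times the corresponding part
  of the majorant at 1/2. Since 2t \<le> 1, the factor (2t)^J comes out of the whole tail, and the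
  full majorant series sums to the power of 2.\<close>

lemma binomial_product_remainder:
  fixes \<alpha> \<beta> u v :: complex and t :: real
  assumes "norm u \<le> t" "norm v \<le> t" "t \<le> 1/2"
  shows "norm ((1+u) powr \<alpha> * (1+v) powr \<beta> - (\<Sum>n<J. \<Sum>a\<le>n. (\<alpha> gchoose a) * (\<beta> gchoose (n-a)) * u^a * v^(n-a)))
          \<le> (2*t)^J * 2 powr (norm \<alpha> + norm \<beta>)"
proof -
  have t0: "t \<ge> 0" using assms(1) norm_ge_zero order_trans by blast
  define p where "p c n = (-1)^n * ((- norm c) gchoose n)" for c :: complex and n
  have p: "norm (c gchoose n) \<le> p c n" for c n unfolding p_def by (rule norm_gbinomial_le)
  have p0: "p c n \<ge> 0" for c n using p[of c n] norm_ge_zero order_trans by blast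
  have ps: "(\<lambda>n. p c n * (1/2)^n) sums (2 powr (norm c))" for c
    unfolding p_def by (rule sums_gbinomial_majorant)
  define A where "A n = (\<alpha> gchoose n) * u^n" for n
  define B where "B n = (\<beta> gchoose n) * v^n" for n
  have le: "norm ((c gchoose n) * w^n) \<le> p c n * (1/2)^n" if "norm w \<le> t" for c w n
    unfolding norm_mult norm_power
    using that assms(3) by (intro mult_mono p power_mono p0) auto
  have sA: "summable (\<lambda>n. norm (A n))" "summable (\<lambda>n. norm (B n))"
    unfolding A_def B_def using le assms(1,2) ps
    by (auto intro!: summable_comparison_test'[OF sums_summable[OF ps]])
  define C where "C n = (\<Sum>i\<le>n. A i * B (n - i))" for n
  have "A sums (1+u) powr \<alpha>" "B sums (1+v) powr \<beta>"
    unfolding A_def B_def using assms by (auto intro!: gen_binomial_complex)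
  then have Cs: "C sums ((1+u) powr \<alpha> * (1+v) powr \<beta>)"
    using Cauchy_product_sums[OF sA] by (simp add: C_def[abs_def] sums_iff)
  define d where "d n = (\<Sum>i\<le>n. (p \<alpha> i * (1/2)^i) * (p \<beta> (n - i) * (1/2)^(n-i)))" for n
  have "summable (\<lambda>n. norm (p c n * (1/2)^n))" for c
    using sums_summable[OF ps] p0 by (simp add: abs_mult)
  then have ds: "d sums (2 powr (norm \<alpha>) * 2 powr (norm \<beta>))"
    using Cauchy_product_sums[of "\<lambda>n. p \<alpha> n * (1/2)^n" "\<lambda>n. p \<beta> n * (1/2)^n"] ps
    by (simp add: d_def[abs_def] sums_iff)
  have d0: "d n \<ge> 0" for n unfolding d_def by (intro sum_nonneg mult_nonneg_nonneg p0) auto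
  have Cd: "norm (C n) \<le> (2*t)^n * d n" for n
  proof -
    have "norm (C n) \<le> (\<Sum>i\<le>n. norm (A i) * norm (B (n - i)))"
      unfolding C_def by (rule order_trans[OF norm_sum]) (simp add: norm_mult)
    also have "\<dots> \<le> (\<Sum>i\<le>n. (p \<alpha> i * t^i) * (p \<beta> (n - i) * t^(n-i)))"
      using assms unfolding A_def B_def norm_mult norm_power
      by (intro sum_mono mult_mono p power_mono p0 mult_nonneg_nonneg) (auto simp: t0)
    also have "\<dots> = (\<Sum>i\<le>n. (2*t)^n * ((p \<alpha> i * (1/2)^i) * (p \<beta> (n - i) * (1/2)^(n-i))))"
    proof (rule sum.cong[OF refl])
      fix i assume "i \<in> {..n}"
      then have n: "(2*t)^n = (2*t)^i * (2*t)^(n-i)" using power_add[of "2*t" i "n-i"] by simp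
      have h: "t^k = (2*t)^k * (1/2)^k" for k
      proof -
        have "t^k = (2*t*(1/2))^k" by simp
        also have "\<dots> = (2*t)^k * (1/2)^k" by (rule power_mult_distrib)
        finally show ?thesis .
      qed
      have "p \<alpha> i * t ^ i * (p \<beta> (n - i) * t ^ (n - i)) =
          p \<alpha> i * ((2*t)^i * (1/2)^i) * (p \<beta> (n - i) * ((2*t)^(n-i) * (1/2)^(n-i)))"
        by (simp only: h[symmetric])
      also have "\<dots> = (2*t)^i * (2*t)^(n-i) * (p \<alpha> i * (1 / 2) ^ i * (p \<beta> (n - i) * (1 / 2) ^ (n - i)))"
        by (simp only: mult_ac)
      finally show "p \<alpha> i * t ^ i * (p \<beta> (n - i) * t ^ (n - i)) =
          (2 * t) ^ n * (p \<alpha> i * (1 / 2) ^ i * (p \<beta> (n - i) * (1 / 2) ^ (n - i)))"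
        unfolding n .
    qed
    finally show ?thesis by (simp add: d_def sum_distrib_left)
  qed
  have rem: "(\<lambda>n. C (n + J)) sums ((1+u) powr \<alpha> * (1+v) powr \<beta> - (\<Sum>n<J. C n))"
    by (rule sums_split_initial_segment[OF Cs])
  have dJ: "(\<lambda>n. d (n + J)) sums (2 powr (norm \<alpha>) * 2 powr (norm \<beta>) - (\<Sum>n<J. d n))"
    by (rule sums_split_initial_segment[OF ds])
  have le2: "norm (C (n + J)) \<le> (2*t)^J * d (n + J)" for n
  proof -
    have "(2*t)^(n+J) \<le> 1 * (2*t)^J" unfolding power_add
      using assms(3) t0 by (intro mult_right_mono power_le_one) auto
    then have "(2*t)^(n+J) * d (n+J) \<le> (2*t)^J * d (n+J)" by (intro mult_right_mono d0) auto
    with Cd[of "n+J"] show ?thesis by linarith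
  qed
  have sm: "summable (\<lambda>n. (2*t)^J * d (n + J))" using dJ by (intro summable_mult) (auto simp: sums_iff)
  have smC: "summable (\<lambda>n. norm (C (n + J)))"
    by (rule summable_comparison_test'[OF sm]) (use le2 in auto)
  have "norm ((1+u) powr \<alpha> * (1+v) powr \<beta> - (\<Sum>n<J. C n)) = norm (\<Sum>n. C (n + J))"
    using rem by (simp add: sums_iff)
  also have "\<dots> \<le> (\<Sum>n. norm (C (n + J)))" using smC by (rule summable_norm)
  also have "\<dots> \<le> (\<Sum>n. (2*t)^J * d (n + J))" by (rule suminf_le[OF le2 smC sm])
  also have "\<dots> = (2*t)^J * (2 powr (norm \<alpha>) * 2 powr (norm \<beta>) - (\<Sum>n<J. d n))"
    using dJ by (subst suminf_mult) (auto simp: sums_iff)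
  also have "\<dots> \<le> (2*t)^J * (2 powr (norm \<alpha>) * 2 powr (norm \<beta>))"
    using t0 by (intro mult_left_mono) (auto intro: sum_nonneg d0)
  also have "(\<Sum>n<J. C n) = (\<Sum>n<J. \<Sum>a\<le>n. (\<alpha> gchoose a) * (\<beta> gchoose (n-a)) * u^a * v^(n-a))"
    by (simp add: C_def A_def B_def mult_ac)
  finally show ?thesis by (simp add: powr_add)
qed

text \<open>Since \<open>0 powr s = 0\<close>, the kernel vanishes at \<open>0\<close>, so lattice sums may range over all of \<open>L\<close>.\<close>
definition ekern :: "int \<Rightarrow> complex \<Rightarrow> complex \<Rightarrow> complex" where
  "ekern k s x = x powi (-k) * complex_of_real (cmod x) powr (-s)"

lemma ekern_0 [simp]: "ekern k s 0 = 0" by (simp add: ekern_def)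

lemma ekern_mult: "ekern k s (x * y) = ekern k s x * ekern k s y"
proof -
  have "(complex_of_real (cmod x) * complex_of_real (cmod y)) powr (-s) =
        complex_of_real (cmod x) powr (-s) * complex_of_real (cmod y) powr (-s)"
    by (rule powr_times_real) auto
  then show ?thesis by (simp add: ekern_def norm_mult power_int_mult_distrib)
qed

lemma norm_ekern: "x \<noteq> 0 \<Longrightarrow> norm (ekern k s x) = norm x powr (-(of_int k + Re s))"
  by (simp add: ekern_def norm_mult norm_power_int norm_powr_real_powr powr_add[symmetric]
      flip: powr_real_of_int')

lemma ekern_at_0: "x \<noteq> 0 \<Longrightarrow> ekern k 0 x = x powi (-k)"
  by (simp add: ekern_def)

lemma holomorphic_ekern [holomorphic_intros]:
  "f holomorphic_on A \<Longrightarrow> (\<lambda>s. ekern k (f s) x) holomorphic_on A"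
  by (cases "x = 0") (auto simp: ekern_def intro!: holomorphic_intros)

text \<open>|w|^2 is the product of w and cnj w, whose principal logarithms are conjugate here. The
  kernel thus becomes a product of two complex powers, each with its own binomial series.\<close>

lemma ekern_right_halfplane:
  assumes "Re w > 0"
  shows "ekern k s w = w powr (- of_int k - s/2) * cnj w powr (-s/2)"
proof -
  have w: "w \<noteq> 0" "w \<notin> \<real>\<^sub>\<le>\<^sub>0" using assms by (auto simp: complex_nonpos_Reals_iff)
  have L: "Ln (cnj w) = cnj (Ln w)" using cnj_Ln[OF w(2)] by simp
  have "Ln w + cnj (Ln w) = complex_of_real (2 * ln (cmod w))"
    using w by (simp add: complex_add_cnj)
  then have "-s/2 * (Ln w + cnj (Ln w)) = -s * complex_of_real (ln (cmod w))" by simp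
  then have "w powr (-s/2) * cnj w powr (-s/2) = complex_of_real (cmod w) powr (-s)"
    using w L by (simp add: powr_def exp_add[symmetric] Ln_of_real ring_distribs)
  moreover have "w powr (- of_int k - s/2) = w powi (-k) * w powr (-s/2)"
  proof -
    have "w powr (of_int (-k) + (-s/2)) = w powr (of_int (-k)) * w powr (-s/2)"
      by (rule powr_add)
    then show ?thesis using w complex_powr_of_int[of w "-k"] by simp
  qed
  ultimately show ?thesis by (simp add: ekern_def mult_ac)
qed

lemma ekern_add:
  assumes "x \<noteq> 0" "norm (z/x) < 1"
  shows "ekern k s (x + z) = ekern k s x * ((1 + z/x) powr (- of_int k - s/2) * (1 + cnj (z/x)) powr (-s/2))"
proof -
  have "Re (1 + z/x) > 0" using assms(2) abs_Re_le_cmod[of "z/x"] by auto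
  moreover have "x + z = x * (1 + z/x)" using assms by (simp add: field_simps)
  ultimately show ?thesis using ekern_right_halfplane[of "1+z/x" k s] by (simp add: ekern_mult)
qed

text \<open>Each Taylor monomial of the kernel is a kernel again, of another weight and with s
  shifted. The decay \<open>of_int k + Re s\<close> grows by a + b, the degree of the
  monomial.\<close>

lemma ekern_monomial:
  assumes "x \<noteq> 0"
  shows "ekern k s x * (z/x)^a * (cnj (z/x))^b = z^a * cnj z^b * ekern (k + int a - int b) (s + 2 * of_nat b) x"
proof -
  have "complex_of_real (cmod x) powr (-(s + 2 * of_nat b)) =
        complex_of_real (cmod x) powr (-s) * complex_of_real (cmod x) powr (of_int (- 2 * int b))"
    by (simp add: powr_add[symmetric])
  also have "of_int (- 2 * int b) = (of_int (- int (2 * b)) :: complex)" by simp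
  also have "complex_of_real (cmod x) powr (of_int (- int (2 * b))) = inverse (complex_of_real (cmod x) ^ (2*b))"
    using assms complex_powr_of_int[of "complex_of_real (cmod x)" "- int (2 * b)"]
    by (simp only: power_int_minus power_int_of_nat) auto
  also have "complex_of_real (cmod x) ^ (2*b) = x^b * cnj x^b"
    by (simp only: power_mult of_real_power[symmetric] complex_norm_square power_mult_distrib)
  finally have 1: "complex_of_real (cmod x) powr (-(s + 2 * of_nat b)) =
        complex_of_real (cmod x) powr (-s) * inverse (x^b * cnj x^b)" .
  have "x powi (-(k + int a - int b)) = x powi (-k) * x powi (- int a) * x powi (int b)"
  proof -
    have "-(k + int a - int b) = (-k + - int a) + int b" by simp
    then show ?thesis by (simp only: power_int_add[OF disjI1[OF assms]])
  qed
  then have 2: "x powi (-(k + int a - int b)) = x powi (-k) * inverse (x^a) * x^b"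
    by (simp add: power_int_minus)
  show ?thesis unfolding ekern_def 1 2 using assms by (simp add: field_simps)
qed

definition ekern_taylor :: "nat \<Rightarrow> int \<Rightarrow> complex \<Rightarrow> complex \<Rightarrow> complex \<Rightarrow> complex" where
  "ekern_taylor J k z s x = (\<Sum>n<J. \<Sum>a\<le>n. ((- of_int k - s/2) gchoose a) * ((-s/2) gchoose (n-a)) * z^a * cnj z^(n-a)
      * ekern (k + int a - int (n-a)) (s + 2 * of_nat (n-a)) x)"

lemma holomorphic_gbinomial [holomorphic_intros]:
  "f holomorphic_on A \<Longrightarrow> (\<lambda>s. f s gchoose n) holomorphic_on A"
  unfolding gbinomial_prod_rev by (intro holomorphic_intros) auto

lemma holomorphic_ekern_taylor [holomorphic_intros]: "(\<lambda>s. ekern_taylor J k z s x) holomorphic_on A"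
  unfolding ekern_taylor_def by (intro holomorphic_intros) auto

lemma ekern_taylor_remainder:
  assumes "x \<noteq> 0" "2 * norm z \<le> norm x"
  shows "norm (ekern k s (x + z) - ekern_taylor J k z s x) \<le>
     (2 * norm z)^J * 2 powr (norm (of_int k + s/2) + norm (s/2)) * norm x powr (-(of_int k + Re s + real J))"
proof -
  define t where "t = norm z / norm x"
  have t: "t \<le> 1/2" using assms by (simp add: t_def field_simps)
  have nt: "norm (z/x) = t" by (simp add: t_def norm_divide)
  have nt': "norm (cnj (z/x)) = t" by (simp only: nt complex_mod_cnj)
  let ?S = "(\<Sum>n<J. \<Sum>a\<le>n. ((- of_int k - s/2) gchoose a) * ((-s/2) gchoose (n-a)) * (z/x)^a * (cnj (z/x))^(n-a))"
  have T: "ekern_taylor J k z s x = ekern k s x * ?S"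
    unfolding ekern_taylor_def sum_distrib_left
  proof (intro sum.cong refl)
    fix n a
    show "((- of_int k - s/2) gchoose a) * ((-s/2) gchoose (n-a)) * z^a * cnj z^(n-a)
      * ekern (k + int a - int (n-a)) (s + 2 * of_nat (n-a)) x =
      ekern k s x * (((- of_int k - s/2) gchoose a) * ((-s/2) gchoose (n-a)) * (z/x)^a * (cnj (z/x))^(n-a))"
      using arg_cong[OF ekern_monomial[OF assms(1), of k s z a "n-a"],
          of "\<lambda>w. ((- of_int k - s/2) gchoose a) * ((-s/2) gchoose (n-a)) * w"] by (simp only: mult_ac)
  qed
  have "ekern k s (x + z) = ekern k s x * ((1 + z/x) powr (- of_int k - s/2) * (1 + cnj (z/x)) powr (-s/2))"
    by (rule ekern_add) (use assms t nt in auto)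
  then have "ekern k s (x + z) - ekern_taylor J k z s x =
     ekern k s x * ((1 + z/x) powr (- of_int k - s/2) * (1 + cnj (z/x)) powr (-s/2) - ?S)"
    by (simp add: T right_diff_distrib)
  then have "norm (ekern k s (x + z) - ekern_taylor J k z s x) =
     norm (ekern k s x) * norm ((1 + z/x) powr (- of_int k - s/2) * (1 + cnj (z/x)) powr (-s/2) - ?S)"
    by (simp only: norm_mult)
  also have "\<dots> \<le> norm (ekern k s x) * ((2*t)^J * 2 powr (norm (- of_int k - s/2) + norm (-s/2)))"
    by (intro mult_left_mono binomial_product_remainder) (use t nt nt' in auto)
  also have "norm (ekern k s x) * ((2*t)^J * 2 powr (norm (- of_int k - s/2) + norm (-s/2))) =
     (2 * norm z)^J * 2 powr (norm (of_int k + s/2) + norm (s/2)) * (norm x powr (-(of_int k + Re s)) / norm x ^ J)"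
  proof -
    have "norm (- of_int k - s/2) = norm (of_int k + s/2)"
      using norm_minus_cancel[of "of_int k + s/2"] by (simp add: algebra_simps)
    then show ?thesis using norm_ekern[OF assms(1), of k s] by (simp add: t_def power_mult_distrib power_divide)
  qed
  also have "norm x powr (-(of_int k + Re s)) / norm x ^ J = norm x powr (-(of_int k + Re s + real J))"
  proof -
    have "norm x powr (-(of_int k + Re s) - real J) = norm x powr (-(of_int k + Re s)) / norm x powr (real J)"
      by (rule powr_diff)
    then show ?thesis using assms(1) by (simp add: powr_realpow)
  qed
  finally show ?thesis .
qed

section \<open>Lattices and convergence\<close>

lemma has_sum_sum:
  fixes f :: "'a \<Rightarrow> 'b \<Rightarrow> 'c::{topological_comm_monoid_add, t2_space}"
  assumes "\<And>i. i \<in> I \<Longrightarrow> (f i has_sum S i) A"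
  shows "((\<lambda>x. \<Sum>i\<in>I. f i x) has_sum (\<Sum>i\<in>I. S i)) A"
  using assms by (induction I rule: infinite_finite_induct) (auto intro: has_sum_add)

lemma summable_int_powr:
  assumes "a > 1"
  shows "(\<lambda>i::int. (1 + \<bar>real_of_int i\<bar>) powr (-a)) summable_on UNIV"
proof -
  have "summable (\<lambda>n. real n powr (-a))" using assms by (simp add: summable_real_powr_iff)
  then have "summable (\<lambda>n. real (Suc n) powr (-a))" using summable_Suc_iff[of "\<lambda>n. real n powr (-a)"] by blast
  then have 1: "(\<lambda>n. (1 + real n) powr (-a)) summable_on UNIV"
    by (subst summable_on_UNIV_nonneg_real_iff) (auto simp: add.commute)
  have "(\<lambda>i::int. (1 + \<bar>real_of_int i\<bar>) powr (-a)) summable_on (range int)"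
    using 1 by (subst summable_on_reindex) (auto simp: o_def)
  moreover have "(\<lambda>i::int. (1 + \<bar>real_of_int i\<bar>) powr (-a)) summable_on (range (\<lambda>n. - int n))"
    using 1 by (subst summable_on_reindex) (auto simp: o_def inj_on_def)
  moreover have "(UNIV :: int set) = range int \<union> range (\<lambda>n. - int n)"
    using int_cases2 by blast
  ultimately show ?thesis using summable_on_union by metis
qed

locale lattice_basis =
  fixes w1 w2 :: complex and L :: "complex set"
  assumes w1: "w1 \<noteq> 0" and im: "Im (w2 / w1) \<noteq> 0"
    and L_eq: "L = {of_int m * w1 + of_int n * w2 | m n. True}"
begin

definition lp :: "int \<Rightarrow> int \<Rightarrow> complex" where "lp i j = of_int i * w1 + of_int j * w2"

lemma L_lp: "L = range (\<lambda>(i,j). lp i j)"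
  by (auto simp: L_eq lp_def image_iff)

lemma lp_in [simp]: "lp i j \<in> L" by (auto simp: L_lp)

lemma L_cases: "x \<in> L \<Longrightarrow> (\<And>i j. x = lp i j \<Longrightarrow> P) \<Longrightarrow> P"
  by (auto simp: L_lp)

lemma lp_add: "lp i j + lp k l = lp (i + k) (j + l)" by (simp add: lp_def algebra_simps)
lemma lp_uminus: "- lp i j = lp (- i) (- j)" by (simp add: lp_def)
lemma lp_scale: "of_int n * lp i j = lp (n * i) (n * j)" by (simp add: lp_def algebra_simps)

lemma L_0 [simp]: "0 \<in> L" using lp_in[of 0 0] by (simp add: lp_def)
lemma L_w1 [simp]: "w1 \<in> L" using lp_in[of 1 0] by (simp add: lp_def)
lemma L_w2 [simp]: "w2 \<in> L" using lp_in[of 0 1] by (simp add: lp_def)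
lemma L_add [intro]: "x \<in> L \<Longrightarrow> y \<in> L \<Longrightarrow> x + y \<in> L" by (auto elim!: L_cases simp: lp_add)
lemma L_uminus [intro]: "x \<in> L \<Longrightarrow> - x \<in> L" by (auto elim!: L_cases simp: lp_uminus)
lemma L_uminus_iff [simp]: "- x \<in> L \<longleftrightarrow> x \<in> L" using L_uminus[of x] L_uminus[of "-x"] by auto
lemma L_diff [intro]: "x \<in> L \<Longrightarrow> y \<in> L \<Longrightarrow> x - y \<in> L" using L_add[of x "-y"] by auto
lemma L_of_int: "x \<in> L \<Longrightarrow> of_int n * x \<in> L" by (auto elim!: L_cases simp: lp_scale)

lemma L_add_iff: "l \<in> L \<Longrightarrow> x + l \<in> L \<longleftrightarrow> x \<in> L"
  using L_diff[of "x+l" l] by auto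

lemma L_add_iff': "l \<in> L \<Longrightarrow> l + x \<in> L \<longleftrightarrow> x \<in> L"
  using L_add_iff[of l x] by (simp add: add.commute)

lemma bij_L_shift: "l \<in> L \<Longrightarrow> bij_betw (\<lambda>x. x + l) L L"
  by (rule bij_betwI[where g = "\<lambda>x. x - l"]) auto

lemma lp_lower: "\<exists>C>0. \<forall>i j. \<bar>real_of_int i\<bar> + \<bar>real_of_int j\<bar> \<le> C * norm (lp i j)"
proof -
  define t where "t = w2 / w1"
  define y where "y = \<bar>Im t\<bar>"
  have y: "y > 0" using im by (simp add: y_def t_def)
  define C where "C = (1 + norm t / y + 1 / y) / norm w1"
  have "\<bar>real_of_int i\<bar> + \<bar>real_of_int j\<bar> \<le> C * norm (lp i j)" for i j
  proof -
    define X where "X = norm (of_int i + of_int j * t)"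
    have X: "norm (lp i j) = norm w1 * X"
    proof -
      have "lp i j = w1 * (of_int i + of_int j * t)" using w1 by (simp add: t_def lp_def field_simps)
      then show ?thesis by (simp add: X_def norm_mult)
    qed
    have "\<bar>Im (of_int i + of_int j * t)\<bar> \<le> X" unfolding X_def by (rule abs_Im_le_cmod)
    then have j: "\<bar>real_of_int j\<bar> * y \<le> X" by (simp add: y_def abs_mult)
    have "norm (complex_of_int i) \<le> X + norm (of_int j * t)"
      unfolding X_def using norm_triangle_ineq4[of "of_int i + of_int j * t" "of_int j * t"] by simp
    then have i: "\<bar>real_of_int i\<bar> \<le> X + \<bar>real_of_int j\<bar> * norm t" by (simp add: norm_mult)
    have j': "\<bar>real_of_int j\<bar> \<le> X / y" using j y by (simp add: field_simps)
    have "\<bar>real_of_int j\<bar> * norm t \<le> X / y * norm t" using j' by (intro mult_right_mono) auto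
    then have "\<bar>real_of_int i\<bar> + \<bar>real_of_int j\<bar> \<le> X + X / y * norm t + X / y" using i j' by linarith
    also have "\<dots> = C * norm (lp i j)" using w1 by (simp add: C_def X field_simps)
    finally show ?thesis .
  qed
  moreover have "C > 0" using y w1 by (auto simp: C_def intro!: divide_pos_pos add_pos_nonneg)
  ultimately show ?thesis by blast
qed

lemma lp_inj: "lp i j = lp k l \<Longrightarrow> i = k \<and> j = l"
proof -
  assume "lp i j = lp k l"
  then have 0: "lp (i - k) (j - l) = 0" by (simp add: lp_def algebra_simps)
  obtain C where "\<bar>real_of_int (i - k)\<bar> + \<bar>real_of_int (j - l)\<bar> \<le> C * norm (lp (i - k) (j - l))"
    using lp_lower by blast
  with 0 show ?thesis by auto
qed

lemma bij_lp: "bij_betw (\<lambda>(i,j). lp i j) UNIV L"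
  by (auto simp: bij_betw_def L_lp inj_on_def dest: lp_inj)

lemma lp_0_iff: "lp i j = 0 \<longleftrightarrow> i = 0 \<and> j = 0"
  using lp_inj[of i j 0 0] by (auto simp: lp_def)

lemma finite_L_ball: "finite {x \<in> L. norm x \<le> R}"
proof -
  obtain C where C: "C > 0" "\<And>i j. \<bar>real_of_int i\<bar> + \<bar>real_of_int j\<bar> \<le> C * norm (lp i j)"
    using lp_lower by blast
  define n where "n = \<lceil>C * R\<rceil>"
  have "{x \<in> L. norm x \<le> R} \<subseteq> (\<lambda>(i,j). lp i j) ` ({-n..n} \<times> {-n..n})"
  proof
    fix x assume "x \<in> {x \<in> L. norm x \<le> R}"
    then obtain i j where x: "x = lp i j" "norm (lp i j) \<le> R" by (auto elim: L_cases)
    have "\<bar>real_of_int i\<bar> + \<bar>real_of_int j\<bar> \<le> C * R"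
      using C(2)[of i j] x(2) C(1) by (meson mult_left_mono less_imp_le order_trans)
    then have "\<bar>real_of_int i\<bar> \<le> real_of_int n" "\<bar>real_of_int j\<bar> \<le> real_of_int n" unfolding n_def by linarith+
    then have "i \<in> {-n..n}" "j \<in> {-n..n}" by auto
    then show "x \<in> (\<lambda>(i,j). lp i j) ` ({-n..n} \<times> {-n..n})" using x by auto
  qed
  then show ?thesis by (rule finite_subset) auto
qed

lemma countable_L: "countable L"
  unfolding L_lp by auto

text \<open>(1 + |i|)(1 + |j|) is at most a constant times |\<open>lp i j\<close>|^2, which reduces
  the double series to a product of two simple ones with exponent \<sigma>/2 > 1.\<close>

lemma summable_L:
  assumes "\<sigma> > 2"
  shows "(\<lambda>x. norm x powr (-\<sigma>)) summable_on L"
proof -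
  obtain C where C: "C > 0" "\<And>i j. \<bar>real_of_int i\<bar> + \<bar>real_of_int j\<bar> \<le> C * norm (lp i j)"
    using lp_lower by blast
  define a where "a = \<sigma>/2"
  have a: "a > 1" using assms by (simp add: a_def)
  define g where "g i = (1 + \<bar>real_of_int i\<bar>) powr (-a)" for i :: int
  have g: "g summable_on UNIV" unfolding g_def by (rule summable_int_powr[OF a])
  have g0: "g i \<ge> 0" for i by (simp add: g_def)
  have "(\<lambda>(i,j). g i * g j) summable_on (UNIV \<times> UNIV)"
    by (rule summable_on_SigmaI[where g = "\<lambda>i. g i * infsum g UNIV"])
       (auto intro!: has_sum_cmult_right has_sum_infsum g summable_on_cmult_left mult_nonneg_nonneg g0)
  then have "(\<lambda>ij. (4 * C^2) powr a * (\<lambda>(i,j). g i * g j) ij) summable_on (UNIV \<times> UNIV)"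
    by (rule summable_on_cmult_right)
  then have "(\<lambda>(i,j). norm (lp i j) powr (-\<sigma>)) summable_on (UNIV \<times> UNIV)"
  proof (rule summable_on_comparison_test)
    fix ij :: "int \<times> int"
    obtain i j where ij: "ij = (i,j)" by (cases ij)
    show "(case ij of (i,j) \<Rightarrow> norm (lp i j) powr (-\<sigma>)) \<le> (4 * C^2) powr a * (case ij of (i,j) \<Rightarrow> g i * g j)"
    proof (cases "i = 0 \<and> j = 0")
      case True then show ?thesis by (simp add: ij lp_def g_def)
    next
      case False
      define m where "m = \<bar>real_of_int i\<bar> + \<bar>real_of_int j\<bar>"
      have "\<bar>i\<bar> + \<bar>j\<bar> \<ge> 1" using False by auto
      then have m: "m \<ge> 1" unfolding m_def by linarith
      have X: "norm (lp i j) > 0" using False by (simp add: lp_0_iff)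
      have "(1 + \<bar>real_of_int i\<bar>) * (1 + \<bar>real_of_int j\<bar>) \<le> (2*m) * (2*m)"
        using m by (intro mult_mono) (auto simp: m_def)
      also have "\<dots> \<le> 4 * (C * norm (lp i j))^2"
        using C(2)[of i j] m unfolding m_def[symmetric] by (simp add: power2_eq_square mult_mono)
      finally have le: "(1 + \<bar>real_of_int i\<bar>) * (1 + \<bar>real_of_int j\<bar>) \<le> 4 * C^2 * (norm (lp i j))^2"
        by (simp add: power_mult_distrib)
      have "(4 * C^2 * (norm (lp i j))^2) powr (-a) \<le> ((1 + \<bar>real_of_int i\<bar>) * (1 + \<bar>real_of_int j\<bar>)) powr (-a)"
        using le a by (intro powr_mono2') (auto intro!: mult_pos_pos add_pos_nonneg)
      also have "\<dots> = g i * g j" by (simp add: g_def powr_mult)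
      finally have "(4 * C^2 * (norm (lp i j))^2) powr (-a) \<le> g i * g j" .
      then have "(4 * C^2) powr a * (4 * C^2 * (norm (lp i j))^2) powr (-a) \<le> (4 * C^2) powr a * (g i * g j)"
        by (intro mult_left_mono) auto
      also have "(4 * C^2) powr a * (4 * C^2 * (norm (lp i j))^2) powr (-a) = ((norm (lp i j))^2) powr (-a)"
      proof -
        have "(4 * C^2) powr a * (4 * C^2) powr (-a) = 1"
          using C(1) by (simp only: powr_add[symmetric]) auto
        then show ?thesis by (simp only: powr_mult[of "4 * C^2"] mult.assoc[symmetric])
      qed
      also have "(norm (lp i j))^2 = norm (lp i j) powr 2" using X powr_realpow[of "norm (lp i j)" 2] by simp
      also have "(norm (lp i j) powr 2) powr (-a) = norm (lp i j) powr (-\<sigma>)"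
        by (simp only: powr_powr a_def) simp
      finally show ?thesis by (simp add: ij)
    qed
  qed auto
  then show ?thesis
    using summable_on_reindex_bij_betw[OF bij_lp, of "\<lambda>x. norm x powr (-\<sigma>)"] by (simp add: case_prod_unfold)
qed

section \<open>Lattice sums of the kernel and of its Taylor remainders\<close>

definition esum :: "int \<Rightarrow> complex \<Rightarrow> complex \<Rightarrow> complex" where
  "esum k s z = infsum (\<lambda>x. ekern k s (x + z)) L"

text \<open>Removing the Taylor terms of degree below \<open>J\<close> moves the half-plane of
  convergence \<open>J\<close> units to the left. At x = 0 the Taylor terms vanish, so the summand
  there is \<open>ekern k s z\<close>.\<close>

definition erest :: "nat \<Rightarrow> int \<Rightarrow> complex \<Rightarrow> complex \<Rightarrow> complex" where
  "erest J k z s = infsum (\<lambda>x. ekern k s (x + z) - ekern_taylor J k z s x) L"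

lemma erest_bound:
  assumes "Re s + of_int k + real J > 2"
  shows "\<exists>r>0. \<exists>B M. finite B \<and> M summable_on (L - B) \<and>
               (\<forall>x\<in>L - B. \<forall>w\<in>ball s r. norm (ekern k w (x + z) - ekern_taylor J k z w x) \<le> M x)"
proof -
  define p where "p = Re s + of_int k + real J"
  define r where "r = (p - 2) / 2"
  have r: "r > 0" "p - r > 2" using assms by (auto simp: r_def p_def field_simps)
  define B where "B = {x \<in> L. norm x \<le> 2 * norm z}"
  define K where "K = (2 * norm z)^J * 2 powr (\<bar>of_int k\<bar> + norm s + r)"
  \<comment> \<open>Two powers are added because the exponent varies within r of p, and which end
    dominates depends on whether |x| is above or below 1.\<close>
  define M where "M x = K * (norm x powr (-(p - r)) + norm x powr (-(p + r)))" for x :: complex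
  have "M summable_on (L - B)" unfolding M_def
    by (intro summable_on_cmult_right summable_on_add summable_on_subset_banach[OF summable_L]) (use r in auto)
  moreover have "norm (ekern k w (x + z) - ekern_taylor J k z w x) \<le> M x" if x: "x \<in> L - B" and w: "w \<in> ball s r" for x w
  proof -
    have x0: "norm x > 2 * norm z" "x \<noteq> 0" using x by (auto simp: B_def)
    define q where "q = of_int k + Re w + real J"
    have dw: "norm (w - s) < r" using w by (simp add: dist_norm norm_minus_commute)
    have "\<bar>q - p\<bar> < r"
      using abs_Re_le_cmod[of "w - s"] dw by (simp add: q_def p_def)
    then have q: "p - r \<le> q" "q \<le> p + r" by auto
    have "norm x powr (-q) \<le> norm x powr (-(p - r)) + norm x powr (-(p + r))"
    proof (cases "norm x \<ge> 1")
      case True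
      then have "norm x powr (-q) \<le> norm x powr (-(p - r))" using q by (intro powr_mono) auto
      then show ?thesis by (simp add: add_increasing2)
    next
      case False
      then have "norm x powr (-q) \<le> norm x powr (-(p + r))" using q x0 by (intro powr_mono') auto
      then show ?thesis by (simp add: add_increasing)
    qed
    moreover have "norm (of_int k + w/2) + norm (w/2) \<le> \<bar>of_int k\<bar> + norm s + r"
      using norm_triangle_ineq[of "of_int k" "w/2"] norm_triangle_ineq[of s "w - s"] dw
      by (simp add: norm_divide)
    then have "(2 * norm z)^J * 2 powr (norm (of_int k + w/2) + norm (w/2)) \<le> K"
      unfolding K_def by (intro mult_left_mono powr_mono) auto
    ultimately have "(2 * norm z)^J * 2 powr (norm (of_int k + w/2) + norm (w/2)) * norm x powr (-q) \<le> M x"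
      unfolding M_def by (intro mult_mono) (auto simp: K_def)
    moreover have "norm (ekern k w (x + z) - ekern_taylor J k z w x) \<le>
        (2 * norm z)^J * 2 powr (norm (of_int k + w/2) + norm (w/2)) * norm x powr (-q)"
      using ekern_taylor_remainder[of x z k w J] x0 by (simp add: q_def)
    ultimately show ?thesis by linarith
  qed
  moreover have "finite B" unfolding B_def by (rule finite_L_ball)
  ultimately show ?thesis using r(1) by blast
qed

lemma
  shows holomorphic_erest: "(\<lambda>s. erest J k z s) holomorphic_on {s. Re s > 2 - of_int k - real J}"
    and summable_erest: "Re s + of_int k + real J > 2 \<Longrightarrow> (\<lambda>x. ekern k s (x + z) - ekern_taylor J k z s x) summable_on L"
proof -
  let ?S = "{s. Re s > 2 - of_int k - real J}"
  have bd: "\<exists>r>0. \<exists>B M. finite B \<and> M summable_on (L - B) \<and>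
               (\<forall>x\<in>L - B. \<forall>w\<in>ball s r \<inter> ?S. norm (ekern k w (x + z) - ekern_taylor J k z w x) \<le> M x)" if "s \<in> ?S" for s
    using erest_bound[of s k J z] that by fastforce
  have hol: "(\<lambda>s. ekern k s (x + z) - ekern_taylor J k z s x) holomorphic_on ?S" for x
    by (intro holomorphic_intros)
  show "(\<lambda>s. erest J k z s) holomorphic_on ?S"
    unfolding erest_def by (rule infsum_holomorphic_deriv(1)[OF open_halfplane_gt hol bd])
  show "Re s + of_int k + real J > 2 \<Longrightarrow> (\<lambda>x. ekern k s (x + z) - ekern_taylor J k z s x) summable_on L"
    by (rule infsum_holomorphic_deriv(2)[OF open_halfplane_gt hol bd]) auto
qed

lemma esum_summable: "Re s + of_int k > 2 \<Longrightarrow> (\<lambda>x. ekern k s (x + z)) summable_on L"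
  using summable_erest[of s k 0 z] by (simp add: ekern_taylor_def)

lemma esum_summable0: "Re s + of_int k > 2 \<Longrightarrow> (\<lambda>x. ekern k s x) summable_on L"
  using esum_summable[of s k 0] by simp

lemma esum_holomorphic: "(\<lambda>s. esum k s z) holomorphic_on {s. Re s > 2 - of_int k}"
  using holomorphic_erest[of 0 k z] by (simp add: erest_def esum_def[abs_def] ekern_taylor_def)

lemma esum_expand:
  assumes "Re s + of_int k > 2"
  shows "esum k s z = erest J k z s + (\<Sum>n<J. \<Sum>a\<le>n. ((- of_int k - s/2) gchoose a) * ((-s/2) gchoose (n-a)) * z^a * cnj z^(n-a)
      * esum (k + int a - int (n-a)) (s + 2 * of_nat (n-a)) 0)"
proof -
  have hs: "((\<lambda>x. ekern_taylor J k z s x) has_sum (\<Sum>n<J. \<Sum>a\<le>n. ((- of_int k - s/2) gchoose a) * ((-s/2) gchoose (n-a)) * z^a * cnj z^(n-a)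
      * esum (k + int a - int (n-a)) (s + 2 * of_nat (n-a)) 0)) L"
    unfolding ekern_taylor_def
  proof (intro has_sum_sum has_sum_cmult_right)
    fix n a assume na: "n \<in> {..<J}" "a \<in> {..n}"
    then have "Re (s + 2 * of_nat (n-a)) + of_int (k + int a - int (n-a)) = Re s + of_int k + real n"
      by (simp add: of_nat_diff)
    then show "(ekern (k + int a - int (n-a)) (s + 2 * of_nat (n-a)) has_sum esum (k + int a - int (n-a)) (s + 2 * of_nat (n-a)) 0) L"
      unfolding esum_def using assms by (auto intro!: has_sum_infsum esum_summable0)
  qed
  have "((\<lambda>x. (ekern k s (x + z) - ekern_taylor J k z s x) + ekern_taylor J k z s x) has_sum
     (erest J k z s + (\<Sum>n<J. \<Sum>a\<le>n. ((- of_int k - s/2) gchoose a) * ((-s/2) gchoose (n-a)) * z^a * cnj z^(n-a)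
      * esum (k + int a - int (n-a)) (s + 2 * of_nat (n-a)) 0))) L"
    unfolding erest_def by (intro has_sum_add hs has_sum_infsum summable_erest) (use assms in auto)
  then show ?thesis by (simp add: esum_def infsumI)
qed

lemma eis_series_esum: "eis_series L k z s = esum (int k) s z"
  unfolding eis_series_def esum_def
proof (rule infsum_cong_neutral)
  fix x assume "x \<in> {x \<in> L. x + z \<noteq> 0} \<inter> L"
  show "inverse ((x + z) ^ k) * complex_of_real (cmod (x + z)) powr - s = ekern (int k) s (x + z)"
    by (simp add: ekern_def power_int_minus)
qed auto

end

section \<open>Averages over a lattice and multipliers\<close>

lemma periodic_int_add:
  fixes g :: "int \<Rightarrow> 'a"
  assumes "\<And>i. g (i + n) = g i"
  shows "g (i + n * q) = g i"
proof (induction q rule: int_induct[of _ 0])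
  case (step1 q)
  then show ?case using assms[of "i + n * q"] by (simp add: algebra_simps)
next
  case (step2 q)
  then show ?case using assms[of "i + n * (q - 1)"] by (simp add: algebra_simps)
qed auto

lemma sum_periodic_shift:
  fixes g :: "int \<Rightarrow> 'a::comm_monoid_add"
  assumes per: "\<And>i. g (i + n) = g i" and n: "n > 0"
  shows "(\<Sum>i\<in>{0..<n}. g (i + k)) = (\<Sum>i\<in>{0..<n}. g i)"
proof (rule sum.reindex_bij_witness[where i = "\<lambda>i. (i - k) mod n" and j = "\<lambda>i. (i + k) mod n"])
  fix i assume i: "i \<in> {0..<n}"
  show "((i + k) mod n - k) mod n = i" "((i - k) mod n + k) mod n = i"
    using i by (simp_all add: mod_simps)
  show "(i + k) mod n \<in> {0..<n}" "(i - k) mod n \<in> {0..<n}" using n by auto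
  have "g ((i + k) mod n + n * ((i + k) div n)) = g ((i + k) mod n)" by (rule periodic_int_add[of g n, OF per])
  then show "g ((i + k) mod n) = g (i + k)" by simp
qed

lemma sum_dvd_indicator:
  fixes h n k :: int
  assumes "h > 0" "h dvd n" "n > 0"
  shows "(\<Sum>i\<in>{0..<n}. if h dvd (i - k) then 1 else 0 :: real) = of_int n / of_int h"
proof -
  obtain q where q: "n = h * q" using assms(2) by blast
  have "(\<Sum>i\<in>{0..<n}. if h dvd (i - k) then 1 else 0 :: real) = (\<Sum>i\<in>{0..<n}. if h dvd i then 1 else 0)"
    using sum_periodic_shift[of "\<lambda>i. if h dvd i then 1 else 0 :: real" n "-k"] assms
    by (simp add: dvd_add_left_iff)
  also have "\<dots> = real (card {i \<in> {0..<n}. h dvd i})"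
    by (subst sum.inter_filter[symmetric]) auto
  also have "{i \<in> {0..<n}. h dvd i} = (\<lambda>i. h * i) ` {0..<q}"
    using assms(1) by (auto simp: q image_iff elim!: dvdE simp: zero_le_mult_iff)
  also have "card \<dots> = nat q" using assms(1) by (subst card_image) (auto simp: inj_on_def)
  also have "real (nat q) = of_int n / of_int h" using assms by (auto simp: q zero_less_mult_iff)
  finally show ?thesis .
qed

context lattice_basis
begin

definition periodic :: "nat \<Rightarrow> (complex \<Rightarrow> 'a) \<Rightarrow> bool" where
  "periodic N g \<longleftrightarrow> (\<forall>x\<in>L. \<forall>l\<in>L. g (x + of_nat N * l) = g x)"

text \<open>For \<open>N\<close>-periodic functions this is the sum over L/NL. A rational integer as
  modulus makes a box of coordinates a system of representatives.\<close>

definition bsum :: "nat \<Rightarrow> (complex \<Rightarrow> 'a::comm_monoid_add) \<Rightarrow> 'a" where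
  "bsum N g = (\<Sum>i\<in>{0..<int N}. \<Sum>j\<in>{0..<int N}. g (lp i j))"

lemma bsum_cong: "(\<And>x. x \<in> L \<Longrightarrow> f x = g x) \<Longrightarrow> bsum N f = bsum N g"
  by (simp add: bsum_def)

lemma bsum_add: "bsum N (\<lambda>x. f x + g x) = bsum N f + bsum N g"
  by (simp add: bsum_def sum.distrib)

lemma bsum_uminus: "bsum N (\<lambda>x. - f x :: 'a::ab_group_add) = - bsum N f"
  by (simp add: bsum_def sum_negf)

lemma bsum_diff: "bsum N (\<lambda>x. f x - g x :: 'a::ab_group_add) = bsum N f - bsum N g"
  by (simp add: bsum_def sum_subtractf)

lemma bsum_cmult: "bsum N (\<lambda>x. c * f x :: 'a::semiring_0) = c * bsum N f"
  by (simp add: bsum_def sum_distrib_left)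

lemma bsum_cmult_right: "bsum N (\<lambda>x. f x * c :: 'a::semiring_0) = bsum N f * c"
  by (simp add: bsum_def sum_distrib_right)

lemma bsum_const: "bsum N (\<lambda>x. c :: 'a::comm_ring_1) = of_nat N^2 * c"
  by (simp add: bsum_def power2_eq_square)

lemma bsum_prod: "bsum N g = (\<Sum>p\<in>{0..<int N}\<times>{0..<int N}. g (lp (fst p) (snd p)))"
  by (simp add: bsum_def sum.cartesian_product case_prod_unfold)

lemma bsum_swap: "bsum N (\<lambda>x. bsum M (\<lambda>y. f x y)) = bsum M (\<lambda>y. bsum N (\<lambda>x. f x y))"
  unfolding bsum_prod by (rule sum.swap)

lemma bsum_shift:
  assumes per: "periodic N g" and N: "N > 0" and l: "l \<in> L"
  shows "bsum N (\<lambda>x. g (x + l)) = bsum N g"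
proof -
  obtain p q where l: "l = lp p q" using l by (auto elim: L_cases)
  have 1: "g (lp (i + int N) j) = g (lp i j)" for i j
  proof -
    have "lp (i + int N) j = lp i j + of_nat N * lp 1 0" by (simp add: lp_def algebra_simps)
    then show ?thesis using per by (simp add: periodic_def)
  qed
  have 2: "g (lp i (j + int N)) = g (lp i j)" for i j
  proof -
    have "lp i (j + int N) = lp i j + of_nat N * lp 0 1" by (simp add: lp_def algebra_simps)
    then show ?thesis using per by (simp add: periodic_def)
  qed
  have "bsum N (\<lambda>x. g (x + l)) = (\<Sum>i\<in>{0..<int N}. \<Sum>j\<in>{0..<int N}. g (lp (i + p) (j + q)))"
    by (simp add: bsum_def l lp_add)
  also have "\<dots> = (\<Sum>i\<in>{0..<int N}. \<Sum>j\<in>{0..<int N}. g (lp (i + p) j))"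
    by (intro sum.cong refl sum_periodic_shift) (use 2 N in auto)
  also have "\<dots> = (\<Sum>i\<in>{0..<int N}. \<Sum>j\<in>{0..<int N}. g (lp i j))"
    by (rule sum_periodic_shift[where g = "\<lambda>i. \<Sum>j\<in>{0..<int N}. g (lp i j)"]) (use 1 N in auto)
  finally show ?thesis by (simp add: bsum_def)
qed

section \<open>The ring of multipliers, its norm and trace\<close>

lemma multipliersD: "m \<in> multipliers L \<Longrightarrow> x \<in> L \<Longrightarrow> m * x \<in> L"
  by (auto simp: multipliers_def)

lemma multipliersI: "(\<And>x. x \<in> L \<Longrightarrow> m * x \<in> L) \<Longrightarrow> m \<in> multipliers L"
  by (auto simp: multipliers_def)

lemma multipliers_add: "m \<in> multipliers L \<Longrightarrow> n \<in> multipliers L \<Longrightarrow> m + n \<in> multipliers L"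
  by (intro multipliersI) (auto simp: ring_distribs multipliersD)
lemma multipliers_mult: "m \<in> multipliers L \<Longrightarrow> n \<in> multipliers L \<Longrightarrow> m * n \<in> multipliers L"
  by (intro multipliersI) (auto simp: mult.assoc multipliersD)
lemma multipliers_uminus: "m \<in> multipliers L \<Longrightarrow> - m \<in> multipliers L"
  by (intro multipliersI) (auto simp: multipliersD)
lemma multipliers_of_int: "of_int n \<in> multipliers L"
  by (intro multipliersI) (auto simp: L_of_int)
lemma multipliers_of_nat: "of_nat n \<in> multipliers L"
  using multipliers_of_int[of "int n"] by simp
lemma multipliers_0: "0 \<in> multipliers L" using multipliers_of_int[of 0] by simp
lemma multipliers_1: "1 \<in> multipliers L" using multipliers_of_int[of 1] by simp
lemma multipliers_diff: "m \<in> multipliers L \<Longrightarrow> n \<in> multipliers L \<Longrightarrow> m - n \<in> multipliers L"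
  using multipliers_add[of m "-n"] multipliers_uminus[of n] by simp

text \<open>With t = w2/w1 one has (a + b t) t = c + d t. The imaginary part gives 2 b Re t = d - a,
  then the real part gives c = - b |t|^2; norm and trace follow by substitution. This is how
  multipliers become closed under conjugation.\<close>

lemma multiplier_matrix:
  assumes "m \<in> multipliers L"
  obtains a b c d where "m * w1 = lp a b" "m * w2 = lp c d"
    "(norm m)^2 = of_int (a * d - b * c)" "m + cnj m = of_int (a + d)"
proof -
  obtain a b where ab: "m * w1 = lp a b" using multipliersD[OF assms L_w1] by (auto elim: L_cases)
  obtain c d where cd: "m * w2 = lp c d" using multipliersD[OF assms L_w2] by (auto elim: L_cases)
  define t where "t = w2 / w1"
  define x where "x = Re t"
  define y where "y = Im t"
  have y: "y \<noteq> 0" using im by (simp add: y_def t_def)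
  have m: "m = of_int a + of_int b * t" using ab w1 by (simp add: t_def lp_def field_simps)
  have mt: "m * t = of_int c + of_int d * t" using cd w1 by (simp add: t_def lp_def field_simps)
  have "(of_int a + of_int b * t) * t = of_int c + of_int d * t" using m mt by simp
  then have re: "(a + b * x) * x - b * y * y = c + d * x" and "(a + b * x) * y + b * y * x = d * y"
    by (simp_all add: complex_eq_iff x_def y_def)
  then have "(2 * b * x) * y = (d - a) * y" by (simp add: algebra_simps)
  then have tr: "2 * b * x = of_int d - of_int a" using y by simp
  have c: "c = - b * (x^2 + y^2)"
  proof -
    have "real_of_int c = a * x + b * x^2 - b * y^2 - d * x" using re by (simp add: algebra_simps power2_eq_square)
    also have "\<dots> = - (of_int d - of_int a) * x + b * x^2 - b * y^2" by (simp add: algebra_simps)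
    also have "\<dots> = - b * (x^2 + y^2)" unfolding tr[symmetric] by (simp add: algebra_simps power2_eq_square)
    finally show ?thesis .
  qed
  have mxy: "Re m = a + b * x" "Im m = b * y" by (simp_all add: m x_def y_def)
  have "(norm m)^2 = a^2 + a * (2 * b * x) + b * (b * (x^2 + y^2))"
    unfolding cmod_power2 mxy by (simp add: power2_eq_square algebra_simps)
  also have "\<dots> = a^2 + a * (of_int d - of_int a) - b * c" unfolding tr by (simp add: c algebra_simps)
  finally have 1: "(norm m)^2 = of_int (a * d - b * c)" by (simp add: algebra_simps power2_eq_square)
  have "m + cnj m = of_real (2 * Re m)" by (rule complex_add_cnj)
  also have "2 * Re m = of_int (a + d)" using tr by (simp add: mxy)
  finally have "m + cnj m = of_int (a + d)" by simp
  with 1 ab cd that show ?thesis by blast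
qed

lemma multipliers_cnj:
  assumes "m \<in> multipliers L" shows "cnj m \<in> multipliers L"
proof -
  obtain k where "m + cnj m = of_int k" using multiplier_matrix[OF assms] by metis
  then have "cnj m = of_int k - m" by (simp add: algebra_simps)
  then show ?thesis using assms by (simp add: multipliers_diff multipliers_of_int)
qed

lemma multiplier_norm:
  assumes "m \<in> multipliers L"
  obtains N where "(norm m)^2 = of_nat N" "m * cnj m = of_nat N"
proof -
  obtain k :: int where k: "(norm m)^2 = of_int k" using multiplier_matrix[OF assms] by metis
  then have "k \<ge> 0" using zero_le_power2[of "norm m"] by simp
  then have 1: "(norm m)^2 = of_nat (nat k)" using k by simp
  moreover have "m * cnj m = of_nat (nat k)"
    using complex_norm_square[of m] 1 by simp
  ultimately show ?thesis using that by blast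
qed

definition msub :: "complex \<Rightarrow> complex set" where "msub m = (\<lambda>x. m * x) ` L"

lemma msub_iff: "m \<noteq> 0 \<Longrightarrow> x \<in> msub m \<longleftrightarrow> x / m \<in> L"
  by (auto simp: msub_def image_iff intro!: bexI[of _ "x / m"])

text \<open>The index of mL in L is |m|^2. The matrix of m is brought to Hermite form: mL is
  generated by \<open>lp h 0\<close> and \<open>lp e g\<close> with g h = |m|^2, so membership is
  one divisibility in j and then one in i, each counted separately.\<close>

lemma bsum_msub:
  assumes m: "m \<in> multipliers L" "m \<noteq> 0" and n: "n \<in> multipliers L" "of_nat N = m * n" and N: "N > 0"
  shows "bsum N (\<lambda>x. if x / m \<in> L then 1 else 0 :: real) = real N^2 / (norm m)^2"
proof -
  obtain a b c d where M1: "m * w1 = lp a b" and M2: "m * w2 = lp c d" and det: "(norm m)^2 = of_int (a * d - b * c)"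
    by (rule multiplier_matrix[OF m(1)])
  have det0: "a * d - b * c > 0" using det m(2) by (metis of_int_0_less_iff zero_less_norm_iff zero_less_power)
  define g where "g = gcd b d"
  have "b \<noteq> 0 \<or> d \<noteq> 0" using det0 by auto
  then have g0: "g > 0" by (simp add: g_def)
  obtain b' d' where b': "b = g * b'" and d': "d = g * d'" unfolding g_def by (meson dvd_def gcd_dvd1 gcd_dvd2)
  obtain p q where pq: "p * b + q * d = g" unfolding g_def using bezout_int by blast
  have "g * (p * b' + q * d') = g * 1" using pq b' d' by (simp add: algebra_simps)
  then have pq': "p * b' + q * d' = 1" using g0 by simp
  define h where "h = a * d' - b' * c"
  define e where "e = p * a + q * c"
  have gh: "g * h = a * d - b * c" by (simp add: h_def b' d' algebra_simps)
  then have "g * h > 0" using det0 by simp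
  then have h0: "h > 0" using g0 by (rule zero_less_mult_pos)
  have mem: "lp i j / m \<in> L \<longleftrightarrow> (\<exists>\<alpha> \<beta>. i = \<alpha> * h + \<beta> * e \<and> j = \<beta> * g)" (is "?l \<longleftrightarrow> ?r") for i j
  proof
    assume ?l
    then obtain k l where "lp i j / m = lp k l" by (auto elim: L_cases)
    then have "lp i j = m * lp k l" using m(2) by (simp add: field_simps)
    also have "\<dots> = of_int k * lp a b + of_int l * lp c d"
      unfolding M1[symmetric] M2[symmetric] by (simp add: lp_def algebra_simps)
    also have "\<dots> = lp (k * a + l * c) (k * b + l * d)" by (simp add: lp_def algebra_simps)
    finally have ij: "i = k * a + l * c" "j = k * b + l * d" using lp_inj by blast+
    define \<alpha> where "\<alpha> = k * q - l * p"
    define \<beta> where "\<beta> = k * b' + l * d'"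
    have "\<alpha> * h + \<beta> * e = (k * a + l * c) * (p * b' + q * d')"
      by (simp add: \<alpha>_def \<beta>_def h_def e_def algebra_simps)
    then have "i = \<alpha> * h + \<beta> * e" using pq' ij by simp
    moreover have "j = \<beta> * g" using ij by (simp add: \<beta>_def b' d' algebra_simps)
    ultimately show ?r by blast
  next
    assume ?r
    then obtain \<alpha> \<beta> where ij: "i = \<alpha> * h + \<beta> * e" "j = \<beta> * g" by blast
    define k where "k = \<alpha> * d' + \<beta> * p"
    define l where "l = - \<alpha> * b' + \<beta> * q"
    have "m * lp k l = of_int k * lp a b + of_int l * lp c d"
      unfolding M1[symmetric] M2[symmetric] by (simp add: lp_def algebra_simps)
    also have "\<dots> = lp (k * a + l * c) (k * b + l * d)" by (simp add: lp_def algebra_simps)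
    also have "k * a + l * c = i" by (simp add: k_def l_def ij h_def e_def algebra_simps)
    also have "k * b + l * d = j"
    proof -
      have "k * b + l * d = \<beta> * (p * b + q * d)" by (simp add: k_def l_def b' d' algebra_simps)
      then show ?thesis by (simp add: pq ij)
    qed
    finally have "lp i j / m = lp k l" using m(2) by (simp add: field_simps)
    then show ?l by simp
  qed
  have nL: "n * x \<in> L" if "x \<in> L" for x using multipliersD n that by blast
  \<comment> \<open>N = m n puts NL inside mL; read off on the two basis vectors, this makes
    \<open>h\<close> and \<open>g\<close> divide N.\<close>
  have "lp (int N) 0 / m = n * w1" "lp 0 (int N) / m = n * w2"
    using m(2) n(2) by (simp_all add: lp_def)
  then have NL: "lp (int N) 0 / m \<in> L" "lp 0 (int N) / m \<in> L" using nL by auto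
  have hN: "h dvd int N" using NL(1) g0 unfolding mem by auto
  have gN: "g dvd int N" using NL(2) unfolding mem by auto
  have mem2: "lp i j / m \<in> L \<longleftrightarrow> g dvd j \<and> h dvd (i - (j div g) * e)" for i j
  proof
    assume "lp i j / m \<in> L" then show "g dvd j \<and> h dvd (i - (j div g) * e)" using g0 by (auto simp: mem)
  next
    assume "g dvd j \<and> h dvd (i - (j div g) * e)"
    then obtain \<alpha> where "i - (j div g) * e = h * \<alpha>" "j = (j div g) * g" by auto
    then show "lp i j / m \<in> L" unfolding mem by (intro exI[of _ \<alpha>] exI[of _ "j div g"]) (auto simp: algebra_simps)
  qed
  have "bsum N (\<lambda>x. if x / m \<in> L then 1 else 0 :: real) =
     (\<Sum>j\<in>{0..<int N}. \<Sum>i\<in>{0..<int N}. if g dvd j \<and> h dvd (i - (j div g) * e) then 1 else 0)"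
    unfolding bsum_def mem2 by (rule sum.swap)
  also have "\<dots> = (\<Sum>j\<in>{0..<int N}. if g dvd (j - 0) then real N / of_int h else 0)"
    using sum_dvd_indicator[OF h0 hN] N by (intro sum.cong refl) auto
  also have "\<dots> = (\<Sum>j\<in>{0..<int N}. real N / of_int h * (if g dvd (j - 0) then 1 else 0))"
    by (intro sum.cong refl) auto
  also have "\<dots> = real N / of_int h * (real N / of_int g)"
    using sum_dvd_indicator[OF g0 gN, of 0] N by (simp only: sum_distrib_left[symmetric])
  also have "\<dots> = real N^2 / of_int (g * h)" by (simp add: power2_eq_square)
  finally show ?thesis using det gh by simp
qed

lemma periodic_indicator:
  assumes "m \<in> multipliers L" "m \<noteq> 0" "n \<in> multipliers L" "of_nat N = m * n"
  shows "periodic N (\<lambda>x. F (if (x + z) / m \<in> L then u else v))"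
proof -
  have "(x + of_nat N * l + z) / m \<in> L \<longleftrightarrow> (x + z) / m \<in> L" if "l \<in> L" for x l
  proof -
    have "(x + of_nat N * l + z) / m = (x + z) / m + n * l" using assms by (simp add: field_simps)
    then show ?thesis using L_add_iff[of "n * l"] multipliersD[OF assms(3) that] by simp
  qed
  then show ?thesis unfolding periodic_def by simp
qed

text \<open>The sum at (z + x)/m is, up to the kernel factor, the sum over the coset x + mL. A point
  of L lies in the cosets of N^2/|m|^2 of the representatives x, so exchanging the two sums gives a
  multiple of the full sum.\<close>

lemma esum_distribution:
  assumes m: "m \<in> multipliers L" "m \<noteq> 0" and n: "n \<in> multipliers L" "of_nat N = m * n" and N: "N > 0"
    and s: "Re s + of_int k > 2"
  shows "bsum N (\<lambda>x. esum k s ((z + x) / m)) = of_nat N^2 / (of_real (norm m))^2 * ekern k s (1/m) * esum k s z"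
proof -
  define f where "f l = ekern k s (l + z)" for l
  have fs: "f summable_on L" unfolding f_def by (rule esum_summable[OF s])
  have 1: "esum k s ((z + x) / m) = ekern k s (1/m) * infsum (\<lambda>l. if (l - x) / m \<in> L then f l else 0) L"
    and 2: "(\<lambda>l. if (l - x) / m \<in> L then f l else 0) summable_on L" if x: "x \<in> L" for x
  proof -
    have "esum k s ((z + x) / m) = infsum (\<lambda>y. ekern k s (1/m) * f (x + m * y)) L"
      unfolding esum_def f_def by (intro infsum_cong, subst ekern_mult[symmetric]) (use m(2) in \<open>simp add: field_simps\<close>)
    also have "\<dots> = ekern k s (1/m) * infsum (\<lambda>y. f (x + m * y)) L" by (rule infsum_cmult_right')
    also have "infsum (\<lambda>y. f (x + m * y)) L = infsum f ((\<lambda>y. x + m * y) ` L)"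
      using infsum_reindex[of "\<lambda>y. x + m * y" L f] m(2) by (simp add: inj_on_def o_def)
    also have "(\<lambda>y. x + m * y) ` L = {l \<in> L. (l - x) / m \<in> L}"
    proof (intro equalityI subsetI)
      fix l assume "l \<in> (\<lambda>y. x + m * y) ` L"
      then obtain y where y: "y \<in> L" "l = x + m * y" by blast
      then have "l \<in> L" using x multipliersD[OF m(1)] by blast
      moreover have "(l - x) / m = y" using y m(2) by simp
      ultimately show "l \<in> {l \<in> L. (l - x) / m \<in> L}" using y by simp
    next
      fix l assume "l \<in> {l \<in> L. (l - x) / m \<in> L}"
      moreover have "l = x + m * ((l - x) / m)" using m(2) by simp
      ultimately show "l \<in> (\<lambda>y. x + m * y) ` L" by blast
    qed
    also have "infsum f {l \<in> L. (l - x) / m \<in> L} = infsum (\<lambda>l. if (l - x) / m \<in> L then f l else 0) L"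
      by (rule infsum_cong_neutral) auto
    finally show "esum k s ((z + x) / m) = ekern k s (1/m) * infsum (\<lambda>l. if (l - x) / m \<in> L then f l else 0) L" .
    have "f summable_on {l \<in> L. (l - x) / m \<in> L}" by (rule summable_on_subset_banach[OF fs]) auto
    then show "(\<lambda>l. if (l - x) / m \<in> L then f l else 0) summable_on L"
      by (subst summable_on_cong_neutral[where g = f and T = "{l \<in> L. (l - x) / m \<in> L}"]) auto
  qed
  have cnt: "bsum N (\<lambda>x. if (l - x) / m \<in> L then f l else 0) = of_nat N^2 / (of_real (norm m))^2 * f l" if l: "l \<in> L" for l
  proof -
    have "bsum N (\<lambda>x. if (l - x) / m \<in> L then f l else 0) = bsum N (\<lambda>x. f l * of_real (if (x + - l) / m \<in> L then 1 else 0))"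
    proof (rule bsum_cong)
      fix x
      have "(l - x) / m = - ((x + - l) / m)" using minus_divide_left[of "x + - l" m] by simp
      then show "(if (l - x) / m \<in> L then f l else 0) = f l * of_real (if (x + - l) / m \<in> L then 1 else 0)"
        by (simp only: L_uminus_iff) auto
    qed
    also have "\<dots> = f l * bsum N (\<lambda>x. of_real (if (x + - l) / m \<in> L then 1 else 0))" by (rule bsum_cmult)
    also have "bsum N (\<lambda>x. of_real (if (x + - l) / m \<in> L then 1 else 0) :: complex) = bsum N (\<lambda>x. of_real (if x / m \<in> L then 1 else 0))"
      using bsum_shift[OF periodic_indicator[OF m n, of of_real 0 1 0] N, of "-l"] l by simp
    also have "\<dots> = of_real (bsum N (\<lambda>x. if x / m \<in> L then 1 else 0))"
      by (simp add: bsum_def)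
    also have "\<dots> = of_nat N^2 / (of_real (norm m))^2"
      by (subst bsum_msub[OF m n N]) simp
    finally show ?thesis by simp
  qed
  have "bsum N (\<lambda>x. esum k s ((z + x) / m)) = bsum N (\<lambda>x. ekern k s (1/m) * infsum (\<lambda>l. if (l - x) / m \<in> L then f l else 0) L)"
    by (rule bsum_cong) (use 1 in auto)
  also have "\<dots> = ekern k s (1/m) * bsum N (\<lambda>x. infsum (\<lambda>l. if (l - x) / m \<in> L then f l else 0) L)" by (rule bsum_cmult)
  also have "bsum N (\<lambda>x. infsum (\<lambda>l. if (l - x) / m \<in> L then f l else 0) L) =
      infsum (\<lambda>l. bsum N (\<lambda>x. if (l - x) / m \<in> L then f l else 0)) L"
    unfolding bsum_def by (rule infsumI[symmetric]) (intro has_sum_sum has_sum_infsum 2 lp_in)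
  also have "\<dots> = infsum (\<lambda>l. of_nat N^2 / (of_real (norm m))^2 * f l) L"
    by (rule infsum_cong) (rule cnt)
  also have "\<dots> = of_nat N^2 / (of_real (norm m))^2 * esum k s z"
    unfolding esum_def f_def by (rule infsum_cmult_right')
  finally show ?thesis by (simp add: mult_ac)
qed

end

section \<open>Analytic continuation\<close>

text \<open>Weight 0 is an Epstein zeta function, with a simple pole at s = 2; the other weights
  have entire continuations.\<close>

definition pole_factor :: "int \<Rightarrow> complex \<Rightarrow> complex" where
  "pole_factor k s = (if k = 0 then s - 2 else 1)"

text \<open>The simple pole of the weight-zero series is cancelled by a zero of its Taylor coefficient.\<close>
lemma taylor_coeff_cancels_pole:
  fixes k :: int
  assumes "a + b \<ge> 1"
  shows "\<exists>C. C holomorphic_on UNIV \<and>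
     (\<forall>s. ((- of_int k - s/2) gchoose a) * ((-s/2) gchoose b) = C s * pole_factor (k + int a - int b) (s + 2 * of_nat b))"
proof (cases "k + int a - int b = 0")
  case False
  then show ?thesis
    by (intro exI[of _ "\<lambda>s. ((- of_int k - s/2) gchoose a) * ((-s/2) gchoose b)"])
       (auto simp: pole_factor_def intro!: holomorphic_intros)
next
  case True
  show ?thesis
  proof (cases a)
    case 0
    then obtain c where c: "b = Suc c" using assms by (cases b) auto
    have "((- of_int k - s/2) gchoose a) * ((-s/2) gchoose b) =
        (((-s/2) gchoose c) / (of_nat (Suc c) * (-2))) * (s + 2 * of_nat b - 2)" for s :: complex
      by (simp add: 0 c gbinomial_Suc_step field_simps del: of_nat_Suc) (simp add: algebra_simps)
    then show ?thesis using True
      by (intro exI[of _ "\<lambda>s. (((-s/2) gchoose c) / (of_nat (Suc c) * (-2)))"])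
         (auto simp: pole_factor_def intro!: holomorphic_intros simp del: of_nat_Suc)
  next
    case (Suc c)
    have kc: "of_int k = (of_nat b - of_nat a :: complex)"
    proof -
      have "k = int b - int a" using True by simp
      then show ?thesis by simp
    qed
    have "((- of_int k - s/2) gchoose a) * ((-s/2) gchoose b) =
        (((- of_int k - s/2) gchoose c) * ((-s/2) gchoose b) / (of_nat (Suc c) * (-2))) * (s + 2 * of_nat b - 2)" for s :: complex
    proof -
      have e: "(- of_int k - s/2) - of_nat c = (s + 2 * of_nat b - 2) / (-2 :: complex)"
        by (simp add: kc Suc field_simps)
      show ?thesis unfolding Suc gbinomial_Suc_step[of "- of_int k - s/2" c] e
        by (simp only: times_divide_eq_right times_divide_eq_left divide_divide_eq_left mult_ac)
    qed
    then show ?thesis using True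
      by (intro exI[of _ "\<lambda>s. (((- of_int k - s/2) gchoose c) * ((-s/2) gchoose b) / (of_nat (Suc c) * (-2)))"])
         (auto simp: pole_factor_def intro!: holomorphic_intros simp del: of_nat_Suc)
  qed
qed

text \<open>Otherwise u ln 2 and u ln 3 are nonzero integer multiples of 2 pi i, hence a power of 2
  equals a power of 3 with nontrivial exponents; parity excludes this.\<close>

lemma two_powers_separate:
  fixes u :: complex
  assumes "2 powr u = 1" "3 powr u = 1"
  shows "u = 0"
proof (rule ccontr)
  assume u: "u \<noteq> 0"
  have "exp (u * of_real (ln 2)) = 1" "exp (u * of_real (ln 3)) = 1"
    using assms Ln_of_real[of 2] Ln_of_real[of 3] by (simp_all add: powr_def)
  then obtain m n :: int where mn: "Im (u * of_real (ln 2)) = of_int (2 * m) * pi" "Re (u * of_real (ln 2)) = 0"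
     "Im (u * of_real (ln 3)) = of_int (2 * n) * pi" by (auto simp: exp_eq_1)
  have m0: "m \<noteq> 0" using mn u by (auto simp: complex_eq_iff)
  have "Im u * ln 2 * of_int n = Im u * ln 3 * of_int m" using mn by (simp add: field_simps)
  moreover have "Im u \<noteq> 0" using mn u by (auto simp: complex_eq_iff)
  ultimately have eq: "of_int n * ln 2 = of_int m * ln (3::real)" by (simp add: mult.commute)
  then have "\<bar>of_int n\<bar> * ln 2 = \<bar>of_int m\<bar> * ln (3::real)"
    by (metis abs_mult abs_of_pos ln_gt_zero one_less_numeral_iff semiring_norm(76) semiring_norm(77))
  then have "real (nat \<bar>n\<bar>) * ln 2 = real (nat \<bar>m\<bar>) * ln 3" by simp
  then have "ln ((2::real) ^ nat \<bar>n\<bar>) = ln (3 ^ nat \<bar>m\<bar>)" by (simp add: ln_realpow)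
  then have "(2::real) ^ nat \<bar>n\<bar> = 3 ^ nat \<bar>m\<bar>" by simp
  then have "(2::nat) ^ nat \<bar>n\<bar> = 3 ^ nat \<bar>m\<bar>" by (metis of_nat_eq_iff of_nat_numeral of_nat_power)
  moreover have "odd ((3::nat) ^ nat \<bar>m\<bar>)" by simp
  ultimately have "nat \<bar>n\<bar> = 0" by (metis even_numeral even_power zero_less_iff_neq_zero)
  then show False using eq m0 by simp
qed

section \<open>Complex multiplication and the scaling factors\<close>

locale cm_lattice = lattice_basis +
  fixes \<mu> :: complex
  assumes mu: "\<mu> \<in> multipliers L" "Im \<mu> \<noteq> 0"
begin

text \<open>If it failed, m / cnj m would be a root of unity of order dividing |k| for all nonzero
  multipliers m, but m = n + \<mu> yields infinitely many such quotients.\<close>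

lemma multiplier_argument:
  assumes "k \<noteq> (0::int)"
  shows "\<exists>m\<in>multipliers L. m \<noteq> 0 \<and> m powi k \<noteq> cnj m powi k"
proof (rule ccontr)
  assume "\<not> ?thesis"
  then have all: "m powi k = cnj m powi k" if "m \<in> multipliers L" "m \<noteq> 0" for m using that by blast
  define c where "c n = of_nat n + \<mu>" for n
  have c: "c n \<in> multipliers L" for n unfolding c_def by (intro multipliers_add multipliers_of_nat mu)
  have c0: "c n \<noteq> 0" for n using mu(2) by (auto simp: c_def complex_eq_iff)
  define q where "q n = c n / cnj (c n)" for n
  define e where "e = nat \<bar>k\<bar>"
  have e: "e \<ge> 1" using assms by (simp add: e_def)
  have "q n ^ e = 1" for n
  proof -
    have "q n powi k = 1" using all[OF c c0, of n] c0[of n] by (simp add: q_def power_int_divide_distrib)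
    moreover have "k = int e \<or> k = - int e" by (auto simp: e_def)
    ultimately show ?thesis by (auto simp: power_int_minus)
  qed
  then have "range q \<subseteq> {z. z ^ e = 1}" by auto
  then have "finite (range q)" using finite_roots_unity[OF e] finite_subset by blast
  moreover have "inj q"
  proof (rule injI)
    fix n n' assume "q n = q n'"
    then have "c n * cnj (c n') = c n' * cnj (c n)" using c0 by (simp add: q_def field_simps)
    then have "(of_nat n - of_nat n') * (cnj \<mu> - \<mu>) = 0" by (simp add: c_def algebra_simps)
    moreover have "cnj \<mu> \<noteq> \<mu>" using mu(2) by (auto simp: complex_eq_iff)
    ultimately show "n = n'" by simp
  qed
  ultimately show False using finite_imageD infinite_UNIV_nat by blast
qed

lemma ekern_inverse:
  assumes "m \<noteq> 0"
  shows "ekern k s (1/m) = m powi k * of_real (norm m) powr s"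
proof -
  have n: "norm m > 0" using assms by simp
  have P: "complex_of_real x powr c = exp (c * of_real (ln x))" if "x > 0" for x c
    using that by (simp add: powr_def Ln_of_real)
  have "complex_of_real (1 / norm m) powr (-s) = complex_of_real (norm m) powr s"
    using n by (subst P, simp, subst P, simp) (simp add: ln_div)
  then show ?thesis using assms
    by (simp add: ekern_def power_int_divide_distrib power_int_minus norm_divide)
qed

text \<open>Take N = |m|^2 in \<open>esum_distribution\<close> at z = 0 and subtract the N^2 = |m|^4
  copies of \<open>esum k s 0\<close>: this factor times \<open>esum k s 0\<close> remains. It
  equals |m|^2 (m^k |m|^s - |m|^2).\<close>

definition scale_factor :: "complex \<Rightarrow> int \<Rightarrow> complex \<Rightarrow> complex" where
  "scale_factor m k s = of_real (norm m)^2 * ekern k s (1/m) - of_real (norm m)^4"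

text \<open>In weight 0 the factors of all m vanish at s = 2. This common zero, the source of the
  pole, is divided out.\<close>

definition scale_quot :: "complex \<Rightarrow> int \<Rightarrow> complex \<Rightarrow> complex" where
  "scale_quot m k s = (if k = 0 then (if s = 2 then deriv (scale_factor m 0) 2 else (scale_factor m 0 s - scale_factor m 0 2) / (s - 2)) else scale_factor m k s)"

lemma holomorphic_scale_factor: "(\<lambda>s. scale_factor m k s) holomorphic_on A"
  unfolding scale_factor_def by (intro holomorphic_intros)

lemma holomorphic_scale_quot: "scale_quot m k holomorphic_on UNIV"
proof (cases "k = 0")
  case True
  have "(\<lambda>s. if s = 2 then deriv (scale_factor m 0) 2 else (scale_factor m 0 s - scale_factor m 0 2) / (s - 2)) holomorphic_on UNIV"
    by (rule pole_lemma_open[OF holomorphic_scale_factor[of m 0]]) auto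
  then show ?thesis using True by (simp add: scale_quot_def[abs_def])
next
  case False
  then show ?thesis using holomorphic_scale_factor[of m k] by (simp add: scale_quot_def[abs_def])
qed

lemma scale_factor_0: "m \<noteq> 0 \<Longrightarrow> scale_factor m 0 s = of_real (norm m)^2 * of_real (norm m) powr s - of_real (norm m)^4"
  by (simp add: scale_factor_def ekern_inverse)

lemma scale_factor_0_2: "m \<noteq> 0 \<Longrightarrow> scale_factor m 0 2 = 0"
  by (simp add: scale_factor_0 power2_eq_square power4_eq_xxxx powr_def)
     (metis (no_types) exp_double exp_Ln norm_eq_zero of_real_eq_0_iff power2_eq_square mult.assoc)

lemma pole_factor_scale_quot: "m \<noteq> 0 \<Longrightarrow> pole_factor k s * scale_quot m k s = scale_factor m k s"
  by (auto simp: pole_factor_def scale_quot_def scale_factor_0_2)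

text \<open>In weight 0, m = 2 and m = 3 have no common zero except s = 2, where the derivative of 4
  * 2^s - 16 is used. In other weights m and cnj m have the same norm, so a common zero would force
  m^k = (cnj m)^k.\<close>

lemma scale_quot_nonzero: "\<exists>m\<in>multipliers L - {0}. scale_quot m k s \<noteq> 0"
proof (cases "k = 0")
  case True
  have 23: "2 \<in> multipliers L - {0}" "3 \<in> multipliers L - {0}"
    using multipliers_of_nat[of 2] multipliers_of_nat[of 3] by auto
  show ?thesis
  proof (cases "s = 2")
    case s: True
    have "scale_factor 2 0 = (\<lambda>s. 4 * 2 powr s - 16)" by (rule ext) (simp add: scale_factor_0)
    then have "(scale_factor 2 0 has_field_derivative 4 * (2 powr 2 * Ln 2)) (at 2)"
      by (auto intro!: derivative_eq_intros)
    then have "deriv (scale_factor 2 0) 2 = 4 * (2 powr 2 * Ln 2)" by (rule DERIV_imp_deriv)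
    moreover have "Ln 2 \<noteq> (0::complex)" using Ln_of_real[of 2] by simp
    ultimately show ?thesis using True s 23 by (intro bexI[of _ 2]) (auto simp: scale_quot_def)
  next
    case s: False
    have "\<not> (scale_factor 2 0 s = 0 \<and> scale_factor 3 0 s = 0)"
    proof
      assume "scale_factor 2 0 s = 0 \<and> scale_factor 3 0 s = 0"
      then have "2 powr s = (4::complex)" "3 powr s = (9::complex)" by (auto simp: scale_factor_0)
      then have "2 powr (s - 2) = (1::complex)" "3 powr (s - 2) = (1::complex)"
        by (simp_all add: powr_diff)
      then have "s - 2 = 0" by (rule two_powers_separate)
      with s show False by simp
    qed
    then have "scale_quot 2 k s \<noteq> 0 \<or> scale_quot 3 k s \<noteq> 0" using s True by (auto simp: scale_quot_def scale_factor_0_2)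
    then show ?thesis using 23 by blast
  qed
next
  case False
  obtain m where m: "m \<in> multipliers L" "m \<noteq> 0" "m powi k \<noteq> cnj m powi k"
    using multiplier_argument[OF False] by blast
  have "\<not> (scale_factor m k s = 0 \<and> scale_factor (cnj m) k s = 0)"
  proof
    assume "scale_factor m k s = 0 \<and> scale_factor (cnj m) k s = 0"
    then have "of_real (norm m)^2 * ekern k s (1/m) = of_real (norm m)^2 * ekern k s (1/cnj m)"
      by (simp add: scale_factor_def)
    then have "ekern k s (1/m) = ekern k s (1/cnj m)" using m by simp
    then have "m powi k * of_real (norm m) powr s = cnj m powi k * of_real (norm m) powr s"
      using m by (simp add: ekern_inverse)
    then show False using m by simp
  qed
  then have "scale_quot m k s \<noteq> 0 \<or> scale_quot (cnj m) k s \<noteq> 0" using False by (auto simp: scale_quot_def)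
  moreover have "m \<in> multipliers L - {0}" "cnj m \<in> multipliers L - {0}" using m multipliers_cnj[OF m(1)] by auto
  ultimately show ?thesis by blast
qed

definition ext_to :: "nat \<Rightarrow> int \<Rightarrow> bool" where
  "ext_to M k \<longleftrightarrow> (\<exists>F. F holomorphic_on {s. Re s > 2 - of_int k - real M} \<and>
      (\<forall>s. Re s > 2 - of_int k \<longrightarrow> F s = pole_factor k s * esum k s 0))"

text \<open>A term of degree n \<ge> 1 involves a series evaluated n units further to the right,
  measured by \<open>Re s + of_int k\<close>. What is known to depth M therefore covers it to depth
  M + 1, and its coefficient removes the pole that may occur.\<close>

lemma taylor_terms_extend:
  assumes ext: "\<And>k. ext_to M k"
  shows "\<exists>F. F holomorphic_on {s. Re s > 2 - of_int k - real (Suc M)} \<and>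
     (\<forall>s. Re s > 2 - of_int k \<longrightarrow> F s = (\<Sum>n\<in>{1..<J}. \<Sum>a\<le>n. ((- of_int k - s/2) gchoose a) * ((-s/2) gchoose (n-a)) * z^a * cnj z^(n-a)
      * esum (k + int a - int (n-a)) (s + 2 * of_nat (n-a)) 0))"
proof -
  let ?U = "{s. Re s > 2 - of_int k - real (Suc M)}"
  define T where "T n a s = ((- of_int k - s/2) gchoose a) * ((-s/2) gchoose (n-a)) * z^a * cnj z^(n-a)
      * esum (k + int a - int (n-a)) (s + 2 * of_nat (n-a)) 0" for n a s
  have "\<exists>F. F holomorphic_on ?U \<and> (\<forall>s. Re s > 2 - of_int k \<longrightarrow> F s = T n a s)" if n: "n \<ge> 1" and a: "a \<le> n" for n a
  proof -
    define b where "b = n - a"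
    have ab: "n = a + b" using a by (simp add: b_def)
    define k' where "k' = k + int a - int b"
    obtain C where C: "C holomorphic_on UNIV"
        "\<And>s. ((- of_int k - s/2) gchoose a) * ((-s/2) gchoose b) = C s * pole_factor k' (s + 2 * of_nat b)"
      using taylor_coeff_cancels_pole[of a b k] n ab unfolding k'_def by auto
    obtain F where F: "F holomorphic_on {s. Re s > 2 - of_int k' - real M}"
        "\<And>s. Re s > 2 - of_int k' \<Longrightarrow> F s = pole_factor k' s * esum k' s 0"
      using ext[of k'] unfolding ext_to_def by blast
    have dom: "s + 2 * of_nat b \<in> {s. Re s > 2 - of_int k' - real M}" if "s \<in> ?U" for s
      using that n ab by (simp add: k'_def)
    have "(F \<circ> (\<lambda>s. s + 2 * of_nat b)) holomorphic_on ?U"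
      by (rule holomorphic_on_compose_gen[OF _ F(1)]) (use dom in \<open>auto intro!: holomorphic_intros\<close>)
    then have "(\<lambda>s. C s * z^a * cnj z^b * F (s + 2 * of_nat b)) holomorphic_on ?U"
      using C(1) by (intro holomorphic_intros) (auto simp: o_def intro: holomorphic_on_subset)
    moreover have "C s * z^a * cnj z^b * F (s + 2 * of_nat b) = T n a s" if "Re s > 2 - of_int k" for s
    proof -
      have "Re (s + 2 * of_nat b) > 2 - of_int k'" using that n ab by (simp add: k'_def)
      then show ?thesis using F(2)[of "s + 2 * of_nat b"] C(2)[of s]
        unfolding T_def b_def[symmetric] k'_def[symmetric] by (simp add: mult_ac)
    qed
    ultimately show ?thesis by blast
  qed
  then obtain F where F: "\<And>n a. n \<ge> 1 \<Longrightarrow> a \<le> n \<Longrightarrow> F n a holomorphic_on ?U"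
     "\<And>n a s. n \<ge> 1 \<Longrightarrow> a \<le> n \<Longrightarrow> Re s > 2 - of_int k \<Longrightarrow> F n a s = T n a s"
    by metis
  have "(\<lambda>s. \<Sum>n\<in>{1..<J}. \<Sum>a\<le>n. F n a s) holomorphic_on ?U"
    by (intro holomorphic_intros F) auto
  moreover have "(\<Sum>n\<in>{1..<J}. \<Sum>a\<le>n. F n a s) = (\<Sum>n\<in>{1..<J}. \<Sum>a\<le>n. T n a s)" if "Re s > 2 - of_int k" for s
    using that F(2) by (intro sum.cong refl) auto
  ultimately show ?thesis unfolding T_def by blast
qed

lemma esum_expand':
  assumes "Re s + of_int k > 2" "J \<ge> 1"
  shows "esum k s z = erest J k z s + esum k s 0 + (\<Sum>n\<in>{1..<J}. \<Sum>a\<le>n. ((- of_int k - s/2) gchoose a) * ((-s/2) gchoose (n-a)) * z^a * cnj z^(n-a)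
      * esum (k + int a - int (n-a)) (s + 2 * of_nat (n-a)) 0)"
proof -
  have "{..<J} = insert 0 {1..<J}" using assms(2) by auto
  then show ?thesis using esum_expand[OF assms(1), of z J] by simp
qed

text \<open>In the sum of \<open>esum k s (x/m)\<close> over x, the degree 0 part of each Taylor
  expansion is the unknown \<open>esum k s 0\<close>; everything else is already holomorphic on the
  larger half-plane. This determines the unknown up to \<open>scale_factor\<close>, and the
  different m are glued.\<close>

lemma ext_to_step:
  assumes ext: "\<And>k. ext_to M k"
  shows "ext_to (Suc M) k"
proof -
  let ?U = "{s. Re s > 2 - of_int k - real (Suc M)}"
  let ?V = "{s. Re s > 2 - of_int k}"
  \<comment> \<open>With this many terms removed, the remainder converges on exactly the enlarged
    half-plane.\<close>
  define J where "J = Suc M"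
  have "\<exists>B. B holomorphic_on ?U \<and> (\<forall>s\<in>?V. scale_factor m k s * esum k s 0 = B s)" if m: "m \<in> multipliers L - {0}" for m
  proof -
    obtain N where N: "(norm m)^2 = of_nat N" "m * cnj m = of_nat N"
      using multiplier_norm[of m] m by blast
    have N0: "N > 0" using N(1) m by (metis DiffD2 gr0I insertI1 norm_eq_zero of_nat_0 power_eq_0_iff singletonI)
    define RT where "RT z s = (\<Sum>n\<in>{1..<J}. \<Sum>a\<le>n. ((- of_int k - s/2) gchoose a) * ((-s/2) gchoose (n-a)) * z^a * cnj z^(n-a)
      * esum (k + int a - int (n-a)) (s + 2 * of_nat (n-a)) 0)" for z s
    have "\<forall>z. \<exists>F. F holomorphic_on ?U \<and> (\<forall>s. Re s > 2 - of_int k \<longrightarrow> F s = RT z s)"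
      unfolding RT_def using taylor_terms_extend[OF ext] by blast
    then obtain F where F: "\<And>z. F z holomorphic_on ?U" "\<And>z s. Re s > 2 - of_int k \<Longrightarrow> F z s = RT z s"
      by metis
    define B where "B s = bsum N (\<lambda>x. erest J k (x / m) s + F (x / m) s)" for s
    have "B holomorphic_on ?U" unfolding B_def[abs_def] bsum_def
      using holomorphic_erest[of J k] by (intro holomorphic_intros F(1)) (auto simp: J_def)
    moreover have "scale_factor m k s * esum k s 0 = B s" if s: "s \<in> ?V" for s
    proof -
      have s': "Re s + of_int k > 2" using s by simp
      have "bsum N (\<lambda>x. esum k s ((0 + x) / m)) = of_nat N^2 / (of_real (norm m))^2 * ekern k s (1/m) * esum k s 0"
        by (rule esum_distribution[OF _ _ multipliers_cnj _ N0 s']) (use m N in auto)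
      also have "of_nat N = (of_real (norm m) :: complex)^2" using N(1) by (metis of_real_of_nat_eq of_real_power)
      finally have 1: "bsum N (\<lambda>x. esum k s (x / m)) = of_real (norm m)^2 * ekern k s (1/m) * esum k s 0"
        using m by (simp add: power2_eq_square)
      have "bsum N (\<lambda>x. esum k s (x / m)) = bsum N (\<lambda>x. (erest J k (x / m) s + F (x / m) s) + esum k s 0)"
      proof (rule bsum_cong)
        fix x
        have s2: "Re s > 2 - of_int k" using s by simp
        have "J \<ge> 1" by (simp add: J_def)
        from esum_expand'[OF s' this, of "x/m"]
        show "esum k s (x / m) = (erest J k (x / m) s + F (x / m) s) + esum k s 0"
          unfolding F(2)[OF s2] RT_def by (simp only: add_ac)
      qed
      also have "\<dots> = B s + of_nat N^2 * esum k s 0"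
        by (simp add: bsum_add bsum_const B_def)
      also have "of_nat N = (of_real (norm m) :: complex)^2" using N(1) by (metis of_real_of_nat_eq of_real_power)
      finally show ?thesis using 1 by (simp add: scale_factor_def algebra_simps flip: power_mult)
    qed
    ultimately show ?thesis by blast
  qed
  then obtain B where B: "\<And>m. m \<in> multipliers L - {0} \<Longrightarrow> B m holomorphic_on ?U"
     "\<And>m s. m \<in> multipliers L - {0} \<Longrightarrow> s \<in> ?V \<Longrightarrow> scale_factor m k s * esum k s 0 = B m s"
    by metis
  have "\<exists>F. F holomorphic_on ?U \<and> (\<forall>s\<in>?V. F s = pole_factor k s * esum k s 0)"
  proof (rule holomorphic_extension_glue[where G = "\<lambda>m. scale_quot m k" and B = B and I = "multipliers L - {0}"])
    show "open ?U" "open ?V" by (rule open_halfplane_gt)+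
    show "connected ?U" by (intro convex_connected convex_Re_gt)
    show "?V \<subseteq> ?U" by auto
    show "?V \<noteq> {}" by (auto intro: exI[of _ "complex_of_real (3 - of_int k)"])
    show "scale_quot m k holomorphic_on ?U" for m using holomorphic_scale_quot holomorphic_on_subset by blast
    show "pole_factor k s * esum k s 0 * scale_quot m k s = B m s" if "m \<in> multipliers L - {0}" "s \<in> ?V" for m s
    proof -
      have e: "pole_factor k s * esum k s 0 * scale_quot m k s = (pole_factor k s * scale_quot m k s) * esum k s 0" by (simp only: mult_ac)
      have "m \<noteq> 0" using that by simp
      then show ?thesis unfolding e pole_factor_scale_quot[OF \<open>m \<noteq> 0\<close>] using B(2)[OF that] by simp
    qed
    show "\<exists>m\<in>multipliers L - {0}. scale_quot m k s \<noteq> 0" for s by (rule scale_quot_nonzero)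
  qed (use B in auto)
  then show ?thesis unfolding ext_to_def by auto
qed

lemma ext_to_all: "ext_to M k"
proof (induction M arbitrary: k)
  case 0
  have "(\<lambda>s. pole_factor k s * esum k s 0) holomorphic_on {s. Re s > 2 - of_int k}"
    unfolding pole_factor_def using esum_holomorphic[of 0 0] esum_holomorphic[of k 0]
    by (cases "k = 0") (auto intro!: holomorphic_intros)
  then show ?case unfolding ext_to_def by auto
next
  case (Suc M) then show ?case by (rule ext_to_step)
qed

lemma econt_exists: "\<exists>F. F holomorphic_on UNIV \<and> (\<forall>s. Re s > 2 - of_int k \<longrightarrow> F s = pole_factor k s * esum k s 0)"
  using ext_to_all unfolding ext_to_def by (rule entire_extension)

definition econt :: "int \<Rightarrow> complex \<Rightarrow> complex" where
  "econt k = (SOME F. F holomorphic_on UNIV \<and> (\<forall>s. Re s > 2 - of_int k \<longrightarrow> F s = pole_factor k s * esum k s 0))"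

lemma econt_holo: "econt k holomorphic_on UNIV"
  and econt_eq: "Re s > 2 - of_int k \<Longrightarrow> econt k s = pole_factor k s * esum k s 0"
  using someI_ex[OF econt_exists[of k]] unfolding econt_def by blast+

text \<open>The Taylor expansion about z = 0 carries the continuation to every z; for k \<noteq> 0
  its degree 0 term has no pole.\<close>

lemma esum_extends:
  assumes "k \<noteq> 0"
  shows "\<exists>F. F holomorphic_on UNIV \<and> (\<forall>s. Re s > 2 - of_int k \<longrightarrow> F s = esum k s z)"
proof (rule entire_extension)
  fix M
  let ?U = "{s. Re s > 2 - of_int k - real M}"
  obtain F where F: "F holomorphic_on {s. Re s > 2 - of_int k - real (Suc M)}" "\<And>s. Re s > 2 - of_int k \<Longrightarrow>
      F s = (\<Sum>n\<in>{1..<Suc M}. \<Sum>a\<le>n. ((- of_int k - s/2) gchoose a) * ((-s/2) gchoose (n-a)) * z^a * cnj z^(n-a)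
      * esum (k + int a - int (n-a)) (s + 2 * of_nat (n-a)) 0)"
    using taylor_terms_extend[OF ext_to_all, where J = "Suc M"] by blast
  have "(\<lambda>s. erest (Suc M) k z s + econt k s + F s) holomorphic_on ?U"
    by (intro holomorphic_intros holomorphic_on_subset[OF F(1)] holomorphic_on_subset[OF econt_holo]
       holomorphic_on_subset[OF holomorphic_erest]) auto
  moreover have "erest (Suc M) k z s + econt k s + F s = esum k s z" if "Re s > 2 - of_int k" for s
    using esum_expand'[of s k "Suc M" z] econt_eq[OF that] F(2)[OF that] that assms by (simp add: pole_factor_def)
  ultimately show "\<exists>F. F holomorphic_on ?U \<and> (\<forall>s. Re s > 2 - of_int k \<longrightarrow> F s = esum k s z)" by blast
qed

end

section \<open>The values at zero\<close>

lemma ekern_1_0: "ekern 1 0 x = inverse x"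
  by (cases "x = 0") (auto simp: ekern_at_0 power_int_minus)

lemma ekern_2_0: "ekern 2 0 x = inverse (x^2)"
  by (cases "x = 0") (auto simp: ekern_at_0 power_int_def power_inverse)

context lattice_basis
begin

lemma bsum_1: "bsum 1 g = g 0"
proof -
  have "{0..<1::int} = {0}" by auto
  then show ?thesis by (simp add: bsum_def lp_def)
qed

text \<open>Since \<open>inverse 0 = 0\<close>, the summand at \<open>x = 0\<close> is the principal part, and \<open>wp\<close> vanishes on \<open>L\<close>.\<close>
definition zeta :: "complex \<Rightarrow> complex" where
  "zeta z = infsum (\<lambda>x. inverse (x + z) - inverse x + z * inverse (x^2)) L"

definition wp :: "complex \<Rightarrow> complex" where
  "wp z = infsum (\<lambda>x. inverse ((x + z)^2) - inverse (x^2)) L"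

lemma taylor_zeta: "ekern 1 0 (x + z) - ekern_taylor 2 1 z 0 x = inverse (x + z) - inverse x + z * inverse (x^2)"
  by (simp add: ekern_taylor_def ekern_1_0 ekern_2_0 numeral_2_eq_2 lessThan_Suc atMost_Suc)

lemma taylor_wp: "ekern 2 0 (x + z) - ekern_taylor 1 2 z 0 x = inverse ((x + z)^2) - inverse (x^2)"
  by (simp add: ekern_taylor_def ekern_2_0)

lemma zeta_erest: "zeta z = erest 2 1 z 0"
  unfolding zeta_def erest_def taylor_zeta ..

lemma wp_erest: "wp z = erest 1 2 z 0"
  unfolding wp_def erest_def taylor_wp ..

lemma zeta_summable: "(\<lambda>x. inverse (x + z) - inverse x + z * inverse (x^2)) summable_on L"
  using summable_erest[of 0 1 2 z] unfolding taylor_zeta by simp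

lemma wp_summable: "(\<lambda>x. inverse ((x + z)^2) - inverse (x^2)) summable_on L"
  using summable_erest[of 0 2 1 z] unfolding taylor_wp by simp

definition zeta0 :: "complex \<Rightarrow> complex" where
  "zeta0 z = infsum (\<lambda>x. inverse (x + z) - inverse x + z * inverse (x^2)) (L - {0})"

definition wp0 :: "complex \<Rightarrow> complex" where
  "wp0 z = infsum (\<lambda>x. inverse ((x + z)^2) - inverse (x^2)) (L - {0})"

lemma zeta_split: "zeta z = inverse z + zeta0 z"
proof -
  have "L = insert 0 (L - {0})" by auto
  then have "zeta z = infsum (\<lambda>x. inverse (x + z) - inverse x + z * inverse (x^2)) (insert 0 (L - {0}))"
    unfolding zeta_def by simp
  also have "\<dots> = inverse z + zeta0 z"
    unfolding zeta0_def by (subst infsum_insert) (auto intro!: summable_on_subset_banach[OF zeta_summable])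
  finally show ?thesis .
qed

lemma wp_split: "wp z = inverse (z^2) + wp0 z"
proof -
  have "L = insert 0 (L - {0})" by auto
  then have "wp z = infsum (\<lambda>x. inverse ((x + z)^2) - inverse (x^2)) (insert 0 (L - {0}))"
    unfolding wp_def by simp
  also have "\<dots> = inverse (z^2) + wp0 z"
    unfolding wp0_def by (subst infsum_insert) (auto intro!: summable_on_subset_banach[OF wp_summable])
  finally show ?thesis .
qed

lemma zeta0_0 [simp]: "zeta0 0 = 0" by (simp add: zeta0_def)
lemma wp0_0 [simp]: "wp0 0 = 0" by (simp add: wp0_def)

lemma locally_finite_closed:
  fixes S :: "complex set"
  assumes "\<And>R. finite {x \<in> S. norm x \<le> R}"
  shows "\<exists>r>0. ball p r \<inter> S \<subseteq> {p}" and "closed S"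
proof -
  have *: "\<exists>r>0. ball p r \<inter> S \<subseteq> {p}" for p
  proof -
    obtain d where d: "d > 0" "\<And>x. x \<in> {x \<in> S. norm x \<le> norm p + 1} \<Longrightarrow> x \<noteq> p \<Longrightarrow> d \<le> dist p x"
      using finite_set_avoid[OF assms[of "norm p + 1"], of p] by blast
    have "ball p (min d 1) \<inter> S \<subseteq> {p}"
    proof
      fix x assume x: "x \<in> ball p (min d 1) \<inter> S"
      then have "norm x \<le> norm p + 1" using norm_triangle_ineq2[of x p] by (auto simp: dist_norm norm_minus_commute)
      then show "x \<in> {p}" using d(2)[of x] x by force
    qed
    then show ?thesis using d(1) by (intro exI[of _ "min d 1"]) auto
  qed
  then show "\<exists>r>0. ball p r \<inter> S \<subseteq> {p}" .
  have "open (- S)" unfolding open_contains_ball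
  proof
    fix x assume "x \<in> - S" with *[of x] show "\<exists>e>0. ball x e \<subseteq> - S" by blast
  qed
  then show "closed S" by (simp add: closed_def)
qed

lemma closed_L: "closed L" using locally_finite_closed(2)[OF finite_L_ball] .

lemma closed_L0: "closed (L - {0})"
  by (rule locally_finite_closed(2)) (rule finite_subset[OF _ finite_L_ball], auto)

lemma
  shows zeta0_holo: "zeta0 holomorphic_on - (L - {0})"
    and zeta0_deriv: "z \<in> - (L - {0}) \<Longrightarrow> deriv zeta0 z = - wp0 z"
proof -
  let ?S = "- (L - {0})"
  let ?f = "\<lambda>x z. inverse (x + z) - inverse x + z * inverse (x^2) :: complex"
  have S: "open ?S" using closed_L0 by (rule open_Compl)
  have nz: "x + z \<noteq> 0" if "x \<in> L - {0}" "z \<in> ?S" for x z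
  proof
    assume "x + z = 0" then have "z = - x" by (simp add: add_eq_0_iff)
    with that show False by auto
  qed
  have hol: "?f x holomorphic_on ?S" if "x \<in> L - {0}" for x
    using nz[OF that] by (auto intro!: holomorphic_intros)
  have bd: "\<exists>r>0. \<exists>B M. finite B \<and> M summable_on ((L - {0}) - B) \<and>
               (\<forall>x\<in>(L - {0}) - B. \<forall>w\<in>ball s r \<inter> ?S. norm (?f x w) \<le> M x)" for s
  proof -
    define R where "R = norm s + 1"
    define B where "B = {x \<in> L. norm x \<le> 2 * R}"
    define M where "M x = (2 * R)^2 * 2 powr 1 * norm x powr (-3)" for x :: complex
    have "M summable_on ((L - {0}) - B)" unfolding M_def
      by (intro summable_on_cmult_right summable_on_subset_banach[OF summable_L]) auto
    moreover have "norm (?f x w) \<le> M x" if "x \<in> (L - {0}) - B" "w \<in> ball s 1" for x w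
    proof -
      have w: "norm w \<le> R" using that norm_triangle_ineq2[of w s] by (auto simp: R_def dist_norm norm_minus_commute)
      have x: "x \<noteq> 0" "2 * R < norm x" using that by (auto simp: B_def)
      have "norm (ekern 1 0 (x + w) - ekern_taylor 2 1 w 0 x) \<le>
         (2 * norm w)^2 * 2 powr (norm (of_int 1 + 0/2 :: complex) + norm (0/2 :: complex)) * norm x powr (-(of_int 1 + Re 0 + real 2))"
        by (rule ekern_taylor_remainder) (use x w in auto)
      also have "\<dots> \<le> M x" unfolding M_def using w
        by (auto intro!: mult_right_mono power_mono)
      finally show ?thesis unfolding taylor_zeta .
    qed
    moreover have "finite B" unfolding B_def by (rule finite_L_ball)
    ultimately show ?thesis by (intro exI[of _ 1] conjI exI[of _ B] exI[of _ M]) auto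
  qed
  show "zeta0 holomorphic_on ?S" unfolding zeta0_def[abs_def]
    by (rule infsum_holomorphic_deriv(1)[OF S hol bd])
  assume z: "z \<in> ?S"
  have "((\<lambda>x. deriv (?f x) z) has_sum deriv zeta0 z) (L - {0})"
    unfolding zeta0_def[abs_def] by (rule infsum_holomorphic_deriv(3)[OF S hol bd z])
  moreover have "deriv (?f x) z = - (inverse ((x + z)^2) - inverse (x^2))" if "x \<in> L - {0}" for x
    using nz[OF that z] by (auto intro!: DERIV_imp_deriv derivative_eq_intros simp: power2_eq_square)
  ultimately have "((\<lambda>x. - (inverse ((x + z)^2) - inverse (x^2))) has_sum deriv zeta0 z) (L - {0})"
    by (subst (asm) has_sum_cong) auto
  then have "infsum (\<lambda>x. - (inverse ((x + z)^2) - inverse (x^2))) (L - {0}) = deriv zeta0 z" by (rule infsumI)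
  then show "deriv zeta0 z = - wp0 z" unfolding wp0_def infsum_uminus by (rule sym)
qed

lemma zeta0_has_deriv: "z \<in> - (L - {0}) \<Longrightarrow> (zeta0 has_field_derivative - wp0 z) (at z)"
  using zeta0_holo zeta0_deriv closed_L0 by (metis holomorphic_derivI open_Compl)

lemma zeta_has_deriv: "z \<notin> L \<Longrightarrow> (zeta has_field_derivative - wp z) (at z)"
  unfolding zeta_split[abs_def] wp_split
  by (rule derivative_eq_intros zeta0_has_deriv refl | use L_0 in force)+ (auto simp: power2_eq_square)

lemma zeta_holo: "zeta holomorphic_on - L"
  using zeta_has_deriv by (subst holomorphic_on_open[OF open_Compl[OF closed_L]]) auto

lemma wp0_holo: "wp0 holomorphic_on - (L - {0})"
proof -
  have "(\<lambda>z. - deriv zeta0 z) holomorphic_on - (L - {0})"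
    by (intro holomorphic_intros holomorphic_deriv zeta0_holo open_Compl closed_L0)
  then show ?thesis by (rule holomorphic_transform) (simp add: zeta0_deriv)
qed

lemma wp_holo: "wp holomorphic_on - L"
  unfolding wp_split[abs_def] by (intro holomorphic_intros holomorphic_on_subset[OF wp0_holo]) auto

end

context cm_lattice
begin

text \<open>Evaluates the definite description in \<open>eisE\<close> by any continuation reaching
  slightly to the left of 0, such as a Taylor expansion with few terms. The existence of an entire
  one is \<open>esum_extends\<close>.\<close>

lemma eisE_eq:
  assumes k: "k \<ge> 1" and c: "c < 0" and F: "F holomorphic_on {s. Re s > c}"
    and eq: "\<And>s. Re s > c \<Longrightarrow> Re s > 2 - real k \<Longrightarrow> F s = esum (int k) s z"
  shows "eisE L k z = F 0"
proof -
  have uniq: "G 0 = F 0" if G: "G holomorphic_on UNIV" "\<forall>s. Re s > 2 - real k \<longrightarrow> G s = eis_series L k z s" for G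
  proof (rule analytic_continuation_open[where s = "{s. Re s > max c (2 - real k)}" and s' = "{s. Re s > c}" and f = G and g = F])
    show "{s. Re s > max c (2 - real k)} \<noteq> {}" by (auto intro: exI[of _ "complex_of_real (max c (2 - real k) + 1)"])
    show "connected {s. Re s > c}" by (intro convex_connected convex_Re_gt)
    show "G s = F s" if "s \<in> {s. Re s > max c (2 - real k)}" for s
      using that G(2) eq[of s] by (simp add: eis_series_esum)
    show "open {s. Re s > max c (2 - real k)}" "open {s. Re s > c}" by (rule open_halfplane_gt)+
  qed (use c F G(1) in \<open>auto intro: holomorphic_on_subset\<close>)
  obtain G where G: "G holomorphic_on UNIV" "\<And>s. Re s > 2 - of_int (int k) \<Longrightarrow> G s = esum (int k) s z"
    using esum_extends[of "int k" z] k by auto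
  then have G': "G holomorphic_on UNIV \<and> (\<forall>s. Re s > 2 - real k \<longrightarrow> G s = eis_series L k z s)"
    by (simp add: eis_series_esum)
  show ?thesis unfolding eisE_def
  proof (rule the_equality)
    show "\<exists>f. f holomorphic_on UNIV \<and> (\<forall>s. 2 - real k < Re s \<longrightarrow> f s = eis_series L k z s) \<and> F 0 = f 0"
      using G' uniq[of G] by metis
    show "v = F 0" if "\<exists>f. f holomorphic_on UNIV \<and> (\<forall>s. 2 - real k < Re s \<longrightarrow> f s = eis_series L k z s) \<and> v = f 0" for v
      using that uniq by metis
  qed
qed

lemma eisE_entire:
  assumes "k \<ge> 1"
  obtains F where "F holomorphic_on UNIV" "\<And>s. Re s > 2 - real k \<Longrightarrow> F s = esum (int k) s z" "eisE L k z = F 0"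
proof -
  obtain G where G: "G holomorphic_on UNIV" "\<And>s. Re s > 2 - of_int (int k) \<Longrightarrow> G s = esum (int k) s z"
    using esum_extends[of "int k" z] assms by auto
  have "eisE L k z = G 0"
    by (rule eisE_eq[OF assms, of "-1"]) (use G in \<open>auto intro: holomorphic_on_subset\<close>)
  with G that show ?thesis by auto
qed

lemma eisE_periodic:
  assumes "l \<in> L"
  shows "eisE L k (z + l) = eisE L k z"
proof -
  have "eis_series L k (z + l) s = eis_series L k z s" for s
    using infsum_reindex_bij_betw[OF bij_L_shift[OF assms], of "\<lambda>x. ekern (int k) s (x + z)"]
    by (simp add: eis_series_esum esum_def add_ac)
  then show ?thesis by (simp add: eisE_def)
qed

lemma eisE_distribution:
  assumes m: "m \<in> multipliers L" "m \<noteq> 0" and n: "n \<in> multipliers L" "of_nat N = m * n" and N: "N > 0" and k: "k \<ge> 1"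
  shows "bsum N (\<lambda>x. eisE L k ((z + x) / m)) = of_nat N^2 / (of_real (norm m))^2 * m^k * eisE L k z"
proof -
  have "\<forall>z. \<exists>F. F holomorphic_on UNIV \<and> (\<forall>s. Re s > 2 - real k \<longrightarrow> F s = esum (int k) s z) \<and> eisE L k z = F 0"
    using eisE_entire[OF k] by metis
  then obtain F where F: "\<And>z. F z holomorphic_on UNIV" "\<And>z s. Re s > 2 - real k \<Longrightarrow> F z s = esum (int k) s z"
      "\<And>z. eisE L k z = F z 0" by metis
  let ?l = "\<lambda>s. bsum N (\<lambda>x. F ((z + x) / m) s)"
  let ?r = "\<lambda>s. of_nat N^2 / (of_real (norm m))^2 * ekern (int k) s (1/m) * F z s"
  have "?l 0 = ?r 0"
  proof (rule analytic_continuation_open[where s = "{s. Re s > 2 - real k}" and s' = UNIV and f = ?l and g = ?r])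
    show "{s. Re s > 2 - real k} \<noteq> {}" by (auto intro: exI[of _ "complex_of_real (2 - real k + 1)"])
    show "?l holomorphic_on UNIV" unfolding bsum_def by (intro holomorphic_intros F)
    show "?r holomorphic_on UNIV" by (intro holomorphic_intros F)
    show "?l s = ?r s" if "s \<in> {s. Re s > 2 - real k}" for s
      using esum_distribution[OF m n N, of s "int k" z] that F(2)[of s] by simp
  qed (use open_halfplane_gt in auto)
  moreover have "ekern (int k) 0 (1/m) = m^k" using m by (simp add: ekern_at_0 power_int_minus power_divide)
  ultimately show ?thesis by (simp add: F(3))
qed

lemma eisE_minus:
  assumes "k \<ge> 1"
  shows "eisE L k (- z) = (-1)^k * eisE L k z"
  using eisE_distribution[of "-1" "-1" 1 k z] assms multipliers_of_int[of "-1"]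
  unfolding bsum_1 by simp

definition e2 :: complex where "e2 = eisE L 2 0"
text \<open>\<open>econt 0 2\<close> is the residue at s = 2 of the weight 0 series.\<close>

definition kap :: complex where "kap = econt 0 2 / 2"

lemma econt_0: "k \<ge> 1 \<Longrightarrow> econt (int k) 0 = eisE L k 0"
  by (rule eisE_eq[of k "-1", symmetric])
     (auto simp: econt_eq pole_factor_def intro: holomorphic_on_subset[OF econt_holo])

lemma eisE_1_0: "eisE L 1 0 = 0" using eisE_minus[of 1 0] by simp

text \<open>The coefficient - s/2 of cnj z vanishes at s = 0, but it multiplies the weight 0 series
  at s + 2, which has its pole there. The product tends to - \<open>kap\<close>, and this term turns
  the quasi-periodic \<open>zeta\<close> into a periodic function.\<close>

lemma eisE_1: "eisE L 1 z = zeta z - e2 * z - kap * cnj z"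
proof -
  let ?F = "\<lambda>s. erest 2 1 z s + econt 1 s + ((-1 - s/2) * z * econt 2 s - (1/2) * cnj z * econt 0 (s + 2))"
  have Z0: "(\<lambda>s. econt 0 (s + 2)) holomorphic_on A" for A
  proof -
    have "(\<lambda>s. s + 2) holomorphic_on A" by (intro holomorphic_intros)
    then show ?thesis using holomorphic_on_compose_gen[OF _ econt_holo, of "\<lambda>s. s + 2" A 0] by (simp add: o_def)
  qed
  have "eisE L 1 z = ?F 0"
  proof (rule eisE_eq[where c = "-1"])
    show "?F holomorphic_on {s. Re s > -1}"
      by (intro holomorphic_intros Z0 holomorphic_on_subset[OF econt_holo] holomorphic_on_subset[OF holomorphic_erest]) auto
    fix s assume s: "Re s > 2 - real 1"
    have 0: "econt 0 (s + 2) = s * esum 0 (s + 2) 0" using econt_eq[of 0 "s+2"] s by (simp add: pole_factor_def)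
    have 1: "econt 1 s = esum 1 s 0" using econt_eq[of 1 "s"] s by (simp add: pole_factor_def)
    have 2: "econt 2 s = esum 2 s 0" using econt_eq[of 2 "s"] s by (simp add: pole_factor_def)
    have "{1..<2} = {1::nat}" by auto
    then show "?F s = esum (int 1) s z"
      using esum_expand'[of s 1 2 z] s by (simp add: 0 1 2 atMost_Suc)
  qed auto
  also have "econt 1 0 = 0" using econt_0[of 1] eisE_1_0 by simp
  also have "econt 2 0 = e2" using econt_0[of 2] by (simp add: e2_def)
  finally show ?thesis by (simp add: zeta_erest kap_def)
qed

lemma eisE_2: "eisE L 2 z = wp z + e2"
proof -
  let ?F = "\<lambda>s. erest 1 2 z s + econt 2 s"
  have "eisE L 2 z = ?F 0"
  proof (rule eisE_eq[where c = "-1"])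
    show "?F holomorphic_on {s. Re s > -1}"
      by (intro holomorphic_intros holomorphic_on_subset[OF econt_holo] holomorphic_on_subset[OF holomorphic_erest]) auto
    fix s assume s: "Re s > 2 - real 2"
    have 2: "econt 2 s = esum 2 s 0" using econt_eq[of 2 "s"] s by (simp add: pole_factor_def)
    show "?F s = esum (int 2) s z"
      using esum_expand'[of s 2 1 z] s by (simp add: 2)
  qed auto
  also have "econt 2 0 = e2" using econt_0[of 2] by (simp add: e2_def)
  finally show ?thesis by (simp add: wp_erest)
qed

lemma wp_periodic: "l \<in> L \<Longrightarrow> wp (z + l) = wp z"
  using eisE_periodic[of l 2 z] by (simp add: eisE_2)

lemma wp_minus: "wp (- z) = wp z"
  using eisE_minus[of 2 z] by (simp add: eisE_2)

text \<open>The quasi-periods are read off from the periodicity of \<open>eisE L 1\<close>, which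
  its series shows directly.\<close>

lemma zeta_periodic: "l \<in> L \<Longrightarrow> zeta (z + l) = zeta z + (e2 * l + kap * cnj l)"
  using eisE_periodic[of l 1 z] unfolding eisE_1 by (simp add: algebra_simps)

lemma zeta_minus: "zeta (- z) = - zeta z"
  using eisE_minus[of 1 z] unfolding eisE_1 by simp

lemma wp_L: "l \<in> L \<Longrightarrow> wp l = 0"
  using wp_periodic[of l 0] by (simp add: wp_split)

lemma eisE_1_L: "l \<in> L \<Longrightarrow> eisE L 1 l = 0"
  using eisE_periodic[of l 1 0] eisE_1_0 by simp

end

section \<open>The addition theorem\<close>

context lattice_basis
begin

lemma fundamental_reduction: "\<exists>l\<in>L. norm (z - l) \<le> norm w1 + norm w2"
proof -
  define t where "t = w2 / w1"
  define b where "b = Im (z / w1) / Im t"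
  define a where "a = Re (z / w1) - b * Re t"
  have "Im t \<noteq> 0" using im by (simp add: t_def)
  then have "z / w1 = of_real a + of_real b * t" by (simp add: complex_eq_iff a_def b_def)
  then have z: "z = of_real a * w1 + of_real b * w2" using w1 by (simp add: t_def field_simps)
  define l where "l = lp \<lfloor>a\<rfloor> \<lfloor>b\<rfloor>"
  have "z - l = of_real (a - of_int \<lfloor>a\<rfloor>) * w1 + of_real (b - of_int \<lfloor>b\<rfloor>) * w2"
    by (simp add: z l_def lp_def algebra_simps)
  also have "norm \<dots> \<le> \<bar>a - of_int \<lfloor>a\<rfloor>\<bar> * norm w1 + \<bar>b - of_int \<lfloor>b\<rfloor>\<bar> * norm w2"
    by (rule order_trans[OF norm_triangle_ineq]) (simp only: norm_mult norm_of_real order_refl)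
  also have "\<dots> \<le> 1 * norm w1 + 1 * norm w2"
    by (intro add_mono mult_right_mono) (auto simp: abs_le_iff, linarith+)
  finally show ?thesis by (intro bexI[of _ l]) (auto simp: l_def)
qed

text \<open>An elliptic function without poles is constant. Existence of limits at the exceptional
  set \<open>S\<close> suffices to make it entire; \<open>S\<close> may be larger than L, since the
  addition theorem has singularities in two classes modulo L.\<close>

lemma liouville_lattice:
  assumes S: "\<And>R. finite {x \<in> S. norm x \<le> R}" and hol: "f holomorphic_on - S"
    and perS: "\<And>z l. l \<in> L \<Longrightarrow> z \<in> S \<Longrightarrow> z + l \<in> S"
    and per: "\<And>z l. l \<in> L \<Longrightarrow> z \<notin> S \<Longrightarrow> f (z + l) = f z"
    and lim: "\<And>p. p \<in> S \<Longrightarrow> \<exists>c. (f \<longlongrightarrow> c) (at p)"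
  shows "\<exists>c. \<forall>z. z \<notin> S \<longrightarrow> f z = c"
proof -
  define F where "F z = (if z \<in> S then Lim (at z) f else f z)" for z
  have opS: "open (- S)" using locally_finite_closed(2)[OF S] by (rule open_Compl)
  have Flim: "(F \<longlongrightarrow> F p) (at p)" if p: "p \<in> S" for p
  proof -
    obtain c where c: "(f \<longlongrightarrow> c) (at p)" using lim[OF p] by blast
    then have "F p = c" using p by (simp add: F_def tendsto_Lim)
    moreover obtain r where r: "r > 0" "ball p r \<inter> S \<subseteq> {p}" using locally_finite_closed(1)[OF S] by blast
    have "eventually (\<lambda>z. F z = f z) (at p)"
      unfolding eventually_at using r by (intro exI[of _ r]) (auto simp: F_def dist_commute subset_eq)
    then have "(F \<longlongrightarrow> c) (at p)" using c by (simp add: tendsto_cong)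
    ultimately show ?thesis by simp
  qed
  have Fhol: "F holomorphic_on UNIV"
  proof -
    have "F analytic_on {p}" for p
    proof -
      obtain r where r: "r > 0" "ball p r \<inter> S \<subseteq> {p}" using locally_finite_closed(1)[OF S] by blast
      have "F holomorphic_on ball p r"
      proof (rule no_isolated_singularity')
        show "(F \<longlongrightarrow> F z) (at z within ball p r)" if "z \<in> {p} \<inter> S" for z
          using Flim[of z] that by (auto intro: tendsto_within_subset)
        show "F holomorphic_on (ball p r - {p} \<inter> S)"
        proof (rule holomorphic_transform)
          show "f holomorphic_on (ball p r - {p} \<inter> S)" using r by (intro holomorphic_on_subset[OF hol]) auto
        qed (use r in \<open>auto simp: F_def\<close>)
      qed auto
      then show ?thesis using r(1) analytic_at_ball by blast
    qed
    then show ?thesis using analytic_imp_holomorphic analytic_on_analytic_at by blast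
  qed
  have Fper: "F (z + l) = F z" if l: "l \<in> L" for z l
  proof (cases "z \<in> S")
    case True
    have zl: "z + l \<in> S" using perS l True by blast
    have "((\<lambda>w. F (w + l)) \<longlongrightarrow> F (z + l)) (at z)"
      using LIM_offset[OF Flim[OF zl], of l] by simp
    moreover obtain r where r: "r > 0" "ball z r \<inter> S \<subseteq> {z}" using locally_finite_closed(1)[OF S] by blast
    have "eventually (\<lambda>w. F (w + l) = F w) (at z)"
    proof -
      have "F (w + l) = F w" if "w \<notin> S" for w
      proof -
        have "w + l \<notin> S" using perS[of "-l" "w + l"] l that by auto
        then show ?thesis using per[OF l that] that by (simp add: F_def)
      qed
      then show ?thesis unfolding eventually_at using r by (intro exI[of _ r]) (force simp: dist_commute)
    qed
    ultimately have "(F \<longlongrightarrow> F (z + l)) (at z)" by (simp add: tendsto_cong)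
    then show ?thesis using Flim[OF True] LIM_unique by blast
  next
    case False
    have "z + l \<notin> S" using perS[of "-l" "z + l"] l False by auto
    then show ?thesis using per[OF l False] False by (simp add: F_def)
  qed
  have "compact (F ` cball 0 (norm w1 + norm w2))"
    by (intro compact_continuous_image holomorphic_on_imp_continuous_on holomorphic_on_subset[OF Fhol]) auto
  then have "bounded (F ` cball 0 (norm w1 + norm w2))" by (rule compact_imp_bounded)
  moreover have "range F \<subseteq> F ` cball 0 (norm w1 + norm w2)"
  proof
    fix y assume "y \<in> range F"
    then obtain z where y: "y = F z" by blast
    obtain l where l: "l \<in> L" "norm (z - l) \<le> norm w1 + norm w2" using fundamental_reduction by blast
    have "F z = F (z - l)" using Fper[OF l(1), of "z - l"] by simp
    then show "y \<in> F ` cball 0 (norm w1 + norm w2)" using y l by auto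
  qed
  ultimately have "bounded (range F)" using bounded_subset by blast
  then obtain c where c: "\<And>z. F z = c" using Liouville_theorem[OF Fhol] by (metis constant_on_def UNIV_I)
  show ?thesis using c by (intro exI[of _ c]) (metis F_def)
qed

end

context cm_lattice
begin

text \<open>For fixed v the difference of the two sides is elliptic in u, because the quasi-periods
  cancel. It tends to 0 at u = 0, and u -> - v - u preserves it while exchanging the two classes of
  singularities; so it is constant, hence 0.\<close>

lemma zeta_addition:
  assumes u: "u \<notin> L" and v: "v \<notin> L" and uv: "u + v \<notin> L"
  shows "(zeta u + zeta v - zeta (u + v))^2 = wp u + wp v + wp (u + v)"
proof -
  define f where "f u = (zeta u + zeta v - zeta (u + v))^2 - wp u - wp v - wp (u + v)" for u
  define S where "S = {u. u \<in> L \<or> u + v \<in> L}"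
  have lim0: "(f \<longlongrightarrow> 0) (at 0)"
  proof -
    \<comment> \<open>zeta u + zeta v - zeta (u + v) is 1/u + h u with h 0 = 0 and h' 0 = wp v. In
      the square the double pole cancels against wp u, and 2 h u / u tends to 2 wp v, cancelling wp
      v + wp (u + v).\<close>
    define h where "h u = zeta0 u - (zeta (u + v) - zeta v)" for u
    have dz: "((\<lambda>u. zeta (u + v)) has_field_derivative - wp v) (at 0)"
      using zeta_has_deriv[OF v] DERIV_shift[of zeta "- wp v" 0 v] by simp
    have "(h has_field_derivative (- wp0 0) - (- wp v - 0)) (at 0)" unfolding h_def
      by (intro derivative_intros dz zeta0_has_deriv) auto
    then have hd: "(h has_field_derivative wp v) (at 0)" by simp
    have h0: "h 0 = 0" by (simp add: h_def)
    have l1: "((\<lambda>u. h u / u) \<longlongrightarrow> wp v) (at 0)"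
      using hd h0 by (simp add: has_field_derivative_iff)
    have l2: "(h \<longlongrightarrow> 0) (at 0)" using DERIV_isCont[OF hd] h0 by (simp add: isCont_def)
    have "isCont wp0 0" using holomorphic_on_imp_continuous_on[OF wp0_holo] open_Compl[OF closed_L0]
      by (simp add: continuous_on_eq_continuous_at)
    then have l3: "(wp0 \<longlongrightarrow> 0) (at 0)" by (simp add: isCont_def)
    have "isCont wp v" using holomorphic_on_imp_continuous_on[OF wp_holo] open_Compl[OF closed_L] v
      by (simp add: continuous_on_eq_continuous_at)
    then have l4: "((\<lambda>u. wp (u + v)) \<longlongrightarrow> wp v) (at 0)"
      using LIM_offset[of wp "wp v" v v] by (simp add: isCont_def)
    have "((\<lambda>u. 2 * (h u / u) + h u^2 - wp0 u - wp v - wp (u + v)) \<longlongrightarrow> 2 * wp v + 0^2 - 0 - wp v - wp v) (at 0)"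
      by (intro tendsto_intros l1 l2 l3 l4)
    moreover have "eventually (\<lambda>u. 2 * (h u / u) + h u^2 - wp0 u - wp v - wp (u + v) = f u) (at 0)"
      unfolding eventually_at
    proof (intro exI[of _ 1] conjI ballI impI)
      fix u :: complex assume "u \<noteq> 0 \<and> dist u 0 < 1"
      then have "u \<noteq> 0" by simp
      have "zeta u + zeta v - zeta (u + v) = inverse u + h u" by (simp add: zeta_split[of u] h_def)
      then have fu: "f u = (inverse u + h u)^2 - (inverse (u^2) + wp0 u) - wp v - wp (u + v)"
        by (simp only: f_def wp_split[of u])
      then show "2 * (h u / u) + h u^2 - wp0 u - wp v - wp (u + v) = f u"
      proof -
        have "(inverse u + h u)^2 = inverse (u^2) + 2 * (h u / u) + h u^2"
          using \<open>u \<noteq> 0\<close> by (simp add: power2_eq_square field_simps)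
        then show ?thesis using fu by simp
      qed
    qed auto
    ultimately show ?thesis by (simp add: tendsto_cong)
  qed
  have per: "f (z + l) = f z" if "l \<in> L" for z l
  proof -
    have "zeta (z + l + v) = zeta (z + v) + (e2 * l + kap * cnj l)" "wp (z + l + v) = wp (z + v)"
      using zeta_periodic[OF that, of "z + v"] wp_periodic[OF that, of "z + v"] by (simp_all add: add_ac)
    then show ?thesis using zeta_periodic[OF that, of z] wp_periodic[OF that, of z] by (simp add: f_def add_diff_eq)
  qed
  have sym: "f (- v - z) = f z" for z
  proof -
    have "zeta (- v - z) = - zeta (z + v)" "wp (- v - z) = wp (z + v)"
      using zeta_minus[of "z + v"] wp_minus[of "z + v"] by (simp_all add: add_ac)
    moreover have "zeta (- v - z + v) = - zeta z" "wp (- v - z + v) = wp z" using zeta_minus[of z] wp_minus[of z] by auto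
    ultimately show ?thesis by (simp add: f_def algebra_simps)
  qed
  have limp: "(f \<longlongrightarrow> 0) (at p)" if "p \<in> S" for p
  proof -
    have *: "(f \<longlongrightarrow> 0) (at p)" if "p \<in> L" for p
    proof -
      have "f (z + - p) = f z" for z using per[OF L_uminus[OF that], of z] by simp
      then show ?thesis using LIM_offset[OF lim0, of "- p"] by simp
    qed
    show ?thesis
    proof (cases "p \<in> L")
      case False
      then have pv: "- v - p \<in> L" using that L_uminus[of "v + p"] by (simp add: S_def add.commute minus_diff_commute)
      have "((\<lambda>z. f (- v - z)) \<longlongrightarrow> 0) (at p)"
      proof (rule tendsto_compose_eventually[OF *[OF pv]])
        show "((\<lambda>z. - v - z) \<longlongrightarrow> - v - p) (at p)" by (intro tendsto_intros)
        show "eventually (\<lambda>z. - v - z \<noteq> - v - p) (at p)" by (auto simp: eventually_at intro: exI[of _ 1])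
      qed
      then show ?thesis by (simp add: sym)
    qed (use * in auto)
  qed
  have fin: "finite {x \<in> S. norm x \<le> R}" for R
  proof -
    have "{x \<in> S. norm x \<le> R} \<subseteq> {x \<in> L. norm x \<le> R} \<union> (\<lambda>x. x - v) ` {x \<in> L. norm x \<le> R + norm v}"
    proof
      fix x assume x: "x \<in> {x \<in> S. norm x \<le> R}"
      show "x \<in> {x \<in> L. norm x \<le> R} \<union> (\<lambda>x. x - v) ` {x \<in> L. norm x \<le> R + norm v}"
      proof (cases "x \<in> L")
        case False
        then have "x + v \<in> L" "norm (x + v) \<le> R + norm v" using x norm_triangle_ineq[of x v] by (auto simp: S_def)
        then have "x \<in> (\<lambda>x. x - v) ` {x \<in> L. norm x \<le> R + norm v}" by (intro image_eqI[of _ _ "x + v"]) auto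
        then show ?thesis by blast
      qed (use x in auto)
    qed
    then show ?thesis by (rule finite_subset) (auto intro!: finite_L_ball)
  qed
  have "\<exists>c. \<forall>z. z \<notin> S \<longrightarrow> f z = c"
  proof (rule liouville_lattice[OF fin])
    have 1: "(\<lambda>u. u + v) holomorphic_on - S" by (intro holomorphic_intros)
    have 2: "(\<lambda>u. u + v) ` (- S) \<subseteq> - L" by (auto simp: S_def)
    have "(\<lambda>u. zeta (u + v)) holomorphic_on - S" "(\<lambda>u. wp (u + v)) holomorphic_on - S"
      using holomorphic_on_compose_gen[OF 1 zeta_holo 2] holomorphic_on_compose_gen[OF 1 wp_holo 2]
      by (simp_all add: o_def)
    then show "f holomorphic_on - S" unfolding f_def
      by (intro holomorphic_intros holomorphic_on_subset[OF zeta_holo] holomorphic_on_subset[OF wp_holo]) (auto simp: S_def)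
    show "z + l \<in> S" if "l \<in> L" "z \<in> S" for z l
      using that L_add_iff[of l z] L_add_iff[of l "z + v"] by (auto simp: S_def add_ac)
    show "f (z + l) = f z" if "l \<in> L" "z \<notin> S" for z l using per that by blast
    show "\<exists>c. (f \<longlongrightarrow> c) (at p)" if "p \<in> S" for p using limp[OF that] by blast
  qed
  then obtain c where c: "\<And>z. z \<notin> S \<Longrightarrow> f z = c" by blast
  obtain r where r: "r > 0" "ball 0 r \<inter> S \<subseteq> {0}" using locally_finite_closed(1)[OF fin] by blast
  have "z \<notin> S" if "z \<noteq> 0" "dist z 0 < r" for z using r(2) that by auto
  then have "eventually (\<lambda>z. f z = c) (at 0)" unfolding eventually_at
    using r(1) c by (intro exI[of _ r]) blast
  then have "(f \<longlongrightarrow> c) (at 0)" by (simp add: tendsto_eventually)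
  then have "c = 0" using lim0 LIM_unique by blast
  then have "f u = 0" using c[of u] u uv by (simp add: S_def)
  then show ?thesis by (simp add: f_def algebra_simps)
qed

definition chi :: "complex \<Rightarrow> complex" where "chi z = (if z \<in> L then 1 else 0)"

abbreviation E1 :: "complex \<Rightarrow> complex" where "E1 z \<equiv> eisE L 1 z"

text \<open>The \<open>chi\<close> terms account for triples with a lattice point, where \<open>E1\<close> and \<open>wp\<close> vanish.\<close>
lemma E1_three_term:
  assumes "u + v + w = 0"
  shows "2 * (E1 u * E1 v + E1 v * E1 w + E1 w * E1 u) =
     (wp u - E1 u^2) + (wp v - E1 v^2) + (wp w - E1 w^2) - 2 * (chi u * wp v + chi v * wp w + chi w * wp u)"
proof -
  have w: "w = - (u + v)" using assms by (simp add: add_eq_0_iff)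
  have odd: "E1 (- z) = - E1 z" for z using eisE_minus[of 1 z] by simp
  have shift: "E1 (l + z) = E1 z" "wp (l + z) = wp z" if "l \<in> L" for l z
    using eisE_periodic[OF that, of 1 z] wp_periodic[OF that, of z] by (simp_all add: add.commute)
  consider (u) "u \<in> L" | (v) "u \<notin> L" "v \<in> L" | (w) "u \<notin> L" "v \<notin> L" "w \<in> L" | (g) "u \<notin> L" "v \<notin> L" "w \<notin> L" by blast
  then show ?thesis
  proof cases
    \<comment> \<open>If a triple meets L in one point only, the other two are opposite modulo L,
      both sides reduce to - 2 \<open>E1\<close>^2 there, and one \<open>chi\<close> term removes
      the surplus 2 \<open>wp\<close>.\<close>
    case u
    have E: "E1 w = - E1 v" "wp w = wp v"
      unfolding w using odd[of "u + v"] wp_minus[of "u + v"] shift[OF u, of v] by auto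
    have "w \<in> L \<longleftrightarrow> v \<in> L" unfolding w L_uminus_iff using L_add_iff'[OF u] .
    then show ?thesis using u E eisE_1_L[OF u] wp_L[OF u] wp_L[of v] eisE_1_L[of v]
      by (auto simp: chi_def power2_eq_square)
  next
    case v
    have E: "E1 w = - E1 u" "wp w = wp u"
      unfolding w using odd[of "u + v"] wp_minus[of "u + v"] shift[OF v(2), of u] by (auto simp: add.commute)
    have "w \<in> L \<longleftrightarrow> u \<in> L" unfolding w L_uminus_iff using L_add_iff[OF v(2)] .
    then show ?thesis using v E eisE_1_L[OF v(2)] wp_L[OF v(2)]
      by (auto simp: chi_def power2_eq_square)
  next
    case w': w
    have "v = - u + - w" using assms by (simp add: algebra_simps add_eq_0_iff)
    then have E: "E1 v = - E1 u" "wp v = wp u"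
      using odd[of u] wp_minus[of u] shift[of "- w" "- u"] w'(3) by (auto simp: add.commute)
    show ?thesis using w' E eisE_1_L[OF w'(3)] wp_L[OF w'(3)]
      by (auto simp: chi_def power2_eq_square)
  next
    case g
    have uv: "u + v \<notin> L" using g(3) L_uminus_iff[of "u + v"] unfolding w by blast
    have s: "zeta u + zeta v - zeta (u + v) = E1 u + E1 v + E1 w"
      unfolding eisE_1 w zeta_minus by (simp add: algebra_simps)
    have wpw: "wp (u + v) = wp w" unfolding w wp_minus ..
    have "(E1 u + E1 v + E1 w)^2 = wp u + wp v + wp w"
      using zeta_addition[OF g(1,2) uv] by (simp add: s wpw)
    then show ?thesis using g by (simp add: chi_def power2_eq_square algebra_simps)
  qed
qed

end

section \<open>Lattice means\<close>

context lattice_basis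
begin

definition lmean :: "nat \<Rightarrow> (complex \<Rightarrow> complex) \<Rightarrow> complex" where
  "lmean N g = bsum N g / of_nat N^2"

lemma lmean_cong: "(\<And>x. x \<in> L \<Longrightarrow> f x = g x) \<Longrightarrow> lmean N f = lmean N g"
  unfolding lmean_def by (metis bsum_cong)

lemma lmean_add: "lmean N (\<lambda>x. f x + g x) = lmean N f + lmean N g"
  by (simp add: lmean_def bsum_add add_divide_distrib)
lemma lmean_diff: "lmean N (\<lambda>x. f x - g x) = lmean N f - lmean N g"
  by (simp add: lmean_def bsum_diff diff_divide_distrib)
lemma lmean_uminus: "lmean N (\<lambda>x. - f x) = - lmean N f"
  by (simp add: lmean_def bsum_uminus)
lemma lmean_cmult: "lmean N (\<lambda>x. c * f x) = c * lmean N f"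
  by (simp add: lmean_def bsum_cmult)
lemma lmean_cmult_right: "lmean N (\<lambda>x. f x * c) = lmean N f * c"
  by (simp add: lmean_def bsum_cmult_right)
lemma lmean_const: "N > 0 \<Longrightarrow> lmean N (\<lambda>x. c) = c"
  by (simp add: lmean_def bsum_const)
lemma lmean_swap: "lmean N (\<lambda>x. lmean M (\<lambda>y. f x y)) = lmean M (\<lambda>y. lmean N (\<lambda>x. f x y))"
proof -
  have "bsum N (\<lambda>x. inverse (of_nat M^2) * bsum M (\<lambda>y. f x y)) / of_nat N^2 =
        bsum M (\<lambda>y. inverse (of_nat N^2) * bsum N (\<lambda>x. f x y)) / of_nat M^2"
    unfolding bsum_cmult by (subst bsum_swap) (simp add: field_simps)
  then show ?thesis by (simp add: lmean_def divide_inverse mult.commute)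
qed
lemma lmean_shift: "periodic N g \<Longrightarrow> N > 0 \<Longrightarrow> l \<in> L \<Longrightarrow> lmean N (\<lambda>x. g (x + l)) = lmean N g"
  by (simp add: lmean_def bsum_shift)

definition mdvd :: "complex \<Rightarrow> nat \<Rightarrow> bool" where
  "mdvd m N \<longleftrightarrow> m \<in> multipliers L \<and> (\<exists>n\<in>multipliers L. of_nat N = m * n)"

definition Lper :: "(complex \<Rightarrow> complex) \<Rightarrow> bool" where
  "Lper f \<longleftrightarrow> (\<forall>z. \<forall>l\<in>L. f (z + l) = f z)"

lemma LperD: "Lper f \<Longrightarrow> l \<in> L \<Longrightarrow> f (z + l) = f z" by (simp add: Lper_def)

lemma mdvd_shift:
  assumes "mdvd m N" "N > 0" "r \<in> multipliers L" "l \<in> L"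
  shows "r * (of_nat N * l) / m \<in> L"
proof -
  obtain n where n: "n \<in> multipliers L" "of_nat N = m * n" using assms by (auto simp: mdvd_def)
  have "m \<noteq> 0" using n(2) assms(2) by auto
  then have "r * (of_nat N * l) / m = r * (n * l)" using n by simp
  then show ?thesis using multipliersD assms n by metis
qed

lemma Lper_periodic:
  assumes f: "Lper f" and m: "mdvd m N" "N > 0" and r: "r \<in> multipliers L"
  shows "periodic N (\<lambda>x. f (r * x / m + z))"
  unfolding periodic_def
proof (intro ballI)
  fix x l assume "x \<in> L" "l \<in> L"
  have e: "r * (x + of_nat N * l) / m + z = (r * x / m + z) + r * (of_nat N * l) / m"
    by (simp add: ring_distribs add_divide_distrib)
  show "f (r * (x + of_nat N * l) / m + z) = f (r * x / m + z)"
    unfolding e by (rule LperD[OF f mdvd_shift[OF m r \<open>l \<in> L\<close>]])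
qed

lemma periodic_mult: "periodic N f \<Longrightarrow> periodic N g \<Longrightarrow> periodic N (\<lambda>x. f x * g x :: complex)"
  by (simp add: periodic_def)

text \<open>Averaging additionally over translates by multiples of \<open>c\<close> makes the distribution relations applicable.\<close>
lemma lmean_split:
  assumes g: "periodic N g" and N: "N > 0" and c: "c \<in> multipliers L"
  shows "lmean N g = lmean N (\<lambda>x. lmean N (\<lambda>y. g (x + c * y)))"
proof -
  have "lmean N (\<lambda>x. lmean N (\<lambda>y. g (x + c * y))) = lmean N (\<lambda>y. lmean N (\<lambda>x. g (x + c * y)))"
    by (rule lmean_swap)
  also have "\<dots> = lmean N (\<lambda>y. lmean N g)"
    by (intro lmean_cong lmean_shift g N multipliersD c)
  also have "\<dots> = lmean N g" using N by (rule lmean_const)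
  finally show ?thesis by simp
qed

text \<open>Instead of matching residue systems bijectively, the double mean is averaged once more
  over all translations by (s a + t b, s c + t d). After exchanging the means, (x, y) is fixed, and
  becomes a translation of (s, t) through the inverse matrix.\<close>

lemma lmean_unimodular:
  fixes g :: "complex \<Rightarrow> complex \<Rightarrow> complex"
  assumes g1: "\<And>y. y \<in> L \<Longrightarrow> periodic N (\<lambda>x. g x y)" and g2: "\<And>x. x \<in> L \<Longrightarrow> periodic N (\<lambda>y. g x y)"
    and N: "N > 0"
    and A: "a \<in> multipliers L" "b \<in> multipliers L" "c \<in> multipliers L" "d \<in> multipliers L"
    and det: "a * d - b * c = 1"
  shows "lmean N (\<lambda>x. lmean N (\<lambda>y. g x y)) = lmean N (\<lambda>s. lmean N (\<lambda>t. g (s * a + t * b) (s * c + t * d)))"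
proof -
  note mL = multipliersD
  let ?G = "\<lambda>s t. g (s * a + t * b) (s * c + t * d)"
  have inL: "s * r + t * q \<in> L" if "s \<in> L" "t \<in> L" "r \<in> multipliers L" "q \<in> multipliers L" for s t r q
    using that mL[of r s] mL[of q t] by (auto simp: mult.commute)
  have 1: "lmean N (\<lambda>x. lmean N (\<lambda>y. g (x + p) (y + q))) = lmean N (\<lambda>x. lmean N (\<lambda>y. g x y))"
    if "p \<in> L" "q \<in> L" for p q
  proof -
    have "lmean N (\<lambda>x. lmean N (\<lambda>y. g (x + p) (y + q))) = lmean N (\<lambda>x. lmean N (\<lambda>y. g (x + p) y))"
      by (intro lmean_cong lmean_shift[OF g2 N]) (use that in auto)
    also have "\<dots> = lmean N (\<lambda>y. lmean N (\<lambda>x. g (x + p) y))" by (rule lmean_swap)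
    also have "\<dots> = lmean N (\<lambda>y. lmean N (\<lambda>x. g x y))"
      by (intro lmean_cong lmean_shift[OF g1 N]) (use that in auto)
    also have "\<dots> = lmean N (\<lambda>x. lmean N (\<lambda>y. g x y))" by (rule lmean_swap)
    finally show ?thesis .
  qed
  have pG1: "periodic N (\<lambda>s. ?G s t)" if t: "t \<in> L" for t
    unfolding periodic_def
  proof (intro ballI)
    fix x l assume x: "x \<in> L" and l: "l \<in> L"
    have la: "a * l \<in> L" "c * l \<in> L" using A l mL by auto
    have "?G (x + of_nat N * l) t = g ((x * a + t * b) + of_nat N * (a * l)) ((x * c + t * d) + of_nat N * (c * l))"
      by (rule arg_cong2[where f = g]) (simp_all add: algebra_simps)
    also have "\<dots> = g (x * a + t * b) ((x * c + t * d) + of_nat N * (c * l))"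
    proof -
      have "(x * c + t * d) + of_nat N * (c * l) \<in> L"
        using inL[OF x t A(3,4)] L_of_int[OF la(2), of "int N"] by auto
      then show ?thesis using g1 inL[OF x t A(1,2)] la(1) unfolding periodic_def by blast
    qed
    also have "\<dots> = ?G x t"
      using g2[OF inL[OF x t A(1,2)]] inL[OF x t A(3,4)] la(2) unfolding periodic_def by blast
    finally show "?G (x + of_nat N * l) t = ?G x t" .
  qed
  have pG2: "periodic N (\<lambda>t. ?G s t)" if s: "s \<in> L" for s
    unfolding periodic_def
  proof (intro ballI)
    fix x l assume x: "x \<in> L" and l: "l \<in> L"
    have la: "b * l \<in> L" "d * l \<in> L" using A l mL by auto
    have "?G s (x + of_nat N * l) = g ((s * a + x * b) + of_nat N * (b * l)) ((s * c + x * d) + of_nat N * (d * l))"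
      by (rule arg_cong2[where f = g]) (simp_all add: algebra_simps)
    also have "\<dots> = g (s * a + x * b) ((s * c + x * d) + of_nat N * (d * l))"
    proof -
      have "(s * c + x * d) + of_nat N * (d * l) \<in> L"
        using inL[OF s x A(3,4)] L_of_int[OF la(2), of "int N"] by auto
      then show ?thesis using g1 inL[OF s x A(1,2)] la(1) unfolding periodic_def by blast
    qed
    also have "\<dots> = ?G s x"
      using g2[OF inL[OF s x A(1,2)]] inL[OF s x A(3,4)] la(2) unfolding periodic_def by blast
    finally show "?G s (x + of_nat N * l) = ?G s x" .
  qed
  have 2: "lmean N (\<lambda>s. lmean N (\<lambda>t. g (x + (s * a + t * b)) (y + (s * c + t * d)))) = lmean N (\<lambda>s. lmean N (\<lambda>t. ?G s t))"
    if x: "x \<in> L" and y: "y \<in> L" for x y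
  proof -
    \<comment> \<open>(s0, t0) is the image of (x, y) under the inverse matrix.\<close>
    define s0 where "s0 = x * d + y * (- b)"
    define t0 where "t0 = x * (- c) + y * a"
    have st: "s0 \<in> L" "t0 \<in> L" unfolding s0_def t0_def by (intro inL x y A multipliers_uminus)+
    have "s0 * a + t0 * b = x * (a * d - b * c)" "s0 * c + t0 * d = y * (a * d - b * c)"
      by (simp_all add: s0_def t0_def algebra_simps)
    then have xy: "x = s0 * a + t0 * b" "y = s0 * c + t0 * d" using det by simp_all
    have "lmean N (\<lambda>s. lmean N (\<lambda>t. g (x + (s * a + t * b)) (y + (s * c + t * d)))) =
       lmean N (\<lambda>s. lmean N (\<lambda>t. ?G (s + s0) (t + t0)))"
      unfolding xy by (simp add: algebra_simps)
    also have "\<dots> = lmean N (\<lambda>s. lmean N (\<lambda>t. ?G (s + s0) t))"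
      by (intro lmean_cong lmean_shift[OF pG2 N]) (use st in auto)
    also have "\<dots> = lmean N (\<lambda>t. lmean N (\<lambda>s. ?G (s + s0) t))" by (rule lmean_swap)
    also have "\<dots> = lmean N (\<lambda>t. lmean N (\<lambda>s. ?G s t))"
      by (intro lmean_cong lmean_shift[OF pG1 N]) (use st in auto)
    also have "\<dots> = lmean N (\<lambda>s. lmean N (\<lambda>t. ?G s t))" by (rule lmean_swap)
    finally show ?thesis .
  qed
  have "lmean N (\<lambda>x. lmean N (\<lambda>y. g x y)) = lmean N (\<lambda>s. lmean N (\<lambda>t. lmean N (\<lambda>x. lmean N (\<lambda>y. g x y))))"
    using N by (simp add: lmean_const)
  also have "\<dots> = lmean N (\<lambda>s. lmean N (\<lambda>t. lmean N (\<lambda>x. lmean N (\<lambda>y. g (x + (s * a + t * b)) (y + (s * c + t * d))))))"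
    by (intro lmean_cong 1[symmetric] inL A)
  also have "\<dots> = lmean N (\<lambda>s. lmean N (\<lambda>x. lmean N (\<lambda>t. lmean N (\<lambda>y. g (x + (s * a + t * b)) (y + (s * c + t * d))))))"
    by (intro lmean_cong lmean_swap)
  also have "\<dots> = lmean N (\<lambda>x. lmean N (\<lambda>s. lmean N (\<lambda>t. lmean N (\<lambda>y. g (x + (s * a + t * b)) (y + (s * c + t * d))))))"
    by (rule lmean_swap)
  also have "\<dots> = lmean N (\<lambda>x. lmean N (\<lambda>s. lmean N (\<lambda>y. lmean N (\<lambda>t. g (x + (s * a + t * b)) (y + (s * c + t * d))))))"
    by (intro lmean_cong lmean_swap)
  also have "\<dots> = lmean N (\<lambda>x. lmean N (\<lambda>y. lmean N (\<lambda>s. lmean N (\<lambda>t. g (x + (s * a + t * b)) (y + (s * c + t * d))))))"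
    by (intro lmean_cong lmean_swap)
  also have "\<dots> = lmean N (\<lambda>x. lmean N (\<lambda>y. lmean N (\<lambda>s. lmean N (\<lambda>t. ?G s t))))"
    by (intro lmean_cong 2)
  also have "\<dots> = lmean N (\<lambda>s. lmean N (\<lambda>t. ?G s t))" using N by (simp add: lmean_const)
  finally show ?thesis .
qed

end

section \<open>Distribution relations\<close>

context lattice_basis
begin

lemma mdvdD: "mdvd m N \<Longrightarrow> m \<in> multipliers L" by (simp add: mdvd_def)

lemma mdvd_nonzero: "mdvd m N \<Longrightarrow> N > 0 \<Longrightarrow> m \<noteq> 0"
  by (auto simp: mdvd_def)

lemma mdvd_mult_left: "mdvd (m * n) N \<Longrightarrow> m \<in> multipliers L \<Longrightarrow> n \<in> multipliers L \<Longrightarrow> mdvd m N"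
  unfolding mdvd_def by (metis mult.assoc multipliers_mult)

lemma mdvd_mult_right: "mdvd (m * n) N \<Longrightarrow> m \<in> multipliers L \<Longrightarrow> n \<in> multipliers L \<Longrightarrow> mdvd n N"
  using mdvd_mult_left[of n m N] by (simp add: mult.commute)

lemma mdvd_exists:
  assumes "m \<in> multipliers L" "m \<noteq> 0"
  shows "\<exists>N>0. mdvd m N"
proof -
  obtain N where N: "m * cnj m = of_nat N" using multiplier_norm[OF assms(1)] by metis
  have "N \<noteq> 0" using N assms(2) by (intro notI) auto
  then show ?thesis using N multipliers_cnj[OF assms(1)] assms(1) unfolding mdvd_def
    by (intro exI[of _ N]) (auto intro!: bexI[of _ "cnj m"])
qed

text \<open>The common shape of the relations for \<open>E1\<close>, \<open>eisE L 2\<close> and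
  \<open>chi\<close>, with factors 1 / cnj m, m / cnj m and 1 / |m|^2. Means of products are thus
  computed once for any two such functions.\<close>

definition distr_rel :: "nat \<Rightarrow> (complex \<Rightarrow> complex) \<Rightarrow> (complex \<Rightarrow> complex) \<Rightarrow> bool" where
  "distr_rel N f \<phi> \<longleftrightarrow> Lper f \<and> (\<forall>m z. mdvd m N \<longrightarrow> lmean N (\<lambda>x. f ((z + x) / m)) = \<phi> m * f z)"

lemma distrD: "distr_rel N f \<phi> \<Longrightarrow> mdvd m N \<Longrightarrow> lmean N (\<lambda>x. f ((z + x) / m)) = \<phi> m * f z"
  by (simp add: distr_rel_def)

lemma distr_rel_Lper: "distr_rel N f \<phi> \<Longrightarrow> Lper f" by (simp add: distr_rel_def)

end

context cm_lattice
begin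

lemma E1_distr_rel: "N > 0 \<Longrightarrow> distr_rel N E1 (\<lambda>m. 1 / cnj m)"
proof -
  assume N: "N > 0"
  have "lmean N (\<lambda>x. E1 ((z + x) / m)) = 1 / cnj m * E1 z" if m: "mdvd m N" for m z
  proof -
    obtain n where n: "m \<in> multipliers L" "n \<in> multipliers L" "of_nat N = m * n" using m by (auto simp: mdvd_def)
    have m0: "m \<noteq> 0" using m N by (rule mdvd_nonzero)
    have "m / (of_real (norm m))^2 = 1 / cnj m"
      using m0 complex_norm_square[of m] by (simp add: field_simps)
    moreover have "lmean N (\<lambda>x. E1 ((z + x) / m)) = m / (of_real (norm m))^2 * E1 z"
      using eisE_distribution[OF n(1) m0 n(2,3) N, of 1 z] N by (simp add: lmean_def)
    ultimately show ?thesis by simp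
  qed
  then show ?thesis by (simp add: distr_rel_def Lper_def eisE_periodic)
qed

lemma E2_distr_rel: "N > 0 \<Longrightarrow> distr_rel N (eisE L 2) (\<lambda>m. m / cnj m)"
proof -
  assume N: "N > 0"
  have "lmean N (\<lambda>x. eisE L 2 ((z + x) / m)) = m / cnj m * eisE L 2 z" if m: "mdvd m N" for m z
  proof -
    obtain n where n: "m \<in> multipliers L" "n \<in> multipliers L" "of_nat N = m * n" using m by (auto simp: mdvd_def)
    have m0: "m \<noteq> 0" using m N by (rule mdvd_nonzero)
    have "m^2 / (of_real (norm m))^2 = m / cnj m"
      using m0 complex_norm_square[of m] by (simp add: field_simps power2_eq_square)
    moreover have "lmean N (\<lambda>x. eisE L 2 ((z + x) / m)) = m^2 / (of_real (norm m))^2 * eisE L 2 z"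
      using eisE_distribution[OF n(1) m0 n(2,3) N, of 2 z] N by (simp add: lmean_def)
    ultimately show ?thesis by simp
  qed
  then show ?thesis by (simp add: distr_rel_def Lper_def eisE_periodic)
qed

lemma chi_distr_rel: "N > 0 \<Longrightarrow> distr_rel N chi (\<lambda>m. 1 / of_real (norm m)^2)"
proof -
  assume N: "N > 0"
  have "lmean N (\<lambda>x. chi ((z + x) / m)) = 1 / of_real (norm m)^2 * chi z" if m: "mdvd m N" for m z
  proof -
    obtain n where n: "m \<in> multipliers L" "n \<in> multipliers L" "of_nat N = m * n" using m by (auto simp: mdvd_def)
    have m0: "m \<noteq> 0" using m N by (rule mdvd_nonzero)
    show ?thesis
    proof (cases "z \<in> L")
      case True
      have "bsum N (\<lambda>x. chi ((x + z) / m)) = bsum N (\<lambda>x. chi (x / m))"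
        using bsum_shift[OF periodic_indicator[OF n(1) m0 n(2,3), of "\<lambda>x. x" 0 1 0] N True] by (simp add: chi_def)
      also have "\<dots> = of_real (bsum N (\<lambda>x. if x / m \<in> L then 1 else 0))"
        unfolding bsum_def of_real_sum by (intro sum.cong refl) (simp add: chi_def)
      also have "\<dots> = of_nat N^2 / of_real (norm m)^2" by (subst bsum_msub[OF n(1) m0 n(2,3) N]) simp
      finally show ?thesis using True N by (simp add: lmean_def chi_def add.commute)
    next
      case False
      have "chi ((z + x) / m) = 0" if "x \<in> L" for x
      proof -
        have "(z + x) / m \<notin> L"
        proof
          assume "(z + x) / m \<in> L"
          then have "m * ((z + x) / m) \<in> L" using multipliersD n(1) by blast
          then show False using m0 False L_add_iff[OF that, of z] by simp
        qed
        then show ?thesis by (simp add: chi_def)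
      qed
      then have "lmean N (\<lambda>x. chi ((z + x) / m)) = lmean N (\<lambda>x. 0)" by (intro lmean_cong)
      then show ?thesis using False N by (simp add: lmean_const chi_def)
    qed
  qed
  moreover have "Lper chi" by (auto simp: Lper_def chi_def L_add_iff)
  ultimately show ?thesis by (simp add: distr_rel_def)
qed

lemma wp_eq: "wp z = eisE L 2 z - e2" by (simp add: eisE_2)

lemma E1_minus: "E1 (- z) = - E1 z" using eisE_minus[of 1 z] by simp
lemma chi_minus: "chi (- z) = chi z" by (simp add: chi_def)
lemma chi_0: "l \<in> L \<Longrightarrow> chi l = 1" by (simp add: chi_def)

lemma Lper_E1: "Lper E1" and Lper_wp: "Lper wp" and Lper_chi: "Lper chi"
  by (auto simp: Lper_def chi_def L_add_iff wp_periodic eisE_periodic)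

text \<open>The part of the expanded three-term identity that depends on a single point.\<close>

definition wp_defect :: "complex \<Rightarrow> complex" where "wp_defect z = wp z - E1 z^2"

lemma Lper_wp_defect: "Lper wp_defect" using Lper_E1 Lper_wp by (simp add: Lper_def wp_defect_def)
lemma wp_defect_minus: "wp_defect (- z) = wp_defect z" unfolding wp_defect_def wp_minus E1_minus by simp

lemma three_term': "u + v + w = 0 \<Longrightarrow> 2 * (E1 u * E1 v + E1 v * E1 w + E1 w * E1 u) =
     wp_defect u + wp_defect v + wp_defect w - 2 * (chi u * wp v + chi v * wp w + chi w * wp u)"
  using E1_three_term[of u v w] by (simp add: wp_defect_def)

lemma lmean_wp:
  assumes N: "N > 0" and n: "mdvd n N" and z: "z \<in> L"
  shows "lmean N (\<lambda>x. wp ((z + x) / n)) = (n / cnj n - 1) * e2"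
proof -
  have "lmean N (\<lambda>x. wp ((z + x) / n)) = n / cnj n * eisE L 2 z - e2"
    unfolding wp_eq lmean_diff distrD[OF E2_distr_rel[OF N] n] using N by (simp add: lmean_const)
  also have "eisE L 2 z = e2" by (simp add: eisE_2 wp_L[OF z])
  finally show ?thesis by (simp add: algebra_simps)
qed

text \<open>The mean of \<open>E1\<close>^2 is no direct consequence of a distribution relation.
  Average the three-term identity over x and y for the triple x/n, - y/n, (y - x)/n: the
  \<open>E1\<close> products have mean 0, as \<open>E1\<close> vanishes on L, the three defects have
  equal means R, and each \<open>chi\<close> term has mean QP. Hence 3R = 6QP.\<close>

lemma lmean_wp_defect:
  assumes N: "N > 0" and n: "mdvd n N"
  shows "lmean N (\<lambda>x. wp_defect (x / n)) = 2 / of_real (norm n)^2 * (n / cnj n - 1) * e2"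
proof -
  let ?M = "\<lambda>g. lmean N (\<lambda>x. lmean N (\<lambda>y. g x y))"
  define P where "P = (n / cnj n - 1) * e2"
  define Q where "Q = (1 / of_real (norm n)^2 :: complex)"
  define R where "R = lmean N (\<lambda>x. wp_defect (x / n))"
  have e1: "lmean N (\<lambda>x. E1 ((z + x) / n)) = 0" if "z \<in> L" for z
    using distrD[OF E1_distr_rel[OF N] n, of z] eisE_1_L[OF that] by simp
  have c1: "lmean N (\<lambda>x. chi ((z + x) / n)) = Q" if "z \<in> L" for z
    using distrD[OF chi_distr_rel[OF N] n, of z] chi_0[OF that] by (simp add: Q_def)
  have w1: "lmean N (\<lambda>x. wp ((z + x) / n)) = P" if "z \<in> L" for z
    using lmean_wp[OF N n that] by (simp add: P_def)
  have h1: "lmean N (\<lambda>x. wp_defect ((x + z) / n)) = R" if "z \<in> L" for z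
    using lmean_shift[OF Lper_periodic[OF Lper_wp_defect n N multipliers_1, of 0] N that] by (simp add: R_def)
  have neg: "(- y) / n = - ((0 + y) / n)" for y by simp
  have eq: "2 * (E1 (x / n) * E1 (- y / n) + E1 (- y / n) * E1 ((- x + y) / n) + E1 ((- x + y) / n) * E1 (x / n)) =
     wp_defect (x / n) + wp_defect (- y / n) + wp_defect ((- x + y) / n)
     - 2 * (chi (x / n) * wp (- y / n) + chi (- y / n) * wp ((- x + y) / n) + chi ((- x + y) / n) * wp (x / n))" for x y
    by (rule three_term') (simp add: diff_divide_distrib)
  have t1: "?M (\<lambda>x y. E1 (x / n) * E1 (- y / n)) = 0"
    unfolding neg E1_minus using e1[of 0] N by (simp add: lmean_cmult lmean_uminus lmean_const)
  have t3: "?M (\<lambda>x y. E1 ((- x + y) / n) * E1 (x / n)) = 0"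
  proof -
    have "?M (\<lambda>x y. E1 ((- x + y) / n) * E1 (x / n)) = lmean N (\<lambda>x. 0)"
      unfolding lmean_cmult_right by (rule lmean_cong) (simp only: e1 L_uminus mult_zero_left)
    then show ?thesis using N by (simp add: lmean_const)
  qed
  have neg': "(- x + y) / n = - ((- y + x) / n)" for x y
    using minus_divide_left[of "- y + x" n] by simp
  have t2: "?M (\<lambda>x y. E1 (- y / n) * E1 ((- x + y) / n)) = 0"
  proof -
    have "?M (\<lambda>x y. E1 (- y / n) * E1 ((- x + y) / n)) = lmean N (\<lambda>y. lmean N (\<lambda>x. E1 (- y / n) * - E1 ((- y + x) / n)))"
    proof -
      have "E1 ((- x + y) / n) = - E1 ((- y + x) / n)" for x y unfolding neg'[of x y] E1_minus ..
      then show ?thesis by (subst lmean_swap) (rule lmean_cong, rule lmean_cong, rule arg_cong)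
    qed
    also have "\<dots> = lmean N (\<lambda>y. 0)"
      unfolding lmean_cmult lmean_uminus by (rule lmean_cong) (simp only: e1 L_uminus minus_zero mult_zero_right)
    finally show ?thesis using N by (simp add: lmean_const)
  qed
  have u1: "?M (\<lambda>x y. wp_defect (x / n)) = R" using N by (simp add: lmean_const R_def)
  have u2: "?M (\<lambda>x y. wp_defect (- y / n)) = R" using N by (simp add: lmean_const R_def wp_defect_minus)
  have u3: "?M (\<lambda>x y. wp_defect ((- x + y) / n)) = R"
  proof -
    have "?M (\<lambda>x y. wp_defect ((- x + y) / n)) = lmean N (\<lambda>x. R)"
      by (rule lmean_cong) (simp only: add.commute[of "- x" for x] h1 L_uminus)
    then show ?thesis using N by (simp add: lmean_const)
  qed
  have v1: "?M (\<lambda>x y. chi (x / n) * wp (- y / n)) = Q * P"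
    unfolding neg wp_minus lmean_cmult using w1[of 0] c1[of 0] by (simp add: lmean_cmult_right)
  have v3: "?M (\<lambda>x y. chi ((- x + y) / n) * wp (x / n)) = Q * P"
  proof -
    have "?M (\<lambda>x y. chi ((- x + y) / n) * wp (x / n)) = lmean N (\<lambda>x. Q * wp (x / n))"
      unfolding lmean_cmult_right by (rule lmean_cong) (simp only: c1 L_uminus)
    then show ?thesis using w1[of 0] by (simp add: lmean_cmult)
  qed
  have v2: "?M (\<lambda>x y. chi (- y / n) * wp ((- x + y) / n)) = Q * P"
  proof -
    have "?M (\<lambda>x y. chi (- y / n) * wp ((- x + y) / n)) = lmean N (\<lambda>y. lmean N (\<lambda>x. chi (- y / n) * wp ((- y + x) / n)))"
    proof -
      have "wp ((- x + y) / n) = wp ((- y + x) / n)" for x y unfolding neg'[of x y] wp_minus ..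
      then show ?thesis by (subst lmean_swap) (rule lmean_cong, rule lmean_cong, rule arg_cong)
    qed
    also have "\<dots> = lmean N (\<lambda>y. chi (- y / n) * P)"
      unfolding lmean_cmult by (rule lmean_cong) (simp only: w1 L_uminus)
    also have "\<dots> = Q * P" unfolding lmean_cmult_right using c1[of 0] by (simp add: chi_minus)
    finally show ?thesis .
  qed
  have "?M (\<lambda>x y. 2 * (E1 (x / n) * E1 (- y / n) + E1 (- y / n) * E1 ((- x + y) / n) + E1 ((- x + y) / n) * E1 (x / n))) =
     ?M (\<lambda>x y. wp_defect (x / n) + wp_defect (- y / n) + wp_defect ((- x + y) / n)
     - 2 * (chi (x / n) * wp (- y / n) + chi (- y / n) * wp ((- x + y) / n) + chi ((- x + y) / n) * wp (x / n)))"
    unfolding eq ..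
  then have "2 * (0 + 0 + 0) = R + R + R - 2 * (Q * P + Q * P + Q * P)"
    unfolding lmean_diff lmean_add lmean_cmult[of N 2] t1 t2 t3 u1 u2 u3 v1 v2 v3 .
  then have "R = 2 * Q * P" by (simp add: algebra_simps)
  then show ?thesis by (simp add: R_def P_def Q_def)
qed

text \<open>The sum over L/cL is |c|^2 times the mean modulo N, and |c|^2 / c = cnj c. A common N
  makes sums with different c comparable.\<close>

definition Dsum_mean :: "nat \<Rightarrow> complex \<Rightarrow> complex \<Rightarrow> complex" where
  "Dsum_mean N a c = cnj c * lmean N (\<lambda>x. E1 (x / c) * E1 (a * x / c))"

text \<open>Replacing y by y + c t leaves g (a y / c) fixed, while the mean over t applies the
  distribution relation for c' to f.\<close>

lemma pair_mean:
  assumes N: "N > 0" and c: "mdvd (c * c') N" "c \<in> multipliers L" "c' \<in> multipliers L"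
    and a: "a \<in> multipliers L"
    and f: "distr_rel N f \<phi>" and g: "Lper g"
  shows "lmean N (\<lambda>y. f (y / (c * c')) * g (a * y / c)) = \<phi> c' * lmean N (\<lambda>y. f (y / c) * g (a * y / c))"
proof -
  have cN: "mdvd c N" "mdvd c' N" using mdvd_mult_left[OF c] mdvd_mult_right[OF c] by auto
  have c0: "c \<noteq> 0" using mdvd_nonzero[OF cN(1) N] .
  have p1: "periodic N (\<lambda>y. f (y / (c * c')))"
    using Lper_periodic[OF distr_rel_Lper[OF f] c(1) N multipliers_1, of 0] by simp
  have p2: "periodic N (\<lambda>y. g (a * y / c))"
    using Lper_periodic[OF g cN(1) N a, of 0] by simp
  have "lmean N (\<lambda>y. f (y / (c * c')) * g (a * y / c)) =
      lmean N (\<lambda>y. lmean N (\<lambda>t. f ((y + c * t) / (c * c')) * g (a * (y + c * t) / c)))"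
    by (rule lmean_split[OF periodic_mult[OF p1 p2] N c(2)])
  also have "\<dots> = lmean N (\<lambda>y. lmean N (\<lambda>t. f ((y / c + t) / c') * g (a * y / c)))"
  proof (intro lmean_cong)
    fix y t assume "t \<in> L"
    have "(y + c * t) / (c * c') = (y / c + t) / c'" using c0 by (simp add: field_simps)
    moreover have "a * (y + c * t) / c = a * y / c + a * t" using c0 by (simp add: field_simps)
    moreover have "g (a * y / c + a * t) = g (a * y / c)"
      using LperD[OF g multipliersD[OF a \<open>t \<in> L\<close>]] .
    ultimately show "f ((y + c * t) / (c * c')) * g (a * (y + c * t) / c) = f ((y / c + t) / c') * g (a * y / c)"
      by simp
  qed
  also have "\<dots> = lmean N (\<lambda>y. \<phi> c' * (f (y / c) * g (a * y / c)))"
    unfolding lmean_cmult_right distrD[OF f cN(2)] by (simp add: mult_ac)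
  finally show ?thesis by (simp add: lmean_cmult)
qed

lemma Dsum_mean_homogeneous:
  assumes N: "N > 0" and c: "mdvd (c * l) N" "c \<in> multipliers L" "l \<in> multipliers L"
    and a: "a \<in> multipliers L"
  shows "Dsum_mean N (l * a) (l * c) = Dsum_mean N a c"
proof -
  have l0: "l \<noteq> 0" using mdvd_nonzero[OF mdvd_mult_right[OF c] N] .
  have "lmean N (\<lambda>x. E1 (x / (l * c)) * E1 ((l * a) * x / (l * c))) = lmean N (\<lambda>x. E1 (x / (c * l)) * E1 (a * x / c))"
    using l0 by (simp add: mult_ac)
  also have "\<dots> = 1 / cnj l * lmean N (\<lambda>x. E1 (x / c) * E1 (a * x / c))"
    by (rule pair_mean[OF N c a E1_distr_rel[OF N] Lper_E1])
  finally show ?thesis using l0 by (simp add: Dsum_mean_def)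
qed

text \<open>Since a d = 1 modulo c, the substitution of a x for x exchanges the two
  \<open>E1\<close> factors. The sign comes from cnj (- c) alone, because \<open>E1\<close> is odd
  and occurs twice.\<close>

lemma Dsum_mean_inverse:
  assumes N: "N > 0" and c: "mdvd c N" and A: "a \<in> multipliers L" "b \<in> multipliers L" "d \<in> multipliers L"
    and det: "a * d - b * c = 1"
  shows "Dsum_mean N d (- c) = - Dsum_mean N a c"
proof -
  have cO: "c \<in> multipliers L" using mdvdD[OF c] .
  have c0: "c \<noteq> 0" using mdvd_nonzero[OF c N] .
  define h where "h x = E1 (x / c) * E1 (d * x / c)" for x
  have ph: "periodic N h" unfolding h_def
    by (intro periodic_mult) (use Lper_periodic[OF Lper_E1 c N multipliers_1, of 0] Lper_periodic[OF Lper_E1 c N A(3), of 0] in simp_all)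
  have "lmean N h = lmean N (\<lambda>x. lmean N (\<lambda>y. h x))" using N by (simp add: lmean_const)
  \<comment> \<open>Padding h with a dummy second variable turns multiplication by a modulo c into a
    unimodular substitution.\<close>
  also have "\<dots> = lmean N (\<lambda>s. lmean N (\<lambda>t. h (s * a + t * c)))"
    by (rule lmean_unimodular[OF _ _ N A(1) cO A(2) A(3)]) (use ph det in \<open>auto simp: periodic_def algebra_simps\<close>)
  also have "\<dots> = lmean N (\<lambda>s. lmean N (\<lambda>t. E1 (s / c) * E1 (a * s / c)))"
  proof (intro lmean_cong)
    fix s t assume s: "s \<in> L" and t: "t \<in> L"
    have "(s * a + t * c) / c = a * s / c + t" using c0 by (simp add: field_simps)
    then have 1: "E1 ((s * a + t * c) / c) = E1 (a * s / c)" using LperD[OF Lper_E1 t] by simp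
    have "d * (s * a + t * c) / c = s * (a * d) / c + d * t" using c0 by (simp add: field_simps)
    also have "a * d = 1 + b * c" using det by (simp add: algebra_simps)
    also have "s * (1 + b * c) / c + d * t = s / c + (b * s + d * t)" using c0 by (simp add: field_simps)
    finally have "E1 (d * (s * a + t * c) / c) = E1 (s / c)"
      using LperD[OF Lper_E1, of "b * s + d * t"] s t A multipliersD by auto
    then show "h (s * a + t * c) = E1 (s / c) * E1 (a * s / c)" unfolding h_def 1 by (simp only: mult.commute)
  qed
  also have "\<dots> = lmean N (\<lambda>s. E1 (s / c) * E1 (a * s / c))" using N by (simp add: lmean_const)
  finally have "lmean N h = lmean N (\<lambda>s. E1 (s / c) * E1 (a * s / c))" .
  moreover have "lmean N (\<lambda>x. E1 (x / - c) * E1 (d * x / - c)) = lmean N h"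
    unfolding h_def divide_minus_right E1_minus by simp
  ultimately show ?thesis by (simp add: Dsum_mean_def)
qed

text \<open>a is invertible modulo c, so y/c and a y/c lie in L together; on L the weight 2 factor
  has the constant value \<open>e2\<close>.\<close>

lemma chi_pair:
  assumes N: "N > 0" and c: "mdvd c N" and A: "a \<in> multipliers L" "b \<in> multipliers L" "d \<in> multipliers L"
    and det: "a * d - b * c = 1"
  shows "lmean N (\<lambda>y. chi (y / c) * eisE L 2 (a * y / c)) = e2 / of_real (norm c)^2"
    and "lmean N (\<lambda>y. eisE L 2 (y / c) * chi (a * y / c)) = e2 / of_real (norm c)^2"
proof -
  have c0: "c \<noteq> 0" using mdvd_nonzero[OF c N] .
  have iff: "a * y / c \<in> L \<longleftrightarrow> y / c \<in> L" if y: "y \<in> L" for y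
  proof
    assume "y / c \<in> L" then show "a * y / c \<in> L" using multipliersD[OF A(1)] by (metis times_divide_eq_right)
  next
    assume "a * y / c \<in> L"
    then have "d * (a * y / c) - b * y \<in> L" using multipliersD A y by blast
    also have "d * (a * y / c) - b * y = (a * d - b * c) * y / c" using c0 by (simp add: field_simps)
    finally show "y / c \<in> L" by (simp add: det)
  qed
  have E: "eisE L 2 l = e2" if "l \<in> L" for l using that by (simp add: eisE_2 wp_L)
  have "lmean N (\<lambda>y. chi ((0 + y) / c)) = 1 / of_real (norm c)^2"
    using distrD[OF chi_distr_rel[OF N] c, of 0] chi_0[OF L_0] by simp
  then have *: "lmean N (\<lambda>y. e2 * chi (y / c)) = e2 / of_real (norm c)^2" by (simp add: lmean_cmult)
  show "lmean N (\<lambda>y. chi (y / c) * eisE L 2 (a * y / c)) = e2 / of_real (norm c)^2"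
    unfolding *[symmetric] by (rule lmean_cong) (use iff E in \<open>auto simp: chi_def\<close>)
  show "lmean N (\<lambda>y. eisE L 2 (y / c) * chi (a * y / c)) = e2 / of_real (norm c)^2"
    unfolding *[symmetric] by (rule lmean_cong) (use iff E in \<open>auto simp: chi_def\<close>)
qed

end

section \<open>The three-term relation\<close>

context lattice_basis
begin

text \<open>In the coordinates given by the matrix the form x c - y a becomes - t, so a double mean
  collapses to a simple one.\<close>

lemma lmean2_linear_form:
  assumes N: "N > 0" and n: "mdvd n N" and f: "Lper f"
    and A: "a \<in> multipliers L" "b \<in> multipliers L" "c \<in> multipliers L" "d \<in> multipliers L"
    and det: "a * d - b * c = 1"
  shows "lmean N (\<lambda>x. lmean N (\<lambda>y. f ((x * c - y * a) / n))) = lmean N (\<lambda>t. f (- t / n))"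
proof -
  have "lmean N (\<lambda>x. lmean N (\<lambda>y. f ((x * c - y * a) / n))) =
     lmean N (\<lambda>s. lmean N (\<lambda>t. f (((s * a + t * b) * c - (s * c + t * d) * a) / n)))"
  proof (rule lmean_unimodular[OF _ _ N A det])
    fix y
    have "(x * c - y * a) / n = c * x / n + - (y * a) / n" for x by (simp add: diff_divide_distrib mult.commute)
    then show "periodic N (\<lambda>x. f ((x * c - y * a) / n))"
      using Lper_periodic[OF f n N A(3), of "- (y * a) / n"] by simp
  next
    fix x
    have "(x * c - y * a) / n = (- a) * y / n + x * c / n" for y by (simp add: diff_divide_distrib mult.commute)
    then show "periodic N (\<lambda>y. f ((x * c - y * a) / n))"
      using Lper_periodic[OF f n N multipliers_uminus[OF A(1)], of "x * c / n"] by simp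
  qed
  also have "\<dots> = lmean N (\<lambda>s. lmean N (\<lambda>t. f (- t / n)))"
  proof (intro lmean_cong)
    fix s t
    have "(s * a + t * b) * c - (s * c + t * d) * a = - t * (a * d - b * c)" by (simp add: algebra_simps)
    then show "f (((s * a + t * b) * c - (s * c + t * d) * a) / n) = f (- t / n)" by (simp add: det)
  qed
  also have "\<dots> = lmean N (\<lambda>t. f (- t / n))" using N by (simp add: lmean_const)
  finally show ?thesis .
qed

lemma Lper_uminus: "Lper f \<Longrightarrow> Lper (\<lambda>z. f (- z))"
  unfolding Lper_def
proof (intro allI ballI)
  fix z l assume f: "\<forall>z. \<forall>l\<in>L. f (z + l) = f z" and l: "l \<in> L"
  show "f (- (z + l)) = f (- z)" using f L_uminus[OF l] by (metis minus_add_distrib)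
qed

end

context cm_lattice
begin

text \<open>For fixed y the mean over x is the distribution relation of g for r; the remaining mean
  over y is \<open>pair_mean\<close>.\<close>

lemma lmean2_pair:
  assumes N: "N > 0" and pq: "mdvd (p * q) N" "p \<in> multipliers L" "q \<in> multipliers L" and r: "mdvd r N"
    and a: "a \<in> multipliers L" and f: "distr_rel N f \<phi>" and g: "distr_rel N g \<psi>"
  shows "lmean N (\<lambda>x. lmean N (\<lambda>y. f (y / (p * q)) * g ((x * p - y * a) / (p * r)))) =
     \<psi> r * \<phi> q * lmean N (\<lambda>y. f (y / p) * g (- (a * y / p)))"
proof -
  have p0: "p \<noteq> 0" using mdvd_nonzero[OF mdvd_mult_left[OF pq] N] .
  have r0: "r \<noteq> 0" using mdvd_nonzero[OF r N] .
  have e: "(x * p - y * a) / (p * r) = (- (a * y / p) + x) / r" for x y using p0 r0 by (simp add: field_simps)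
  have "lmean N (\<lambda>x. lmean N (\<lambda>y. f (y / (p * q)) * g ((x * p - y * a) / (p * r)))) =
     lmean N (\<lambda>y. lmean N (\<lambda>x. f (y / (p * q)) * g ((- (a * y / p) + x) / r)))"
    unfolding e by (rule lmean_swap)
  also have "\<dots> = lmean N (\<lambda>y. \<psi> r * (f (y / (p * q)) * g (- (a * y / p))))"
    unfolding lmean_cmult distrD[OF g r] by (simp only: mult.left_commute[of _ "\<psi> r"] lmean_cmult)
  also have "\<dots> = \<psi> r * (\<phi> q * lmean N (\<lambda>y. f (y / p) * g (- (a * y / p))))"
    unfolding lmean_cmult using pair_mean[OF N pq a f Lper_uminus[OF distr_rel_Lper[OF g]]] by simp
  finally show ?thesis by simp
qed

text \<open>The substitution by the first matrix sends its own form to - t and the form of the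
  product matrix to that of the second factor. This brings a product in which both arguments involve
  x into the shape of \<open>lmean2_pair\<close>.\<close>

lemma lmean2_pair_transformed:
  assumes N: "N > 0" and m: "mdvd m N" and n: "mdvd n N" and f: "Lper f" and g: "Lper g"
    and A: "a \<in> multipliers L" "b \<in> multipliers L" "c \<in> multipliers L" "d \<in> multipliers L"
    and det: "a * d - b * c = 1"
    and B: "a' \<in> multipliers L" "c' \<in> multipliers L"
  shows "lmean N (\<lambda>x. lmean N (\<lambda>y. f ((x * c - y * a) / m) * g ((x * (c * a' + d * c') - y * (a * a' + b * c')) / n))) =
    lmean N (\<lambda>s. lmean N (\<lambda>t. f (- (t / m)) * g ((s * c' - t * a') / n)))"
proof -
  define a2 where "a2 = a * a' + b * c'"
  define c2 where "c2 = c * a' + d * c'"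
  have A2: "a2 \<in> multipliers L" "c2 \<in> multipliers L"
    unfolding a2_def c2_def using A B by (auto intro!: multipliers_add multipliers_mult)
  have "lmean N (\<lambda>x. lmean N (\<lambda>y. f ((x * c - y * a) / m) * g ((x * c2 - y * a2) / n))) =
    lmean N (\<lambda>s. lmean N (\<lambda>t. f (((s * a + t * b) * c - (s * c + t * d) * a) / m) * g (((s * a + t * b) * c2 - (s * c + t * d) * a2) / n)))"
  proof (rule lmean_unimodular[OF _ _ N A det])
    fix y
    have "(x * c - y * a) / m = c * x / m + - (y * a) / m" "(x * c2 - y * a2) / n = c2 * x / n + - (y * a2) / n" for x
      by (simp_all add: diff_divide_distrib mult.commute)
    then show "periodic N (\<lambda>x. f ((x * c - y * a) / m) * g ((x * c2 - y * a2) / n))"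
      using Lper_periodic[OF f m N A(3), of "- (y * a) / m"] Lper_periodic[OF g n N A2(2), of "- (y * a2) / n"]
      by (intro periodic_mult) simp_all
  next
    fix x
    have "(x * c - y * a) / m = (- a) * y / m + x * c / m" "(x * c2 - y * a2) / n = (- a2) * y / n + x * c2 / n" for y
      by (simp_all add: diff_divide_distrib mult.commute)
    then show "periodic N (\<lambda>y. f ((x * c - y * a) / m) * g ((x * c2 - y * a2) / n))"
      using Lper_periodic[OF f m N multipliers_uminus[OF A(1)], of "x * c / m"]
        Lper_periodic[OF g n N multipliers_uminus[OF A2(1)], of "x * c2 / n"]
      by (intro periodic_mult) simp_all
  qed
  also have "\<dots> = lmean N (\<lambda>s. lmean N (\<lambda>t. f (- (t / m)) * g ((s * c' - t * a') / n)))"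
  proof (intro lmean_cong)
    fix s t
    have "(s * a + t * b) * c - (s * c + t * d) * a = - t * (a * d - b * c)" by (simp add: algebra_simps)
    moreover have "(s * a + t * b) * c2 - (s * c + t * d) * a2 = (s * c' - t * a') * (a * d - b * c)"
      by (simp add: a2_def c2_def algebra_simps)
    ultimately show "f (((s * a + t * b) * c - (s * c + t * d) * a) / m) * g (((s * a + t * b) * c2 - (s * c + t * d) * a2) / n)
       = f (- (t / m)) * g ((s * c' - t * a') / n)" by (simp add: det)
  qed
  finally show ?thesis unfolding a2_def c2_def .
qed

text \<open>Capital C, C', C'' stand for the conjugates of c, c', c''. Treating them as independent
  variables makes the final step a rational identity.\<close>

lemma three_term_algebra:
  fixes c c' c'' C C' C'' K K' K'' e :: complex
  assumes "c \<noteq> 0" "c' \<noteq> 0" "c'' \<noteq> 0" "C \<noteq> 0" "C' \<noteq> 0" "C'' \<noteq> 0"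
    and eq: "2 * (1/C' * (1/C'') * (- K) - 1/C'' * (1/C) * K' - 1/C' * (1/C) * (- K'')) =
      2 / (c * c'' * (C * C'')) * (c * c'' / (C * C'') - 1) * e
      + 2 / (c * c' * (C * C')) * (c * c' / (C * C') - 1) * e
      + 2 / (c' * c'' * (C' * C'')) * (c' * c'' / (C' * C'') - 1) * e
      - 2 * ((c' / C' * (1 / (c'' * C'')) * (e / (c * C)) - e * (1 / (c * c'' * (C * C''))))
           + (c'' / C'' * (1 / (c * C)) * (e / (c' * C')) - e * (1 / (c * c' * (C * C'))))
           + (1 / (c' * C') * (c / C) * (e / (c'' * C'')) - e * (1 / (c' * c'' * (C' * C'')))))"
  shows "C'' * K'' = C * K + C' * K' + e * ((C' / (C * C'') - c' / (c * c'')) + (C / (C' * C'') - c / (c' * c''))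
      + (C'' / (C * C') - c'' / (c * c')))"
proof -
  have "C'' * K'' - C * K - C' * K' = C * C' * C'' / 2 *
     (2 * (1/C' * (1/C'') * (- K) - 1/C'' * (1/C) * K' - 1/C' * (1/C) * (- K'')))"
    using assms(1-6) by (simp add: field_simps)
  also have "\<dots> = e * ((C' / (C * C'') - c' / (c * c'')) + (C / (C' * C'') - c / (c' * c''))
      + (C'' / (C * C') - c'' / (c * c')))"
    unfolding eq using assms(1-6) by (simp add: divide_simps) (simp add: algebra_simps)
  finally show ?thesis by (simp add: algebra_simps)
qed

text \<open>The linear forms y, x c - y a and x c'' - y a'' belong to infinity and to the images of
  infinity under the first matrix and the product. Their pairwise determinants are c, c', c'' up to
  sign. Each form is divided by its two determinants; the relation between three forms in two
  variables, which here is a c'' - a'' c = c', says that \<open>u\<close> + \<open>v\<close> -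
  \<open>w\<close> = 0.\<close>

lemma Dsum_mean_three_term:
  assumes N: "N > 0" and c: "mdvd (c * (c' * (c * a' + d * c'))) N"
    and A: "a \<in> multipliers L" "b \<in> multipliers L" "c \<in> multipliers L" "d \<in> multipliers L"
    and B: "a' \<in> multipliers L" "b' \<in> multipliers L" "c' \<in> multipliers L" "d' \<in> multipliers L"
    and detA: "a * d - b * c = 1" and detB: "a' * d' - b' * c' = 1"
    and c2: "c'' = c * a' + d * c'" and a2: "a'' = a * a' + b * c'"
  shows "Dsum_mean N a'' c'' = Dsum_mean N a c + Dsum_mean N a' c' + e2 * ((cnj (c' / (c * c'')) - c' / (c * c''))
      + (cnj (c / (c' * c'')) - c / (c' * c'')) + (cnj (c'' / (c * c')) - c'' / (c * c')))"
proof -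
  let ?M = "\<lambda>g. lmean N (\<lambda>x. lmean N (\<lambda>y. g x y))"
  define b'' where "b'' = a * b' + b * d'"
  define d'' where "d'' = c * b' + d * d'"
  have O: "a'' \<in> multipliers L" "b'' \<in> multipliers L" "c'' \<in> multipliers L" "d'' \<in> multipliers L"
    unfolding a2 c2 b''_def d''_def using A B by (auto intro!: multipliers_add multipliers_mult)
  have det2: "a'' * d'' - b'' * c'' = 1"
  proof -
    have "a'' * d'' - b'' * c'' = (a * d - b * c) * (a' * d' - b' * c')"
      by (simp add: a2 c2 b''_def d''_def algebra_simps)
    then show ?thesis by (simp add: detA detB)
  qed
  have mc: "mdvd (c * (c' * c'')) N" using c by (simp add: c2)
  have m1: "mdvd (c' * c'') N" using mdvd_mult_right[OF mc A(3) multipliers_mult[OF B(3) O(3)]] .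
  have m2: "mdvd (c * c'') N" using mdvd_mult_right[of c' "c * c''" N] mc A(3) O(3) B(3) by (simp add: mult_ac multipliers_mult)
  have m3: "mdvd (c * c') N" using mdvd_mult_left[of "c * c'" c'' N] mc A(3) O(3) B(3) by (simp add: mult_ac multipliers_mult)
  have m2': "mdvd (c'' * c) N" and m3': "mdvd (c' * c) N" and m1': "mdvd (c'' * c') N"
    using m1 m2 m3 by (simp_all add: mult.commute)
  have mm: "mdvd c N" "mdvd c' N" "mdvd c'' N"
    using mdvd_mult_left[OF m3 A(3) B(3)] mdvd_mult_right[OF m3 A(3) B(3)] mdvd_mult_right[OF m2 A(3) O(3)] by auto
  have nz: "c \<noteq> 0" "c' \<noteq> 0" "c'' \<noteq> 0" using mm mdvd_nonzero N by auto
  define K where "K a c = lmean N (\<lambda>x. E1 (x / c) * E1 (a * x / c))" for a c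
  define u where "u y = y / (c * c'')" for y
  define v where "v x y = (x * c - y * a) / (c * c')" for x y
  define w where "w x y = (x * c'' - y * a'') / (c' * c'')" for x y
  have sum0: "u y + v x y + - w x y = 0" for x y
  proof -
    have "u y + v x y + - w x y = y * (c' - a * c'' + a'' * c) / (c * (c' * c''))"
      using nz by (simp add: u_def v_def w_def divide_simps) (simp add: algebra_simps)
    also have "c' - a * c'' + a'' * c = c' * (1 - (a * d - b * c))" by (simp add: a2 c2 algebra_simps)
    finally show ?thesis by (simp add: detA)
  qed
  have E2m: "eisE L 2 (- z) = eisE L 2 z" for z using eisE_minus[of 2 z] by simp
  have eq: "2 * (E1 (u y) * E1 (v x y) - E1 (v x y) * E1 (w x y) - E1 (w x y) * E1 (u y)) =
     wp_defect (u y) + wp_defect (v x y) + wp_defect (w x y)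
     - 2 * ((chi (u y) * eisE L 2 (v x y) - e2 * chi (u y)) + (chi (v x y) * eisE L 2 (w x y) - e2 * chi (v x y))
          + (eisE L 2 (u y) * chi (w x y) - e2 * chi (w x y)))" for x y
    using three_term'[OF sum0, of y x] unfolding E1_minus wp_defect_minus chi_minus wp_eq E2m
    by (simp add: algebra_simps)
  note dE = E1_distr_rel[OF N] and d2 = E2_distr_rel[OF N] and dc = chi_distr_rel[OF N]
  have n2: "of_real (norm z)^2 = z * cnj z" for z :: complex
    by (simp only: complex_norm_square[symmetric] of_real_power)
  have A1: "?M (\<lambda>x y. E1 (u y) * E1 (v x y)) = 1 / cnj c' * (1 / cnj c'') * (- K a c)"
    unfolding u_def v_def lmean2_pair[OF N m2 A(3) O(3) mm(2) A(1) dE dE] E1_minus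
    by (simp add: K_def lmean_uminus)
  have A3: "?M (\<lambda>x y. E1 (w x y) * E1 (u y)) = 1 / cnj c' * (1 / cnj c) * (- K a'' c'')"
    using lmean2_pair[OF N m2' O(3) A(3) mm(2) O(1) dE dE] unfolding E1_minus
    by (simp add: K_def lmean_uminus u_def w_def mult.commute)
  have A2: "?M (\<lambda>x y. E1 (v x y) * E1 (w x y)) = 1 / cnj c'' * (1 / cnj c) * K a' c'"
  proof -
    have "?M (\<lambda>x y. E1 (v x y) * E1 (w x y)) =
       ?M (\<lambda>s t. E1 (- (t / (c * c'))) * E1 ((s * c' - t * a') / (c' * c'')))"
      unfolding v_def w_def a2 c2 
      by (rule lmean2_pair_transformed[OF N m3 _ Lper_E1 Lper_E1 A detA B(1,3)]) (use m1 in \<open>simp add: c2\<close>)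
    also have "\<dots> = - ?M (\<lambda>s t. E1 (t / (c' * c)) * E1 ((s * c' - t * a') / (c' * c'')))"
      unfolding E1_minus by (simp add: lmean_uminus mult.commute)
    also have "\<dots> = 1 / cnj c'' * (1 / cnj c) * K a' c'"
      unfolding lmean2_pair[OF N m3' B(3) A(3) mm(3) B(1) dE dE] E1_minus
      by (simp add: K_def lmean_uminus)
    finally show ?thesis .
  qed
  have R1: "?M (\<lambda>x y. wp_defect (u y)) = 2 / (c * c'' * (cnj c * cnj c'')) * (c * c'' / (cnj c * cnj c'') - 1) * e2"
    using lmean_wp_defect[OF N m2] N unfolding n2 by (simp add: u_def lmean_const)
  have even_mean: "lmean N (\<lambda>t. f (- t / n)) = lmean N (\<lambda>t. f (t / n))" if "\<And>z. f (- z) = f z" for f n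
    using that by (simp flip: minus_divide_left)
  have R2: "?M (\<lambda>x y. wp_defect (v x y)) = 2 / (c * c' * (cnj c * cnj c')) * (c * c' / (cnj c * cnj c') - 1) * e2"
    unfolding v_def lmean2_linear_form[OF N m3 Lper_wp_defect A detA] even_mean[of wp_defect, OF wp_defect_minus]
    using lmean_wp_defect[OF N m3] unfolding n2 by simp
  have R3: "?M (\<lambda>x y. wp_defect (w x y)) = 2 / (c' * c'' * (cnj c' * cnj c'')) * (c' * c'' / (cnj c' * cnj c'') - 1) * e2"
    unfolding w_def lmean2_linear_form[OF N m1 Lper_wp_defect O det2] even_mean[of wp_defect, OF wp_defect_minus]
    using lmean_wp_defect[OF N m1] unfolding n2 by simp
  have chi1: "lmean N (\<lambda>t. chi (t / n)) = 1 / (n * cnj n)" if "mdvd n N" for n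
    using distrD[OF dc that, of 0] unfolding n2 by (simp add: chi_0)
  have X1: "?M (\<lambda>x y. chi (u y)) = 1 / (c * c'' * (cnj c * cnj c''))"
    using chi1[OF m2] N by (simp add: u_def lmean_const)
  have X2: "?M (\<lambda>x y. chi (v x y)) = 1 / (c * c' * (cnj c * cnj c'))"
    unfolding v_def lmean2_linear_form[OF N m3 Lper_chi A detA] even_mean[of chi, OF chi_minus]
    using chi1[OF m3] by simp
  have X3: "?M (\<lambda>x y. chi (w x y)) = 1 / (c' * c'' * (cnj c' * cnj c''))"
    unfolding w_def lmean2_linear_form[OF N m1 Lper_chi O det2] even_mean[of chi, OF chi_minus]
    using chi1[OF m1] by simp
  have Y1: "?M (\<lambda>x y. chi (u y) * eisE L 2 (v x y)) = c' / cnj c' * (1 / (c'' * cnj c'')) * (e2 / (c * cnj c))"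
    unfolding u_def v_def lmean2_pair[OF N m2 A(3) O(3) mm(2) A(1) dc d2] E2m chi_pair(1)[OF N mm(1) A(1,2,4) detA] n2 ..
  have Y3: "?M (\<lambda>x y. eisE L 2 (u y) * chi (w x y)) = 1 / (c' * cnj c') * (c / cnj c) * (e2 / (c'' * cnj c''))"
    using lmean2_pair[OF N m2' O(3) A(3) mm(2) O(1) d2 dc]
    unfolding chi_minus chi_pair(2)[OF N mm(3) O(1,2,4) det2] n2 by (simp add: u_def w_def mult.commute)
  have Y2: "?M (\<lambda>x y. chi (v x y) * eisE L 2 (w x y)) = c'' / cnj c'' * (1 / (c * cnj c)) * (e2 / (c' * cnj c'))"
  proof -
    have "?M (\<lambda>x y. chi (v x y) * eisE L 2 (w x y)) =
       ?M (\<lambda>s t. chi (- (t / (c * c'))) * eisE L 2 ((s * c' - t * a') / (c' * c'')))"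
      unfolding v_def w_def a2 c2 
      by (rule lmean2_pair_transformed[OF N m3 _ Lper_chi distr_rel_Lper[OF d2] A detA B(1,3)]) (use m1 in \<open>simp add: c2\<close>)
    also have "\<dots> = ?M (\<lambda>s t. chi (t / (c' * c)) * eisE L 2 ((s * c' - t * a') / (c' * c'')))"
      unfolding chi_minus by (simp add: mult.commute)
    also have "\<dots> = c'' / cnj c'' * (1 / (c * cnj c)) * (e2 / (c' * cnj c'))"
      unfolding lmean2_pair[OF N m3' B(3) A(3) mm(3) B(1) dc d2] E2m chi_pair(1)[OF N mm(2) B(1,2,4) detB] n2 ..
    finally show ?thesis .
  qed
  have "?M (\<lambda>x y. 2 * (E1 (u y) * E1 (v x y) - E1 (v x y) * E1 (w x y) - E1 (w x y) * E1 (u y))) =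
    ?M (\<lambda>x y. wp_defect (u y) + wp_defect (v x y) + wp_defect (w x y)
     - 2 * ((chi (u y) * eisE L 2 (v x y) - e2 * chi (u y)) + (chi (v x y) * eisE L 2 (w x y) - e2 * chi (v x y))
          + (eisE L 2 (u y) * chi (w x y) - e2 * chi (w x y))))"
    unfolding eq ..
  then have "cnj c'' * K a'' c'' = cnj c * K a c + cnj c' * K a' c' + e2 * ((cnj c' / (cnj c * cnj c'') - c' / (c * c''))
      + (cnj c / (cnj c' * cnj c'') - c / (c' * c'')) + (cnj c'' / (cnj c * cnj c') - c'' / (c * c')))"
    unfolding lmean_diff lmean_add lmean_cmult[of N 2] lmean_cmult[of N e2] A1 A2 A3 R1 R2 R3 X1 X2 X3 Y1 Y2 Y3
    by (intro three_term_algebra) (use nz in auto)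
  then show ?thesis by (simp add: Dsum_mean_def K_def)
qed

text \<open>Reduction from L/NL to L/cL has fibres of equal size N^2 / |c|^2, and the summand
  depends only on the class, so the representative picked by \<open>SOME\<close> is
  immaterial.\<close>

lemma ellDsum_Dsum_mean:
  assumes N: "N > 0" and c: "mdvd c N" and a: "a \<in> multipliers L"
  shows "ellDsum L a c = Dsum_mean N a c"
proof -
  have cO: "c \<in> multipliers L" using mdvdD[OF c] .
  obtain n where n: "n \<in> multipliers L" "of_nat N = c * n" using c by (auto simp: mdvd_def)
  have c0: "c \<noteq> 0" using mdvd_nonzero[OF c N] .
  define g where "g \<mu> = E1 (a * \<mu> / c) * E1 (\<mu> / c)" for \<mu>
  define cl where "cl x = {y \<in> L. x - y \<in> (\<lambda>w. c * w) ` L}" for x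
  have mem: "z \<in> (\<lambda>w. c * w) ` L \<longleftrightarrow> z / c \<in> L" for z
    using msub_iff[OF c0, of z] by (simp add: msub_def)
  have clL: "y \<in> cl x \<longleftrightarrow> y \<in> L \<and> (y - x) / c \<in> L" for x y
  proof -
    have "(x - y) / c = - ((y - x) / c)" by (simp add: diff_divide_distrib)
    then show ?thesis unfolding cl_def mem by (simp only: mem_Collect_eq L_uminus_iff)
  qed
  have cl_self: "x \<in> L \<Longrightarrow> x \<in> cl x" for x by (simp add: clL)
  have cl_eq: "cl x = cl y" if "y \<in> cl x" for x y
  proof -
    have "(z - x) / c \<in> L \<longleftrightarrow> (z - y) / c \<in> L" for z
    proof -
      have "(z - x) / c = (z - y) / c + (y - x) / c" by (simp add: diff_divide_distrib)
      then show ?thesis using that L_add_iff by (simp add: clL)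
    qed
    then show ?thesis by (auto simp: clL)
  qed
  have g_cl: "g y = g x" if "y \<in> cl x" for x y
  proof -
    define l where "l = (y - x) / c"
    have l: "l \<in> L" using that by (simp add: clL l_def)
    have "y = x + c * l" using c0 by (simp add: l_def)
    then have "y / c = x / c + l" "a * y / c = a * x / c + a * l" using c0 by (simp_all add: field_simps)
    then show ?thesis using LperD[OF Lper_E1 l] LperD[OF Lper_E1 multipliersD[OF a l]] by (simp add: g_def)
  qed
  define S where "S = {0..<int N} \<times> {0..<int N}"
  define P where "P p = lp (fst p) (snd p)" for p
  have PL: "P p \<in> L" for p by (simp add: P_def)
  have cnt: "of_nat (card {p \<in> S. cl (P p) = C}) = (of_nat N^2 / of_real (norm c)^2 :: complex)" if C: "C \<in> lattice_classes L c" for C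
  proof -
    obtain x where x: "x \<in> L" "C = cl x" using C by (auto simp: lattice_classes_def cl_def)
    have iff: "cl (P p) = C \<longleftrightarrow> (P p + - x) / c \<in> L" for p
      using cl_eq[of "P p" x] cl_self[OF PL, of p] x by (auto simp: clL)
    have fS: "finite S" by (simp add: S_def)
    have "(of_nat (card {p \<in> S. cl (P p) = C}) :: complex) = (\<Sum>p\<in>{p \<in> S. cl (P p) = C}. 1)" by simp
    also have "\<dots> = (\<Sum>p\<in>S. if cl (P p) = C then 1 else 0)"
      using fS by (subst sum.inter_filter[symmetric]) auto
    also have "\<dots> = bsum N (\<lambda>y. if (y + - x) / c \<in> L then 1 else 0)"
      unfolding bsum_prod S_def[symmetric] P_def[symmetric] iff ..
    also have "\<dots> = bsum N (\<lambda>y. if y / c \<in> L then 1 else 0)"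
      using bsum_shift[OF periodic_indicator[OF cO c0 n, of "\<lambda>x. x" 0 1 0] N, of "- x"] x by simp
    also have "\<dots> = of_real (bsum N (\<lambda>x. if x / c \<in> L then 1 else 0))"
      unfolding bsum_def of_real_sum by (intro sum.cong refl) auto
    also have "\<dots> = of_nat N^2 / of_real (norm c)^2" by (subst bsum_msub[OF cO c0 n N]) simp
    finally show ?thesis .
  qed
  have img: "(\<lambda>p. cl (P p)) ` S = lattice_classes L c"
  proof
    show "(\<lambda>p. cl (P p)) ` S \<subseteq> lattice_classes L c" using PL by (auto simp: lattice_classes_def cl_def)
    show "lattice_classes L c \<subseteq> (\<lambda>p. cl (P p)) ` S"
    proof
      fix C assume C: "C \<in> lattice_classes L c"
      \<comment> \<open>Every class is hit because the count of its preimages is not 0.\<close>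
      have "(of_nat N^2 / of_real (norm c)^2 :: complex) \<noteq> 0" using N c0 by simp
      then have "card {p \<in> S. cl (P p) = C} \<noteq> 0" using cnt[OF C] by (metis of_nat_0)
      then obtain p where "p \<in> S" "cl (P p) = C" by (metis (mono_tags, lifting) card.empty Collect_empty_eq)
      then show "C \<in> (\<lambda>p. cl (P p)) ` S" by blast
    qed
  qed
  define rep where "rep C = (SOME \<mu>. \<mu> \<in> C)" for C :: "complex set"
  have "bsum N g = (\<Sum>p\<in>S. g (P p))" by (simp add: bsum_prod S_def P_def)
  also have "\<dots> = (\<Sum>C\<in>lattice_classes L c. \<Sum>p\<in>{p \<in> S. cl (P p) = C}. g (P p))"
  proof (rule sum.group[symmetric])
    show "finite (lattice_classes L c)" unfolding img[symmetric] by (simp add: S_def)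
  qed (use img in \<open>auto simp: S_def\<close>)
  also have "\<dots> = (\<Sum>C\<in>lattice_classes L c. \<Sum>p\<in>{p \<in> S. cl (P p) = C}. g (rep C))"
  proof (intro sum.cong refl)
    fix C p assume p: "p \<in> {p \<in> S. cl (P p) = C}"
    then have "P p \<in> C" using cl_self[OF PL] by blast
    then have "rep C \<in> C" unfolding rep_def by (rule someI)
    then show "g (P p) = g (rep C)" using g_cl p by force
  qed
  also have "\<dots> = (\<Sum>C\<in>lattice_classes L c. of_nat N^2 / of_real (norm c)^2 * g (rep C))"
    using cnt by (intro sum.cong refl) simp
  also have "\<dots> = of_nat N^2 / of_real (norm c)^2 * (\<Sum>C\<in>lattice_classes L c. g (rep C))"
    by (simp add: sum_distrib_left)
  also have "(\<Sum>C\<in>lattice_classes L c. g (rep C)) = c * ellDsum L a c"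
    using c0 by (simp add: ellDsum_def Let_def g_def rep_def)
  finally have "bsum N g = of_nat N^2 / of_real (norm c)^2 * (c * ellDsum L a c)" .
  then have "lmean N g = c / of_real (norm c)^2 * ellDsum L a c" using N by (simp add: lmean_def)
  moreover have "c / of_real (norm c)^2 = 1 / cnj c"
    using c0 complex_norm_square[of c] by (simp add: field_simps)
  ultimately have "ellDsum L a c = cnj c * lmean N g" using c0 by simp
  also have "lmean N g = lmean N (\<lambda>x. E1 (x / c) * E1 (a * x / c))" by (simp add: g_def[abs_def] mult.commute)
  finally show ?thesis by (simp add: Dsum_mean_def)
qed

end

section \<open>The cotangent series and the value of \<open>E\<^sub>2(0)\<close>\<close>

text \<open>This is pi cot (pi x), written in terms of exp (2 pi i x).\<close>

definition cotpi :: "complex \<Rightarrow> complex" where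
  "cotpi x = - \<i> * pi * (1 + exp (2 * pi * \<i> * x)) / (1 - exp (2 * pi * \<i> * x))"

lemma cotpi_regular_part:
  "\<exists>h r. r > 0 \<and> h holomorphic_on ball 0 r \<and> (\<forall>x\<in>ball 0 r - {0}. cotpi x = 1 / x + h x)"
proof -
  let ?e = "\<lambda>x::complex. exp (2 * pi * \<i> * x)"
  define E where "E x = (if x = 0 then deriv ?e 0 else (?e x - ?e 0) / (x - 0))" for x
  have E: "E holomorphic_on UNIV" unfolding E_def
    by (rule pole_lemma_open) (auto intro!: holomorphic_intros)
  have "(?e has_field_derivative (2 * pi * \<i>)) (at 0)" by (auto intro!: derivative_eq_intros)
  then have E0: "E 0 = 2 * pi * \<i>" by (simp add: E_def DERIV_imp_deriv)
  define n where "n x = \<i> * pi * (1 + ?e x) - E x" for x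
  have n: "n holomorphic_on UNIV" unfolding n_def by (intro holomorphic_intros E)
  have n0: "n 0 = 0" by (simp add: n_def E0)
  define n1 where "n1 x = (if x = 0 then deriv n 0 else (n x - n 0) / (x - 0))" for x
  have n1: "n1 holomorphic_on UNIV" unfolding n1_def by (rule pole_lemma_open[OF n]) auto
  have "isCont E 0" using holomorphic_on_imp_continuous_on[OF E] by (simp add: continuous_on_eq_continuous_at)
  moreover have "E 0 \<noteq> 0" by (simp add: E0)
  ultimately obtain r where r: "r > 0" "\<And>x. dist 0 x < r \<Longrightarrow> E x \<noteq> 0"
    using continuous_at_avoid[of 0 E 0] by blast
  have "(\<lambda>x. n1 x / E x) holomorphic_on ball 0 r"
    using r by (intro holomorphic_on_divide holomorphic_on_subset[OF n1] holomorphic_on_subset[OF E]) auto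
  moreover have "cotpi x = 1 / x + n1 x / E x" if "x \<in> ball 0 r - {0}" for x
  proof -
    have x: "x \<noteq> 0" "E x \<noteq> 0" using that r by auto
    have e: "?e x = 1 + x * E x" using x by (simp add: E_def)
    have "n1 x = (\<i> * pi * (1 + ?e x) - E x) / x" using x by (simp add: n1_def n0) (simp add: n_def)
    moreover have "cotpi x = - \<i> * pi * (1 + ?e x) / (- (x * E x))" unfolding cotpi_def using e by simp
    ultimately show ?thesis using x by (simp add: field_simps)
  qed
  ultimately show ?thesis using r(1) by blast
qed

text \<open>The linear Laurent coefficient of pi cot (pi x) at 0. It contributes the constant term
  of \<open>E2_basis\<close>.\<close>

definition cot_coeff :: complex where
  "cot_coeff = (SOME b. \<exists>h r. r > 0 \<and> h holomorphic_on ball 0 r \<and> (\<forall>x\<in>ball 0 r - {0}. cotpi x = 1 / x + h x) \<and> deriv h 0 = b)"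

lemma cot_coeff:
  obtains h r where "r > 0" "h holomorphic_on ball 0 r" "\<And>x. x \<in> ball 0 r - {0} \<Longrightarrow> cotpi x = 1 / x + h x" "deriv h 0 = cot_coeff"
proof -
  have "\<exists>h r. r > 0 \<and> h holomorphic_on ball 0 r \<and> (\<forall>x\<in>ball 0 r - {0}. cotpi x = 1 / x + h x) \<and> deriv h 0 = cot_coeff"
    unfolding cot_coeff_def by (rule someI_ex) (use cotpi_regular_part in blast)
  then show ?thesis using that by blast
qed

text \<open>For |q| < 1 this is the sum of sigma_1(n) q^n over n \<ge> 1.\<close>

definition lambert :: "complex \<Rightarrow> complex" where
  "lambert q = infsum (\<lambda>m. q^m / (1 - q^m)^2) {1::nat..}"

locale oriented_cm_lattice = cm_lattice +
  assumes pos: "Im (w2 / w1) > 0"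
begin

section \<open>Periodic exponentials and the cotangent expansion of zeta\<close>

definition eper :: "complex \<Rightarrow> complex" where "eper z = exp (2 * pi * \<i> * (z / w1))"

definition q :: complex where "q = eper w2"

lemma eper_add: "eper (z + w) = eper z * eper w" by (simp add: eper_def exp_add ring_distribs add_divide_distrib)
lemma eper_nz [simp]: "eper z \<noteq> 0" by (simp add: eper_def)
lemma eper_minus: "eper (- z) = 1 / eper z" by (simp add: eper_def exp_minus field_simps)
lemma eper_w1 [simp]: "eper w1 = 1" using w1 by (simp add: eper_def)
lemma eper_0 [simp]: "eper 0 = 1" by (simp add: eper_def)

lemma eper_mult_w2: "eper (of_nat m * w2) = q^m"
  by (induction m) (auto simp: ring_distribs eper_add q_def)

lemma eper_eq_1: "eper z = 1 \<Longrightarrow> z \<in> L"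
proof -
  assume "eper z = 1"
  then obtain n :: int where n: "Re (2 * pi * \<i> * (z / w1)) = 0" "Im (2 * pi * \<i> * (z / w1)) = of_int (2 * n) * pi"
    unfolding eper_def exp_eq_1 by blast
  have "2 * pi * \<i> * (z / w1) = 2 * pi * \<i> * of_int n" using n by (simp add: complex_eq_iff)
  moreover have "2 * pi * \<i> \<noteq> 0" by simp
  ultimately have "z / w1 = of_int n" using mult_left_cancel by blast
  then have "z = lp n 0" using w1 by (simp add: lp_def field_simps)
  then show ?thesis by simp
qed

lemma norm_ex: "norm (eper z) = exp (- 2 * pi * Im (z / w1))"
proof -
  have "Re (2 * pi * \<i> * u) = - 2 * pi * Im u" for u by simp
  then show ?thesis by (simp only: eper_def norm_exp_eq_Re)
qed

lemma norm_q: "norm q = exp (- 2 * pi * Im (w2 / w1))" by (simp add: q_def norm_ex)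

lemma norm_q_less: "norm q < 1" using pos by (simp add: norm_q)

lemma q_nz [simp]: "q \<noteq> 0" by (simp add: q_def)

definition half_term :: "nat \<Rightarrow> complex \<Rightarrow> complex" where
  "half_term m z = eper (z + of_nat m * w2) / (1 - eper (z + of_nat m * w2))"

definition half_sum :: "complex \<Rightarrow> complex" where "half_sum z = infsum (\<lambda>m. half_term m z) {1..}"

lemma half_term_nz:
  assumes "m \<ge> 1" "z \<in> - (L - {0})"
  shows "eper (z + of_nat m * w2) \<noteq> 1"
proof
  assume e: "eper (z + of_nat m * w2) = 1"
  have mw: "of_nat m * w2 \<in> L" using L_of_int[OF L_w2, of "int m"] by simp
  have "z + of_nat m * w2 \<in> L" using e by (rule eper_eq_1)
  then have "z = 0" using L_add_iff[OF mw] assms(2) by auto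
  then have "q^m = 1" using e eper_mult_w2 by simp
  then have "norm q ^ m = 1" by (metis norm_one norm_power)
  then show False using norm_q_less assms(1)
    by (metis less_irrefl norm_ge_zero not_one_le_zero power_less_one_iff zero_less_iff_neq_zero)
qed

lemma
  shows half_sum_holo: "half_sum holomorphic_on - (L - {0})"
    and half_sum_summable: "z \<in> - (L - {0}) \<Longrightarrow> (\<lambda>m. half_term m z) summable_on {1..}"
    and half_sum_deriv: "z \<in> - (L - {0}) \<Longrightarrow> ((\<lambda>m. deriv (half_term m) z) has_sum deriv half_sum z) {1..}"
proof -
  let ?S = "- (L - {0})"
  have S: "open ?S" using closed_L0 by (rule open_Compl)
  have hol: "half_term m holomorphic_on ?S" if "m \<in> {1..}" for m
    unfolding half_term_def[abs_def] using half_term_nz[of m] that unfolding eper_def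
    by (intro holomorphic_intros w1) auto
  have bd: "\<exists>r>0. \<exists>B M. finite B \<and> M summable_on ({1..} - B) \<and>
               (\<forall>m\<in>{1..} - B. \<forall>w\<in>ball s r \<inter> ?S. norm (half_term m w) \<le> M m)" for s
  proof -
    \<comment> \<open>A bound for |\<open>eper\<close> w| on the unit ball about s, since
      |\<open>eper\<close> w| = exp (- 2 pi Im (w / w1)).\<close>
    define K where "K = exp (2 * pi * ((norm s + 1) / norm w1))"
    have K: "K > 0" by (simp add: K_def)
    have le: "norm (eper (w + of_nat m * w2)) \<le> K * norm q ^ m" if "w \<in> ball s 1" for w m
    proof -
      have "norm w \<le> norm s + 1" using that norm_triangle_ineq2[of w s] by (auto simp: dist_norm norm_minus_commute)
      then have "norm (w / w1) \<le> (norm s + 1) / norm w1" by (simp add: norm_divide divide_right_mono)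
      moreover have "- Im (w / w1) \<le> norm (w / w1)" using abs_Im_le_cmod[of "w / w1"] by linarith
      ultimately have "- Im (w / w1) \<le> (norm s + 1) / norm w1" by linarith
      then have "2 * pi * (- Im (w / w1)) \<le> 2 * pi * ((norm s + 1) / norm w1)" by (intro mult_left_mono) auto
      then have "norm (eper w) \<le> K" by (simp add: norm_ex K_def)
      then show ?thesis unfolding eper_add eper_mult_w2 norm_mult norm_power by (intro mult_right_mono) auto
    qed
    have "(\<lambda>m. K * norm q ^ m) \<longlonglongrightarrow> K * 0"
      using norm_q_less by (intro tendsto_mult_left LIMSEQ_power_zero) auto
    then have "eventually (\<lambda>m. K * norm q ^ m < 1/2) sequentially"
      by (intro order_tendstoD(2)[of _ "K * 0"]) auto
    then obtain n0 where n0: "\<And>m. m \<ge> n0 \<Longrightarrow> K * norm q ^ m < 1/2" by (auto simp: eventually_sequentially)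
    have "summable (\<lambda>m. 2 * (K * norm q ^ m))"
      using norm_q_less by (intro summable_mult summable_geometric) auto
    then have "(\<lambda>m. 2 * (K * norm q ^ m)) summable_on UNIV"
      using K by (subst summable_on_UNIV_nonneg_real_iff) auto
    then have "(\<lambda>m. 2 * (K * norm q ^ m)) summable_on ({1..} - {..<n0})"
      by (rule summable_on_subset_banach) auto
    moreover have "norm (half_term m w) \<le> 2 * (K * norm q ^ m)" if "m \<in> {1..} - {..<n0}" "w \<in> ball s 1" for m w
    proof -
      let ?X = "eper (w + of_nat m * w2)"
      have X: "norm ?X \<le> K * norm q ^ m" "norm ?X \<le> 1/2" using le[OF that(2), of m] n0[of m] that by auto
      have "norm (1 - ?X) \<ge> 1/2" using norm_triangle_ineq2[of 1 ?X] X by simp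
      then have "norm (half_term m w) \<le> norm ?X / (1/2)"
        unfolding half_term_def norm_divide by (intro divide_left_mono) (auto intro!: mult_pos_pos)
      then show ?thesis using X by simp
    qed
    ultimately show ?thesis
      by (intro exI[of _ 1] conjI exI[of _ "{..<n0}"] exI[of _ "\<lambda>m. 2 * (K * norm q ^ m)"]) auto
  qed
  show "half_sum holomorphic_on ?S"
    unfolding half_sum_def[abs_def] by (rule infsum_holomorphic_deriv(1)[OF S hol bd])
  show "z \<in> - (L - {0}) \<Longrightarrow> (\<lambda>m. half_term m z) summable_on {1..}"
    by (rule infsum_holomorphic_deriv(2)[OF S hol bd])
  show "z \<in> - (L - {0}) \<Longrightarrow> ((\<lambda>m. deriv (half_term m) z) has_sum deriv half_sum z) {1..}"
    unfolding half_sum_def[abs_def] by (rule infsum_holomorphic_deriv(3)[OF S hol bd])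
qed

lemma eper_has_deriv: "(eper has_field_derivative (2 * pi * \<i> / w1) * eper z) (at z)"
  unfolding eper_def[abs_def] using w1 by (auto intro!: derivative_eq_intros)

lemma half_sum_deriv_0: "deriv half_sum 0 = (2 * pi * \<i> / w1) * lambert q"
proof -
  have "deriv (half_term m) 0 = (2 * pi * \<i> / w1) * (q^m / (1 - q^m)^2)" if "m \<in> {1..}" for m
  proof -
    have n: "eper (0 + of_nat m * w2) \<noteq> 1" by (rule half_term_nz) (use that in auto)
    have e: "((\<lambda>z. eper (z + of_nat m * w2)) has_field_derivative (2 * pi * \<i> / w1) * eper (0 + of_nat m * w2)) (at 0)"
      using eper_has_deriv[of "0 + of_nat m * w2"] DERIV_shift by blast
    have "(half_term m has_field_derivative
      ((2 * pi * \<i> / w1) * eper (0 + of_nat m * w2) * (1 - eper (0 + of_nat m * w2)) -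
        eper (0 + of_nat m * w2) * (0 - (2 * pi * \<i> / w1) * eper (0 + of_nat m * w2)))
      / ((1 - eper (0 + of_nat m * w2)) * (1 - eper (0 + of_nat m * w2)))) (at 0)"
      unfolding half_term_def[abs_def] by (intro DERIV_divide e DERIV_diff DERIV_const) (use n in simp)
    then have "deriv (half_term m) 0 = ((2 * pi * \<i> / w1) * q^m * (1 - q^m) - q^m * (0 - (2 * pi * \<i> / w1) * q^m))
      / ((1 - q^m) * (1 - q^m))"
      by (simp add: DERIV_imp_deriv eper_mult_w2)
    also have "\<dots> = (2 * pi * \<i> / w1) * (q^m / (1 - q^m)^2)"
    proof -
      have "(k * x * (1 - x) - x * (0 - k * x)) / ((1 - x) * (1 - x)) = k * (x / (1 - x)^2)" for k x :: complex
        by (simp add: power2_eq_square algebra_simps)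
      then show ?thesis .
    qed
    finally show ?thesis .
  qed
  moreover have "((\<lambda>m. deriv (half_term m) 0) has_sum deriv half_sum 0) {1..}" by (rule half_sum_deriv) auto
  ultimately have "((\<lambda>m. (2 * pi * \<i> / w1) * (q^m / (1 - q^m)^2)) has_sum deriv half_sum 0) {1..}"
    by (subst (asm) has_sum_cong) auto
  then have "infsum (\<lambda>m. (2 * pi * \<i> / w1) * (q^m / (1 - q^m)^2)) {1..} = deriv half_sum 0" by (rule infsumI)
  then show ?thesis unfolding lambert_def infsum_cmult_right' by (rule sym)
qed

lemma half_sum_w1: "half_sum (z + w1) = half_sum z"
proof -
  have "half_term m (z + w1) = half_term m z" for m
    using eper_add[of "z + of_nat m * w2" w1] by (simp add: half_term_def add_ac)
  then show ?thesis by (simp add: half_sum_def)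
qed

lemma half_sum_w2:
  assumes "z \<notin> L"
  shows "half_sum (z + w2) = half_sum z - eper (z + w2) / (1 - eper (z + w2))"
proof -
  have "half_sum (z + w2) = infsum (\<lambda>m. half_term (Suc m) z) {1..}"
    unfolding half_sum_def by (rule infsum_cong) (simp add: half_term_def ring_distribs add_ac)
  also have "\<dots> = infsum (\<lambda>m. half_term m z) (Suc ` {1..})"
    by (subst infsum_reindex) (auto simp: o_def)
  finally have 1: "half_sum (z + w2) = infsum (\<lambda>m. half_term m z) (Suc ` {1..})" .
  have e: "{1::nat..} = insert 1 (Suc ` {1..})"
  proof -
    have "m \<in> Suc ` {1..}" if "m \<ge> 2" for m using that by (intro image_eqI[of _ _ "m - 1"]) auto
    then have "m \<in> insert 1 (Suc ` {1..})" if "m \<ge> 1" for m using that by (cases "m = 1") auto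
    then show ?thesis by auto
  qed
  have "half_sum z = infsum (\<lambda>m. half_term m z) (insert 1 (Suc ` {1..}))" unfolding half_sum_def using e by simp
  also have "\<dots> = half_term 1 z + half_sum (z + w2)" unfolding 1
    by (subst infsum_insert) (auto intro!: summable_on_subset_banach[OF half_sum_summable] simp: assms)
  finally show ?thesis by (simp add: half_term_def)
qed

text \<open>The sum over all integers m of (pi / w1) cot (pi (z + m w2) / w1), that is, of 1/(z + x)
  summed first along multiples of w1. The cotangents tend to - pi i and pi i at the two ends; in
  pairs m, - m these limits cancel, and \<open>half_sum\<close> keeps the rest.\<close>

definition cot_series :: "complex \<Rightarrow> complex" where
  "cot_series z = (1 / w1) * (cotpi (z / w1) - 2 * pi * \<i> * (half_sum z - half_sum (- z)))"

lemma cotpi_ex: "cotpi (z / w1) = - \<i> * pi * (1 + eper z) / (1 - eper z)"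
  by (simp add: cotpi_def eper_def)

lemma cot_series_w1: "cot_series (z + w1) = cot_series z"
proof -
  have "half_sum (- z) = half_sum (- (z + w1))" using half_sum_w1[of "- (z + w1)"] by simp
  then show ?thesis by (simp add: cot_series_def cotpi_ex eper_add half_sum_w1)
qed

text \<open>The shift moves one summand across the middle, so the limits - pi i and pi i no longer
  balance and - 2 pi i / w1 is left.\<close>

lemma cot_series_w2:
  assumes z: "z \<notin> L"
  shows "cot_series (z + w2) = cot_series z - 2 * pi * \<i> / w1"
proof -
  have zw: "- (z + w2) \<notin> L" using z L_add_iff[OF L_w2] L_uminus_iff by blast
  have x1: "eper z \<noteq> 1" "eper (z + w2) \<noteq> 1" using eper_eq_1 z L_add_iff[OF L_w2] by blast+
  have "half_sum (- (z + w2) + w2) = half_sum (- (z + w2)) - eper (- (z + w2) + w2) / (1 - eper (- (z + w2) + w2))"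
    by (rule half_sum_w2[OF zw])
  then have a1: "half_sum (- (z + w2)) = half_sum (- z) + (1 / eper z) / (1 - 1 / eper z)"
    by (simp add: eper_minus)
  define X where "X = eper z"
  define Y where "Y = eper (z + w2)"
  have XY: "X \<noteq> 1" "Y \<noteq> 1" "X \<noteq> 0" using x1 by (simp_all add: X_def Y_def)
  have "cotpi ((z + w2) / w1) - 2 * pi * \<i> * (half_sum (z + w2) - half_sum (- (z + w2))) =
    - \<i> * pi * (1 + Y) / (1 - Y) - 2 * pi * \<i> * (half_sum z - Y / (1 - Y) - (half_sum (- z) + (1 / X) / (1 - 1 / X)))"
    unfolding a1 half_sum_w2[OF z] cotpi_ex X_def Y_def ..
  also have "\<dots> = - \<i> * pi * (1 + X) / (1 - X) - 2 * pi * \<i> * (half_sum z - half_sum (- z)) - 2 * pi * \<i>"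
  proof -
    define x where "x = 1 / (X - 1)"
    define y where "y = Y / (1 - Y)"
    have Yy: "(1 + Y) / (1 - Y) = 1 + 2 * y" and Xx: "(1 + X) / (1 - X) = - 1 - 2 * x"
      and x1: "(1 / X) / (1 - 1 / X) = x" using XY by (auto simp: x_def y_def divide_simps) (simp_all add: algebra_simps)
    show ?thesis unfolding times_divide_eq_right[symmetric] Yy Xx x1 y_def[symmetric]
      by (simp add: algebra_simps)
  qed
  finally show ?thesis unfolding cot_series_def cotpi_ex X_def[symmetric]
    by (simp add: cotpi_ex X_def[symmetric] Y_def[symmetric] right_diff_distrib)
qed

end

text \<open>pi^2 / 3 times the completed Eisenstein series E_2(t) - 3 / (pi Im t).\<close>

definition E2_basis :: "complex \<Rightarrow> complex" where
  "E2_basis t = - cot_coeff - 8 * pi^2 * lambert (exp (2 * pi * \<i> * t)) - pi / Im t"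

context oriented_cm_lattice
begin

text \<open>Both functions have the same poles and additive quasi-periods, so their difference turns
  out to be affine in z; its slope carries the q-expansion of \<open>e2\<close>.\<close>

definition zeta_defect :: "complex \<Rightarrow> complex" where "zeta_defect z = zeta z - cot_series z"

lemma open_minus_L: "open (- L)" using closed_L by (rule open_Compl)

lemma cotpi_ex_holo: "(\<lambda>z. cotpi (z / w1)) holomorphic_on - L"
proof -
  have "1 - eper z \<noteq> 0" if "z \<notin> L" for z using eper_eq_1[of z] that by auto
  then show ?thesis unfolding cotpi_ex using w1 unfolding eper_def by (intro holomorphic_intros) auto
qed

lemma half_sum_minus_holo: "(\<lambda>z. half_sum (- z)) holomorphic_on - (L - {0})"
proof -
  have 1: "uminus holomorphic_on - (L - {0})" using holomorphic_on_minus[OF holomorphic_on_ident] by simp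
  have 2: "uminus ` (- (L - {0})) \<subseteq> - (L - {0})" by auto
  show ?thesis using holomorphic_on_compose_gen[OF 1 half_sum_holo 2] by (simp add: o_def)
qed

lemma zeta_defect_holo: "zeta_defect holomorphic_on - L"
  unfolding zeta_defect_def cot_series_def
  by (intro holomorphic_intros zeta_holo cotpi_ex_holo holomorphic_on_subset[OF half_sum_holo] holomorphic_on_subset[OF half_sum_minus_holo]) auto

lemma zeta_defect_w1: "zeta_defect (z + w1) = zeta_defect z + (e2 * w1 + kap * cnj w1)"
  by (simp add: zeta_defect_def cot_series_w1 zeta_periodic)

lemma zeta_defect_w2: "z \<notin> L \<Longrightarrow> zeta_defect (z + w2) = zeta_defect z + (e2 * w2 + kap * cnj w2 + 2 * pi * \<i> / w1)"
  by (simp add: zeta_defect_def cot_series_w2 zeta_periodic)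

lemma deriv_zeta_defect_shift:
  assumes w: "w \<in> L" and c: "\<And>z. z \<notin> L \<Longrightarrow> zeta_defect (z + w) = zeta_defect z + c" and z: "z \<notin> L"
  shows "deriv zeta_defect (z + w) = deriv zeta_defect z"
proof -
  have zw: "z + w \<in> - L" using z L_add_iff[OF w] by simp
  have "(zeta_defect has_field_derivative deriv zeta_defect (z + w)) (at (z + w))"
    using holomorphic_derivI[OF zeta_defect_holo open_minus_L zw] .
  then have "((\<lambda>z. zeta_defect (z + w)) has_field_derivative deriv zeta_defect (z + w)) (at z)"
    using DERIV_shift by blast
  then have "((\<lambda>z. zeta_defect (z + w) - c) has_field_derivative deriv zeta_defect (z + w) - 0) (at z)"
    by (intro DERIV_diff DERIV_const)
  then have "(zeta_defect has_field_derivative deriv zeta_defect (z + w) - 0) (at z)"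
    by (rule has_field_derivative_transform_within_open[OF _ open_minus_L]) (use z c in auto)
  then show ?thesis by (simp add: DERIV_imp_deriv)
qed

lemma deriv_zeta_defect_periodic:
  assumes l: "l \<in> L" and z: "z \<notin> L"
  shows "deriv zeta_defect (z + l) = deriv zeta_defect z"
proof -
  obtain i j where ij: "l = lp i j" using l by (auto elim: L_cases)
  have s1: "deriv zeta_defect (z + w1) = deriv zeta_defect z" if "z \<notin> L" for z
    using deriv_zeta_defect_shift[OF L_w1 zeta_defect_w1 that] by simp
  have s2: "deriv zeta_defect (z + w2) = deriv zeta_defect z" if "z \<notin> L" for z
    using deriv_zeta_defect_shift[OF L_w2 zeta_defect_w2 that] by simp
  have zl: "z + lp i j \<notin> L" for i j using z L_add_iff[OF lp_in] by simp
  have 1: "deriv zeta_defect (z + lp (i + 1) j) = deriv zeta_defect (z + lp i j)" for i j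
  proof -
    have "z + lp (i + 1) j = z + lp i j + w1" by (simp add: lp_def algebra_simps)
    then show ?thesis using s1[OF zl] by (simp add: add.assoc[symmetric])
  qed
  have 2: "deriv zeta_defect (z + lp i (j + 1)) = deriv zeta_defect (z + lp i j)" for i j
  proof -
    have "z + lp i (j + 1) = z + lp i j + w2" by (simp add: lp_def algebra_simps)
    then show ?thesis using s2[OF zl] by (simp add: add.assoc[symmetric])
  qed
  have "deriv zeta_defect (z + lp i j) = deriv zeta_defect (z + lp 0 j)"
    using periodic_int_add[of "\<lambda>i. deriv zeta_defect (z + lp i j)" 1 0 i] 1 by simp
  also have "\<dots> = deriv zeta_defect (z + lp 0 0)"
    using periodic_int_add[of "\<lambda>j. deriv zeta_defect (z + lp 0 j)" 1 0 j] 2 by simp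
  finally show ?thesis by (simp add: ij lp_def)
qed

text \<open>At 0 the poles 1/z cancel. The derivative of \<open>zeta0\<close> there is 0, so what
  remains is the linear coefficient of the cotangent and twice the derivative of
  \<open>half_sum\<close>.\<close>

lemma deriv_zeta_defect_lim: "(deriv zeta_defect \<longlongrightarrow> (- cot_coeff - 8 * pi^2 * lambert q) / w1^2) (at 0)"
proof -
  obtain r h where h: "r > 0" "h holomorphic_on ball 0 r" "\<And>x. x \<in> ball 0 r - {0} \<Longrightarrow> cotpi x = 1 / x + h x" "deriv h 0 = cot_coeff"
    by (rule cot_coeff) blast
  obtain d where d: "d > 0" "ball 0 d \<inter> L \<subseteq> {0}" using locally_finite_closed(1)[OF finite_L_ball] by blast
  define e where "e = min d (r * norm w1)"
  have e: "e > 0" using d h(1) w1 by (simp add: e_def)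
  define g where "g z = zeta0 z - (1 / w1) * h (z / w1) + (2 * pi * \<i> / w1) * (half_sum z - half_sum (- z))" for z
  have sub: "ball 0 e \<subseteq> - (L - {0})" using d by (auto simp: e_def)
  have hw: "z / w1 \<in> ball 0 r" if "z \<in> ball 0 e" for z
    using that w1 by (auto simp: e_def norm_divide field_simps)
  have ekern: "(\<lambda>z. h (z / w1)) holomorphic_on ball 0 e"
  proof -
    have "(\<lambda>z. z / w1) holomorphic_on ball 0 e" using w1 by (intro holomorphic_intros) auto
    moreover have "(\<lambda>z. z / w1) ` ball 0 e \<subseteq> ball 0 r" using hw by auto
    ultimately show ?thesis using holomorphic_on_compose_gen[OF _ h(2)] by (auto simp: o_def)
  qed
  have gh: "g holomorphic_on ball 0 e" unfolding g_def
    by (intro holomorphic_intros ekern holomorphic_on_subset[OF zeta0_holo sub]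
      holomorphic_on_subset[OF half_sum_holo sub] holomorphic_on_subset[OF half_sum_minus_holo sub])
  have fg: "zeta_defect z = g z" if "z \<in> ball 0 e - {0}" for z
  proof -
    have z0: "z \<noteq> 0" "z / w1 \<noteq> 0" using that w1 by auto
    have "cotpi (z / w1) = 1 / (z / w1) + h (z / w1)" using h(3) hw that z0 by auto
    then have "(1 / w1) * cotpi (z / w1) = inverse z + (1 / w1) * h (z / w1)"
      using w1 z0 by (simp add: field_simps)
    moreover have "(1 / w1) * (x - y * a) = (1 / w1) * x - (y / w1) * a" for x y a by (simp add: right_diff_distrib)
    ultimately show ?thesis unfolding zeta_defect_def cot_series_def zeta_split g_def by simp
  qed
  have o: "open (ball 0 e - {0::complex})" by (intro open_Diff) auto
  have dfg: "deriv zeta_defect z = deriv g z" if "z \<in> ball 0 e - {0}" for z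
  proof (rule deriv_cong_ev[OF _ refl])
    show "eventually (\<lambda>z. zeta_defect z = g z) (nhds z)"
      using eventually_nhds_in_open[OF o that] by eventually_elim (use fg in auto)
  qed
  have "isCont (deriv g) 0"
    using holomorphic_on_imp_continuous_on[OF holomorphic_deriv[OF gh]] e by (simp add: continuous_on_eq_continuous_at)
  then have "(deriv g \<longlongrightarrow> deriv g 0) (at 0)" by (simp add: isCont_def)
  moreover have "eventually (\<lambda>z. deriv g z = deriv zeta_defect z) (at 0)"
    unfolding eventually_at using e dfg by (intro exI[of _ e]) auto
  ultimately have lim: "(deriv zeta_defect \<longlongrightarrow> deriv g 0) (at 0)" by (rule Lim_transform_eventually)
  have "(h has_field_derivative cot_coeff) (at (0 / w1))"
    using holomorphic_derivI[OF h(2), of 0] h(1,4) by simp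
  moreover have "((\<lambda>z. z / w1) has_field_derivative 1 / w1) (at 0)"
    using w1 by (auto intro!: derivative_eq_intros)
  ultimately have D1: "((\<lambda>z. h (z / w1)) has_field_derivative cot_coeff * (1 / w1)) (at 0)"
    by (rule DERIV_chain2[where f = h and g = "\<lambda>z. z / w1"])
  have z0: "0 \<in> - (L - {0})" by auto
  have D2: "(half_sum has_field_derivative deriv half_sum 0) (at 0)"
    by (rule holomorphic_derivI[OF half_sum_holo open_Compl[OF closed_L0] z0])
  have D3: "((\<lambda>z. half_sum (- z)) has_field_derivative - deriv half_sum 0) (at 0)"
  proof -
    have "(uminus has_field_derivative (- 1 :: complex)) (at 0)" using DERIV_minus[OF DERIV_ident] by blast
    then show ?thesis using DERIV_chain2[of half_sum "deriv half_sum 0" uminus 0 "-1" UNIV] D2 by simp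
  qed
  have "(g has_field_derivative (- wp0 0 - (1 / w1) * (cot_coeff * (1 / w1)) + (2 * pi * \<i> / w1) * (deriv half_sum 0 - - deriv half_sum 0))) (at 0)"
    unfolding g_def
    by (intro DERIV_add DERIV_diff DERIV_cmult zeta0_has_deriv[OF z0] D1 D2 D3)
  then have "deriv g 0 = - wp0 0 - (1 / w1) * (cot_coeff * (1 / w1)) + (2 * pi * \<i> / w1) * (deriv half_sum 0 - - deriv half_sum 0)"
    by (rule DERIV_imp_deriv)
  also have "\<dots> = (- cot_coeff - 8 * pi^2 * lambert q) / w1^2"
    using w1 by (simp add: half_sum_deriv_0 field_simps power2_eq_square)
  finally show ?thesis using lim by simp
qed

lemma deriv_zeta_defect_const:
  assumes "z \<notin> L"
  shows "deriv zeta_defect z = (- cot_coeff - 8 * pi^2 * lambert q) / w1^2"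
proof -
  let ?c = "(- cot_coeff - 8 * pi^2 * lambert q) / w1^2"
  have lim: "(deriv zeta_defect \<longlongrightarrow> ?c) (at p)" if p: "p \<in> L" for p
  proof -
    obtain d where d: "d > 0" "ball p d \<inter> L \<subseteq> {p}" using locally_finite_closed(1)[OF finite_L_ball] by blast
    have "((\<lambda>z. deriv zeta_defect (z + - p)) \<longlongrightarrow> ?c) (at p)" using LIM_offset[OF deriv_zeta_defect_lim, of "- p"] by simp
    moreover have "eventually (\<lambda>z. deriv zeta_defect (z + - p) = deriv zeta_defect z) (at p)"
    proof -
      have "deriv zeta_defect (z + - p) = deriv zeta_defect z" if "z \<noteq> p" "dist z p < d" for z
      proof (rule deriv_zeta_defect_periodic)
        have "z \<in> ball p d" using that by (simp add: dist_commute)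
        then show "z \<notin> L" using d(2) that by blast
      qed (use p in auto)
      then show ?thesis unfolding eventually_at using d(1) by blast
    qed
    ultimately show ?thesis by (rule Lim_transform_eventually)
  qed
  have "\<exists>c. \<forall>z. z \<notin> L \<longrightarrow> deriv zeta_defect z = c"
  proof (rule liouville_lattice[OF finite_L_ball])
    show "deriv zeta_defect holomorphic_on - L" by (rule holomorphic_deriv[OF zeta_defect_holo open_minus_L])
  qed (use lim deriv_zeta_defect_periodic in auto)
  then obtain c where c: "\<And>z. z \<notin> L \<Longrightarrow> deriv zeta_defect z = c" by blast
  obtain d where d: "d > 0" "ball 0 d \<inter> L \<subseteq> {0}" using locally_finite_closed(1)[OF finite_L_ball] by blast
  have "z \<notin> L" if "z \<noteq> 0" "dist z 0 < d" for z using d(2) that by auto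
  then have "eventually (\<lambda>z. deriv zeta_defect z = c) (at 0)"
    unfolding eventually_at using d(1) c by (intro exI[of _ d]) blast
  then have "(deriv zeta_defect \<longlongrightarrow> c) (at 0)" by (simp add: tendsto_eventually)
  then have "c = ?c" using lim[OF L_0] LIM_unique by blast
  then show ?thesis using c[OF assms] by simp
qed

text \<open>A form of the Legendre relation. With slope c of \<open>zeta_defect\<close>, the shifts
  by w1 and w2 give two linear equations in c - e2 and \<open>kap\<close>; solving them gives
  \<open>kap * cnj w1\<close> = pi / (Im t * w1), which accounts for the term - pi / Im t.\<close>

lemma e2_E2_basis: "e2 * w1^2 = E2_basis (w2 / w1)"
proof -
  define c where "c = (- cot_coeff - 8 * pi^2 * lambert q) / w1^2"
  have conn: "connected (- L)"
    using connected_open_diff_countable[of UNIV L] countable_L convex_connected[OF convex_UNIV]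
    by (simp add: Compl_eq_Diff_UNIV)
  have D: "((\<lambda>z. zeta_defect z - c * z) has_field_derivative 0) (at z)" if "z \<in> - L" for z
  proof -
    have "((\<lambda>z. zeta_defect z - c * z) has_field_derivative deriv zeta_defect z - c * 1) (at z)"
      by (intro DERIV_diff DERIV_cmult DERIV_ident holomorphic_derivI[OF zeta_defect_holo open_minus_L that])
    then show ?thesis using deriv_zeta_defect_const[of z] that by (simp add: c_def)
  qed
  then have cont: "continuous_on (- L) (\<lambda>z. zeta_defect z - c * z)"
    by (meson DERIV_isCont continuous_at_imp_continuous_on)
  obtain K where K: "\<And>z. z \<in> - L \<Longrightarrow> zeta_defect z - c * z = K"
    using DERIV_zero_connected_constant[OF conn open_minus_L, of "{}" "\<lambda>z. zeta_defect z - c * z"] cont D by auto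
  have "- L \<noteq> {}"
  proof -
    have "L \<noteq> UNIV" using countable_L uncountable_UNIV_complex by auto
    then show ?thesis by auto
  qed
  then obtain z where z: "z \<notin> L" by auto
  have zl: "z + w1 \<notin> L" "z + w2 \<notin> L" using z L_add_iff by auto
  have "c * w1 = e2 * w1 + kap * cnj w1"
    using K[of z] K[of "z + w1"] zeta_defect_w1[of z] z zl by (simp add: algebra_simps)
  then have 1: "(c - e2) * w1 = kap * cnj w1" by (simp add: algebra_simps)
  have "c * w2 = e2 * w2 + kap * cnj w2 + 2 * pi * \<i> / w1"
    using K[of z] K[of "z + w2"] zeta_defect_w2[OF z] z zl by (simp add: algebra_simps)
  then have 2: "(c - e2) * w2 = kap * cnj w2 + 2 * pi * \<i> / w1" by (simp add: algebra_simps)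
  define t where "t = w2 / w1"
  have t: "w2 = w1 * t" using w1 by (simp add: t_def)
  define k where "k = kap * cnj w1"
  have "k * t = k * cnj t + 2 * pi * \<i> / w1"
  proof -
    have "(c - e2) * w2 = ((c - e2) * w1) * t" by (simp add: t)
    also have "\<dots> = k * t" by (simp only: 1 k_def)
    finally have "k * t = kap * cnj w2 + 2 * pi * \<i> / w1" using 2 by simp
    also have "kap * cnj w2 = k * cnj t" by (simp add: t k_def)
    finally show ?thesis .
  qed
  then have "k * (t - cnj t) = 2 * pi * \<i> / w1" by (simp add: algebra_simps)
  moreover have "t - cnj t = 2 * \<i> * Im t" by (simp add: complex_eq_iff)
  ultimately have "k * (2 * \<i> * Im t) = 2 * pi * \<i> / w1" by simp
  then have "(2 * \<i>) * (k * Im t) = (2 * \<i>) * (pi / w1)" by (simp add: algebra_simps)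
  then have "k * Im t = pi / w1" by (subst (asm) mult_left_cancel) auto
  then have k: "k = pi / (Im t * w1)" using pos w1 by (simp add: t_def field_simps)
  have ew: "e2 * w1 = c * w1 - k" using 1 by (simp add: k_def algebra_simps)
  have "e2 * w1^2 = (e2 * w1) * w1" by (simp add: power2_eq_square)
  also have "\<dots> = c * w1^2 - k * w1" unfolding ew by (simp add: power2_eq_square algebra_simps)
  also have "\<dots> = - cot_coeff - 8 * pi^2 * lambert q - pi / Im t"
    using w1 by (simp add: c_def k)
  also have "q = exp (2 * pi * \<i> * t)" by (simp add: q_def eper_def t_def)
  finally show ?thesis by (simp add: E2_basis_def t_def)
qed

end

context cm_lattice
begin

text \<open>A multiplier of norm 1 maps L onto itself, and the weight 2 value scales by m^2 under
  it, so e2 = m^2 e2.\<close>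

lemma unit_e2_zero:
  assumes "m \<in> multipliers L" "norm m = 1" "m^2 \<noteq> 1"
  shows "e2 = 0"
proof -
  have m0: "m \<noteq> 0" using assms(2) by auto
  have "of_nat 1 = m * cnj m" using complex_norm_square[of m] assms(2) by simp
  from eisE_distribution[OF assms(1) m0 multipliers_cnj[OF assms(1)] this, of 2 0]
  have "e2 = m^2 * e2" using assms(2) by (simp add: bsum_1[simplified] e2_def)
  then have "(m^2 - 1) * e2 = 0" by (simp add: algebra_simps)
  then show ?thesis using assms(3) by simp
qed

end

section \<open>Non-vanishing of \<open>E\<^sub>2(0)\<close>\<close>

lemma lambert_term_diff:
  fixes x y :: complex
  assumes "x \<noteq> 1" "y \<noteq> 1"
  shows "x / (1 - x)^2 - y / (1 - y)^2 = (x - y) * ((1 - x * y) / ((1 - x)^2 * (1 - y)^2))"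
  using assms by (simp add: divide_simps) (simp add: algebra_simps power2_eq_square)

lemma norm_power_diff_le:
  fixes x y :: complex
  assumes "norm x \<le> r" "norm y \<le> r" "r \<ge> 0"
  shows "norm (x ^ Suc n - y ^ Suc n) \<le> real (Suc n) * r ^ n * norm (x - y)"
proof (induction n)
  case (Suc n)
  have "x ^ Suc (Suc n) - y ^ Suc (Suc n) = x * (x ^ Suc n - y ^ Suc n) + (x - y) * y ^ Suc n"
    by (simp add: algebra_simps)
  then have "norm (x ^ Suc (Suc n) - y ^ Suc (Suc n)) \<le> norm x * norm (x ^ Suc n - y ^ Suc n) + norm (x - y) * norm y ^ Suc n"
    by (metis norm_mult norm_power norm_triangle_ineq)
  also have "\<dots> \<le> r * (real (Suc n) * r ^ n * norm (x - y)) + norm (x - y) * r ^ Suc n"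
    using assms Suc by (intro add_mono mult_mono power_mono) auto
  also have "\<dots> = real (Suc (Suc n)) * r ^ Suc n * norm (x - y)" by (simp add: algebra_simps)
  finally show ?case .
qed auto

lemma lambert_factor_bounds:
  fixes x y :: complex
  assumes "norm x \<le> 1/100" "norm y \<le> 1/100"
  shows "norm ((1 - x * y) / ((1 - x)^2 * (1 - y)^2)) \<le> 11/10"
    and "norm ((1 - x * y) / ((1 - x)^2 * (1 - y)^2)) \<ge> 9/10"
proof -
  have xy: "norm (x * y) \<le> 1/100 * (1/100)" unfolding norm_mult using assms by (intro mult_mono) auto
  have b: "99/100 \<le> norm (1 - z)" "norm (1 - z) \<le> 101/100" if "norm z \<le> 1/100" for z :: complex
    using norm_triangle_ineq2[of 1 z] norm_triangle_ineq4[of 1 z] that by auto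
  have n: "9999/10000 \<le> norm (1 - x * y)" "norm (1 - x * y) \<le> 10001/10000"
    using norm_triangle_ineq2[of 1 "x * y"] norm_triangle_ineq4[of 1 "x * y"] xy by auto
  have dl: "(99/100)^2 * (99/100)^2 \<le> norm (1 - x)^2 * norm (1 - y)^2"
    using b assms by (intro mult_mono power_mono) auto
  have du: "norm (1 - x)^2 * norm (1 - y)^2 \<le> (101/100)^2 * (101/100)^2"
    using b assms by (intro mult_mono power_mono) auto
  have dp: "0 < norm (1 - x)^2 * norm (1 - y)^2" using dl by (rule less_le_trans[rotated]) simp
  have e: "norm ((1 - x * y) / ((1 - x)^2 * (1 - y)^2)) = norm (1 - x * y) / (norm (1 - x)^2 * norm (1 - y)^2)"
    by (simp add: norm_divide norm_mult norm_power)
  have "norm (1 - x * y) / (norm (1 - x)^2 * norm (1 - y)^2) \<le> (10001/10000) / ((99/100)^2 * (99/100)^2)"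
    using n dl by (intro frac_le) auto
  also have "\<dots> \<le> 11/10" by (simp add: power2_eq_square)
  finally show "norm ((1 - x * y) / ((1 - x)^2 * (1 - y)^2)) \<le> 11/10" unfolding e .
  have "9/10 \<le> (9999/10000) / ((101/100)^2 * (101/100)^2 :: real)" by (simp add: power2_eq_square)
  also have "\<dots> \<le> norm (1 - x * y) / (norm (1 - x)^2 * norm (1 - y)^2)"
    using n du dp by (intro frac_le) auto
  finally show "norm ((1 - x * y) / ((1 - x)^2 * (1 - y)^2)) \<ge> 9/10" unfolding e .
qed

text \<open>Near 0 the series is close to the identity. Its first term has difference quotients of
  modulus between 9/10 and 11/10, and all later terms together contribute at most 1/20. The upper
  bound serves to compare heights, the lower one gives injectivity on the disc.\<close>

lemma lambert_estimate:
  fixes x y :: complex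
  assumes x: "norm x \<le> 1/100" and y: "norm y \<le> 1/100"
  shows "norm (lambert x - lambert y) \<le> 12/10 * norm (x - y)" and "norm (lambert x - lambert y) \<ge> 8/10 * norm (x - y)"
proof -
  define T where "T m z = z^m / (1 - z^m)^2" for m and z :: complex
  have pw: "norm (z^m) \<le> 1/100" if "norm z \<le> 1/100" "m \<ge> 1" for z :: complex and m
  proof -
    have "norm (z^m) \<le> (1/100)^m" unfolding norm_power using that by (intro power_mono) auto
    also have "\<dots> \<le> (1/100)^1" using that(2) by (intro power_decreasing) auto
    finally show ?thesis by simp
  qed
  have ne: "z^m \<noteq> 1" if "norm z \<le> 1/100" "m \<ge> 1" for z :: complex and m using pw[OF that] by auto
  have Td: "norm (T (Suc n) x - T (Suc n) y) \<le> 11/10 * (real (Suc n) * (1/100)^n * norm (x - y))" for n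
  proof -
    have "T (Suc n) x - T (Suc n) y = (x ^ Suc n - y ^ Suc n) * ((1 - x ^ Suc n * y ^ Suc n) / ((1 - x ^ Suc n)^2 * (1 - y ^ Suc n)^2))"
      unfolding T_def by (rule lambert_term_diff) (use ne[of x "Suc n"] ne[of y "Suc n"] x y in auto)
    then have "norm (T (Suc n) x - T (Suc n) y) = norm (x ^ Suc n - y ^ Suc n) * norm ((1 - x ^ Suc n * y ^ Suc n) / ((1 - x ^ Suc n)^2 * (1 - y ^ Suc n)^2))"
      by (simp only: norm_mult)
    also have "\<dots> \<le> (real (Suc n) * (1/100) ^ n * norm (x - y)) * (11/10)"
      using x y pw[of x "Suc n"] pw[of y "Suc n"]
      by (intro mult_mono norm_power_diff_le lambert_factor_bounds(1)) auto
    finally show ?thesis by simp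
  qed
  have geo: "(\<lambda>n. real (Suc n) * (1/100)^n) sums (1 / (1 - 1/100)^2)" by (rule geometric_deriv_sums) simp
  have sumT: "(\<lambda>m. T m z) summable_on {1..}" if z: "norm z \<le> 1/100" for z
  proof -
    have le: "norm (T m z) \<le> 2 * (1/100)^m" if m: "m \<in> {1..}" for m
    proof -
      have "99/100 \<le> norm (1 - z^m)" using norm_triangle_ineq2[of 1 "z^m"] pw[of z m] z m by simp
      then have "(99/100)^2 \<le> norm (1 - z^m)^2" by (intro power_mono) auto
      then have d: "1/2 \<le> norm (1 - z^m)^2" by (simp add: power2_eq_square)
      have "norm (T m z) = norm z ^ m / norm (1 - z^m)^2" by (simp add: T_def norm_divide norm_power)
      also have "\<dots> \<le> (1/100)^m / (1/2)" using d z by (intro frac_le power_mono) auto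
      finally show ?thesis by simp
    qed
    have "(\<lambda>m. 2 * (1/100)^m :: real) summable_on UNIV"
      by (subst summable_on_UNIV_nonneg_real_iff) (auto intro!: summable_mult summable_geometric)
    then have s: "(\<lambda>m. 2 * (1/100)^m :: real) summable_on {1..}" by (rule summable_on_subset_banach) auto
    show ?thesis by (rule abs_summable_summable[OF Infinite_Sum.abs_summable_on_comparison_test'[OF s le]])
  qed
  have FS: "(\<lambda>n. T (Suc n) z) sums lambert z" if z: "norm z \<le> 1/100" for z
  proof -
    have "((\<lambda>m. T m z) has_sum lambert z) {1..}" unfolding lambert_def T_def[symmetric] using sumT[OF z] by simp
    moreover have "m \<in> range Suc" if "m \<ge> 1" for m using that by (intro image_eqI[of _ _ "m - 1"]) auto
    then have "{1..} = Suc ` UNIV" by auto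
    ultimately have "((\<lambda>n. T (Suc n) z) has_sum lambert z) UNIV"
      by (simp add: has_sum_reindex o_def)
    then show ?thesis by (rule has_sum_imp_sums)
  qed
  have D: "(\<lambda>n. T (Suc n) x - T (Suc n) y) sums (lambert x - lambert y)" by (intro sums_diff FS x y)
  let ?d = "norm (x - y)"
  have g2: "(\<lambda>n. 11/10 * (real (Suc n) * (1/100)^n * ?d)) sums (11/10 * (1 / (1 - 1/100)^2 * ?d))"
    by (intro sums_mult sums_mult2 geo)
  have tail: "norm ((lambert x - lambert y) - (T 1 x - T 1 y)) \<le> 1/20 * ?d"
  proof -
    have D1: "(\<lambda>n. T (Suc (Suc n)) x - T (Suc (Suc n)) y) sums ((lambert x - lambert y) - (T 1 x - T 1 y))"
      using sums_split_initial_segment[OF D, of 1] by simp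
    have g3: "(\<lambda>n. 11/10 * (real (Suc (Suc n)) * (1/100)^(Suc n) * ?d)) sums (11/10 * (1 / (1 - 1/100)^2 * ?d) - 11/10 * ?d)"
      using sums_split_initial_segment[OF g2, of 1] by simp
    have le: "norm (T (Suc (Suc n)) x - T (Suc (Suc n)) y) \<le> 11/10 * (real (Suc (Suc n)) * (1/100)^(Suc n) * ?d)" for n
      by (rule Td)
    have "norm ((lambert x - lambert y) - (T 1 x - T 1 y)) \<le> 11/10 * (1 / (1 - 1/100)^2 * ?d) - 11/10 * ?d"
      using norm_suminf_le[OF le sums_summable[OF g3]] D1 g3 by (simp add: sums_iff)
    also have "\<dots> \<le> 1/20 * ?d"
    proof -
      have "11/10 * (1 / (1 - 1/100)^2) - 11/10 \<le> (1/20 :: real)" by (simp add: power2_eq_square)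
      then have "(11/10 * (1 / (1 - 1/100)^2) - 11/10) * ?d \<le> 1/20 * ?d" by (intro mult_right_mono) auto
      then show ?thesis by (simp add: algebra_simps)
    qed
    finally show ?thesis .
  qed
  have T1: "norm (T 1 x - T 1 y) \<le> 11/10 * ?d" "9/10 * ?d \<le> norm (T 1 x - T 1 y)"
  proof -
    have "T 1 x - T 1 y = (x - y) * ((1 - x * y) / ((1 - x)^2 * (1 - y)^2))"
      unfolding T_def using lambert_term_diff[of x y] ne[OF x, of 1] ne[OF y, of 1] by simp
    then have "norm (T 1 x - T 1 y) = ?d * norm ((1 - x * y) / ((1 - x)^2 * (1 - y)^2))" by (simp only: norm_mult)
    then show "norm (T 1 x - T 1 y) \<le> 11/10 * ?d" "9/10 * ?d \<le> norm (T 1 x - T 1 y)"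
      using mult_left_mono[OF lambert_factor_bounds(1)[OF x y], of ?d] mult_left_mono[OF lambert_factor_bounds(2)[OF x y], of ?d] by simp_all
  qed
  show "norm (lambert x - lambert y) \<le> 12/10 * ?d"
    using norm_triangle_sub[of "lambert x - lambert y" "T 1 x - T 1 y"] tail T1 by simp
  show "norm (lambert x - lambert y) \<ge> 8/10 * ?d"
    using norm_triangle_sub[of "T 1 x - T 1 y" "lambert x - lambert y"] tail T1 by (simp add: norm_minus_commute)
qed

lemma lambert_cnj: "lambert (cnj x) = cnj (lambert x)"
  unfolding lambert_def infsum_cnj[symmetric] by (rule infsum_cong) simp

text \<open>For x = 2 pi y the quantity 48/10 x^2 is 8 pi^2 (12/10) 2 y^2, which decides the sign of
  the derivative in \<open>height_comparison\<close>. The bound 143 is (27/10)^5 rounded down, and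
  the rest is the quadratic Taylor bound at 5.\<close>

lemma exp_ge_quadratic:
  fixes x :: real
  assumes "x \<ge> 5" shows "exp x > 48/10 * x^2" and "exp x \<ge> 100"
proof -
  have e1: "exp (1::real) \<ge> 27/10" using e_approx_32 unfolding abs_le_iff by simp
  have "exp (5::real) = exp 1 ^ 5" by (simp add: exp_of_nat_mult[symmetric])
  also have "\<dots> \<ge> (27/10)^5" using e1 by (intro power_mono) auto
  finally have e5: "exp (5::real) \<ge> 143" by (simp add: power_numeral_reduce)
  define u where "u = x - 5"
  have v: "u^2 \<ge> 0" by simp
  have R: "143 * (1 + u + u^2/2) = 143 + 143 * u + 143/2 * u^2" by (simp add: algebra_simps)
  have u: "u \<ge> 0" using assms by (simp add: u_def)
  have "exp u \<ge> 1 + u + u^2/2" using u by (rule exp_lower_Taylor_quadratic)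
  then have "143 * (1 + u + u^2/2) \<le> exp 5 * exp u" using e5 u by (intro mult_mono) auto
  also have "\<dots> = exp x" by (simp add: u_def exp_add[symmetric])
  finally have E: "143 * (1 + u + u^2/2) \<le> exp x" .
  have "48/10 * x^2 = 120 + 48 * u + 48/10 * u^2" by (simp add: u_def power2_eq_square algebra_simps)
  also have "\<dots> < 143 * (1 + u + u^2/2)" unfolding R using u v by linarith
  finally show "exp x > 48/10 * x^2" using E by linarith
  show "exp x \<ge> 100" using E u v unfolding R by linarith
qed

text \<open>pi / y - 8 pi^2 (12/10) exp (- 2 pi y) is strictly decreasing from y = 8/10 on; 12/10 is
  the Lipschitz constant of \<open>lambert\<close>.\<close>

lemma height_comparison:
  assumes "y0 \<ge> 8/10" "y0 < y"
  shows "8 * pi^2 * (12/10) * (exp (- 2 * pi * y0) - exp (- 2 * pi * y)) < pi / y0 - pi / y"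
proof -
  define g where "g y = pi / y - 8 * pi^2 * (12/10) * exp (- 2 * pi * y)" for y :: real
  define g' where "g' y = - pi / y^2 + 8 * pi^2 * (12/10) * (2 * pi) * exp (- 2 * pi * y)" for y :: real
  have D: "(g has_real_derivative g' y) (at y)" if "y > 0" for y
    unfolding g_def g'_def using that by (auto intro!: derivative_eq_intros simp: power2_eq_square field_simps)
  have neg: "g' y < 0" if "y \<ge> 8/10" for y
  proof -
    have "pi \<ge> 3125/1000" using pi_approx by simp
    then have "2 * pi * y \<ge> 2 * (3125/1000) * (8/10)" using that by (intro mult_mono) auto
    then have X: "2 * pi * y \<ge> 5" by simp
    then have "exp (2 * pi * y) > 48/10 * (2 * pi * y)^2" by (rule exp_ge_quadratic)
    then have "pi * (8 * pi^2 * (12/10) * 2 * y^2) < pi * exp (2 * pi * y)"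
      by (intro mult_strict_left_mono) (auto simp: power2_eq_square algebra_simps)
    then show ?thesis using that by (simp add: g'_def exp_minus field_simps power2_eq_square)
  qed
  have "g y < g y0"
  proof (rule DERIV_neg_imp_decreasing[OF assms(2)])
    fix x assume "y0 \<le> x"
    then show "\<exists>d. (g has_real_derivative d) (at x) \<and> d < 0"
      using D[of x] neg[of x] assms by (intro exI[of _ "g' x"]) auto
  qed
  then show ?thesis by (simp add: g_def algebra_simps)
qed

section \<open>Oriented and reduced bases\<close>

definition obasis :: "complex set \<Rightarrow> complex \<Rightarrow> complex \<Rightarrow> bool" where
  "obasis L u v \<longleftrightarrow> lattice_basis u v L \<and> Im (v / u) > 0"

lemma obasis_rotate:
  assumes "obasis L u v" shows "obasis L v (- u)"
proof -
  have u: "u \<noteq> 0" and t: "Im (v / u) > 0" and L: "L = {of_int m * u + of_int n * v | m n. True}"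
    using assms by (auto simp: obasis_def lattice_basis_def)
  define s where "s = v / u"
  have s0: "s \<noteq> 0" using t by (auto simp: s_def)
  have v: "v \<noteq> 0" using t by auto
  have "- u / v = - inverse s" using u by (simp add: s_def field_simps)
  then have i: "Im (- u / v) = Im s / (norm s)^2" by (simp add: cmod_power2)
  then have pos: "Im (- u / v) > 0" using t s0 by (simp add: s_def)
  have "{of_int m * u + of_int n * v | m n. True} = {of_int m * v + of_int n * (- u) | m n. True}"
  proof (intro equalityI subsetI)
    fix x assume "x \<in> {of_int m * u + of_int n * v | m n. True}"
    then obtain m n where "x = of_int m * u + of_int n * v" by blast
    then have "x = of_int n * v + of_int (- m) * (- u)" by simp
    then show "x \<in> {of_int m * v + of_int n * (- u) | m n. True}" by blast
  next
    fix x assume "x \<in> {of_int m * v + of_int n * (- u) | m n. True}"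
    then obtain m n where "x = of_int m * v + of_int n * (- u)" by blast
    then have "x = of_int (- n) * u + of_int m * v" by simp
    then show "x \<in> {of_int m * u + of_int n * v | m n. True}" by blast
  qed
  then show ?thesis using L v pos by (simp add: obasis_def lattice_basis_def)
qed

lemma obasis_shear:
  assumes "obasis L u v" shows "obasis L u (v + of_int k * u)"
proof -
  have u: "u \<noteq> 0" and t: "Im (v / u) > 0" and L: "L = {of_int m * u + of_int n * v | m n. True}"
    using assms by (auto simp: obasis_def lattice_basis_def)
  have "(v + of_int k * u) / u = v / u + of_int k" using u by (simp add: field_simps)
  then have pos: "Im ((v + of_int k * u) / u) > 0" using t by simp
  have "{of_int m * u + of_int n * v | m n. True} = {of_int m * u + of_int n * (v + of_int k * u) | m n. True}"
  proof (intro equalityI subsetI)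
    fix x assume "x \<in> {of_int m * u + of_int n * v | m n. True}"
    then obtain m n where "x = of_int m * u + of_int n * v" by blast
    then have "x = of_int (m - n * k) * u + of_int n * (v + of_int k * u)" by (simp add: algebra_simps)
    then show "x \<in> {of_int m * u + of_int n * (v + of_int k * u) | m n. True}" by blast
  next
    fix x assume "x \<in> {of_int m * u + of_int n * (v + of_int k * u) | m n. True}"
    then obtain m n where "x = of_int m * u + of_int n * (v + of_int k * u)" by blast
    then have "x = of_int (m + n * k) * u + of_int n * v" by (simp add: algebra_simps)
    then show "x \<in> {of_int m * u + of_int n * v | m n. True}" by blast
  qed
  then show ?thesis using L u pos by (simp add: obasis_def lattice_basis_def)
qed

context lattice_basis
begin

lemma obasis_exists: "\<exists>u v. obasis L u v"
proof (cases "Im (w2 / w1) > 0")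
  case True
  then show ?thesis using lattice_basis_axioms by (auto simp: obasis_def)
next
  case False
  have "L = {of_int m * w1 + of_int n * (- w2) | m n. True}"
  proof (intro equalityI subsetI)
    fix x assume "x \<in> L"
    then obtain m n where "x = of_int m * w1 + of_int n * w2" using L_eq by blast
    then have "x = of_int m * w1 + of_int (- n) * (- w2)" by simp
    then show "x \<in> {of_int m * w1 + of_int n * (- w2) | m n. True}" by blast
  next
    fix x assume "x \<in> {of_int m * w1 + of_int n * (- w2) | m n. True}"
    then obtain m n where "x = of_int m * w1 + of_int n * (- w2)" by blast
    then have "x = of_int m * w1 + of_int (- n) * w2" by simp
    then show "x \<in> L" using L_eq by blast
  qed
  then show ?thesis using False im w1
    by (intro exI[of _ w1] exI[of _ "- w2"]) (auto simp: obasis_def lattice_basis_def)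
qed

lemma norm_minimum:
  assumes "W \<subseteq> L" "W \<noteq> {}"
  shows "\<exists>w\<in>W. \<forall>v\<in>W. norm w \<le> norm v"
proof -
  obtain w0 where w0: "w0 \<in> W" using assms by blast
  define V where "V = {w \<in> W. norm w \<le> norm w0}"
  have "finite V" by (rule finite_subset[OF _ finite_L_ball[of "norm w0"]]) (use assms in \<open>auto simp: V_def\<close>)
  moreover have "V \<noteq> {}" using w0 by (auto simp: V_def)
  ultimately obtain w where w: "w \<in> V" "\<And>v. v \<in> V \<Longrightarrow> norm w \<le> norm v"
    using ex_is_arg_min_if_finite[of V norm] by (auto simp: is_arg_min_linorder)
  then have "norm w \<le> norm v" if "v \<in> W" for v
    using that by (cases "norm v \<le> norm w0") (auto simp: V_def)
  then show ?thesis using w(1) by (auto simp: V_def)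
qed

lemma obasis_in: "obasis L u v \<Longrightarrow> u \<in> L" "obasis L u v \<Longrightarrow> v \<in> L"
  using lattice_basis.L_w1 lattice_basis.L_w2 by (auto simp: obasis_def)

text \<open>u is a shortest first vector of an oriented basis, v a shortest completion of u.
  Rotation then gives |u| \<le> |v|, and the shears by u and - u bound Re (v/u).\<close>

lemma reduced_basis:
  "\<exists>u v. obasis L u v \<and> norm (v / u) \<ge> 1 \<and> \<bar>Re (v / u)\<bar> \<le> 1/2"
proof -
  have "\<exists>u\<in>{u. \<exists>v. obasis L u v}. \<forall>u'\<in>{u. \<exists>v. obasis L u v}. norm u \<le> norm u'"
    by (rule norm_minimum) (use obasis_in obasis_exists in auto)
  then obtain u v0 where u: "obasis L u v0" "\<And>u' v. obasis L u' v \<Longrightarrow> norm u \<le> norm u'" by blast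
  have "\<exists>v\<in>{v. obasis L u v}. \<forall>v'\<in>{v. obasis L u v}. norm v \<le> norm v'"
    by (rule norm_minimum) (use obasis_in u(1) in auto)
  then obtain v where v: "obasis L u v" "\<And>v'. obasis L u v' \<Longrightarrow> norm v \<le> norm v'" by blast
  have u0: "u \<noteq> 0" using v(1) by (auto simp: obasis_def lattice_basis_def)
  define t where "t = v / u"
  have vt: "v = u * t" using u0 by (simp add: t_def)
  have "norm u \<le> norm v" using u(2)[OF obasis_rotate[OF v(1)]] .
  then have 1: "norm t \<ge> 1" using u0 by (simp add: t_def norm_divide)
  have sh: "norm t \<le> norm (t + of_int k)" for k
  proof -
    have "norm v \<le> norm (v + of_int k * u)" using v(2)[OF obasis_shear[OF v(1)]] .
    also have "v + of_int k * u = u * (t + of_int k)" by (simp add: vt algebra_simps)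
    finally show ?thesis using u0 by (simp add: vt norm_mult)
  qed
  have "(norm t)^2 \<le> (norm (t + of_int k))^2" for k using sh by (intro power_mono) auto
  then have k: "(Re t)^2 \<le> (Re t + of_int k)^2" for k by (simp add: cmod_power2)
  have "\<bar>Re t\<bar> \<le> 1/2" using k[of 1] k[of "-1"] by (auto simp: power2_eq_square algebra_simps abs_le_iff)
  then show ?thesis using v(1) 1 by (auto simp: t_def)
qed

end

text \<open>The ratio t satisfies t^2 = n t - 1, so it maps both basis vectors u and t u into
  L.\<close>

lemma unit_multiplier:
  assumes "obasis L u v" "norm (v / u) = 1" "2 * Re (v / u) = of_int n"
  shows "v / u \<in> multipliers L"
proof -
  interpret lattice_basis u v L using assms(1) by (simp add: obasis_def)
  define t where "t = v / u"
  have v: "v = t * u" using w1 by (simp add: t_def)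
  have "t * t - (t + cnj t) * t + t * cnj t = 0" by (simp add: algebra_simps)
  moreover have "t + cnj t = of_int n" using complex_add_cnj[of t] assms(3) by (simp add: t_def)
  moreover have "t * cnj t = 1" using complex_norm_square[of t] assms(2) by (simp add: t_def)
  ultimately have tt: "t * t = of_int n * t - 1" by (simp add: algebra_simps)
  have "t * lp i j \<in> L" for i j
  proof -
    have "t * lp i j = of_int i * (t * u) + of_int j * (t * t) * u" unfolding lp_def by (simp add: v algebra_simps)
    also have "\<dots> = lp (- j) (i + j * n)" unfolding tt lp_def by (simp add: v algebra_simps)
    finally show ?thesis by simp
  qed
  then show ?thesis unfolding t_def[symmetric] by (intro multipliersI) (auto elim!: L_cases)
qed

text \<open>The lattice spanned by 1 and t has t itself as a unit multiplier, so its
  \<open>e2\<close> is 0. This supplies the reference zeros i and exp (pi i / 3).\<close>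

lemma E2_basis_special:
  assumes "norm t = 1" "2 * Re t = of_int n" "Im t > 0"
  shows "E2_basis t = 0"
proof -
  define L where "L = {of_int m * 1 + of_int n * t | m n. True}"
  have ob: "obasis L 1 t" using assms by (auto simp: obasis_def lattice_basis_def L_def)
  have m: "t \<in> multipliers L" using unit_multiplier[OF ob] assms by simp
  interpret oriented_cm_lattice 1 t L t
    using ob m assms by (auto simp: obasis_def oriented_cm_lattice_def cm_lattice_def cm_lattice_axioms_def oriented_cm_lattice_axioms_def)
  have "t^2 \<noteq> 1"
  proof
    assume "t^2 = 1"
    then have "t = 1 \<or> t = -1" by (simp add: power2_eq_1_iff)
    then show False using assms(3) by auto
  qed
  then have "e2 = 0" using unit_e2_zero[OF m assms(1)] by simp
  then show ?thesis using e2_E2_basis by simp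
qed

lemma exp_2pi_half_integer:
  assumes "2 * Re t = of_int n"
  shows "exp (2 * pi * \<i> * t) = of_real ((if even n then 1 else - 1) * exp (- 2 * pi * Im t))"
proof -
  have "exp (2 * pi * \<i> * t) = exp (of_real (- 2 * pi * Im t) + \<i> * of_real (pi * (2 * Re t)))"
    by (rule arg_cong[where f = exp]) (simp add: complex_eq_iff)
  also have "\<dots> = of_real (exp (- 2 * pi * Im t)) * exp (\<i> * of_real (pi * (2 * Re t)))"
    by (simp only: exp_add exp_of_real)
  also have "exp (\<i> * of_real (pi * (2 * Re t))) = (of_real (cos (pi * of_int n)) + \<i> * of_real (sin (pi * of_int n)) :: complex)"
    unfolding assms by (simp only: cis_conv_exp[symmetric] cis.code complex_eq_iff) simp
  also have "\<dots> = of_real (if even n then 1 else - 1)"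
    using cos_int_times_real[of n] by (simp add: cos_npi_int sin_npi_int mult.commute)
  finally show ?thesis by simp
qed

lemma norm_q_small:
  assumes "Im t \<ge> 8/10"
  shows "norm (exp (2 * pi * \<i> * t)) \<le> 1/100"
proof -
  have "pi \<ge> 3125/1000" using pi_approx by simp
  then have "2 * pi * Im t \<ge> 2 * (3125/1000) * (8/10)" using assms by (intro mult_mono) auto
  then have "exp (2 * pi * Im t) \<ge> 100" by (intro exp_ge_quadratic(2)) simp
  then have "inverse (exp (2 * pi * Im t)) \<le> inverse 100" by (intro le_imp_inverse_le) auto
  moreover have "norm (exp (2 * pi * \<i> * t)) = inverse (exp (2 * pi * Im t))"
    by (simp add: norm_exp_eq_Re exp_minus)
  ultimately show ?thesis by simp
qed

text \<open>Equal parity gives q and q0 the same sign, so |q0 - q| is the difference of two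
  exponentials. Subtracting the two equations expresses pi / y0 - pi / y through the difference of
  the Lambert series, which is too small by \<open>height_comparison\<close> unless the heights
  agree.\<close>

lemma E2_basis_zeros_same_height:
  assumes "E2_basis t = 0" "E2_basis t0 = 0" "2 * Re t = of_int n" "2 * Re t0 = of_int n0" "even n \<longleftrightarrow> even n0"
    "Im t0 \<ge> 8/10" "Im t \<ge> Im t0"
  shows "Im t = Im t0"
proof (rule ccontr)
  define y where "y = Im t"
  define y0 where "y0 = Im t0"
  assume "Im t \<noteq> Im t0"
  then have yy: "y0 < y" "y0 \<ge> 8/10" using assms by (auto simp: y_def y0_def)
  define q where "q = exp (2 * pi * \<i> * t)"
  define q0 where "q0 = exp (2 * pi * \<i> * t0)"
  define \<sigma> :: real where "\<sigma> = (if even n then 1 else - 1)"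
  have q: "q = of_real (\<sigma> * exp (- 2 * pi * y))" "q0 = of_real (\<sigma> * exp (- 2 * pi * y0))"
    unfolding q_def q0_def \<sigma>_def y_def y0_def using exp_2pi_half_integer[OF assms(3)] exp_2pi_half_integer[OF assms(4)] assms(5) by auto
  have sm: "norm q0 \<le> 1/100" "norm q \<le> 1/100" unfolding q_def q0_def by (rule norm_q_small, use yy in \<open>simp add: y_def y0_def\<close>)+
  have "8 * pi^2 * (lambert q0 - lambert q) = of_real (pi / y - pi / y0)"
    using assms(1,2) unfolding E2_basis_def q_def q0_def y_def y0_def by (simp add: algebra_simps)
  then have "norm (8 * pi^2 * (lambert q0 - lambert q)) = \<bar>pi / y - pi / y0\<bar>" by (simp only: norm_of_real)
  moreover have "pi / y < pi / y0" using yy by (intro divide_strict_left_mono) auto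
  ultimately have "8 * pi^2 * norm (lambert q0 - lambert q) = pi / y0 - pi / y" by (simp add: norm_mult norm_power)
  moreover have "norm (lambert q0 - lambert q) \<le> 12/10 * norm (q0 - q)" by (rule lambert_estimate(1)[OF sm])
  moreover have "norm (q0 - q) = exp (- 2 * pi * y0) - exp (- 2 * pi * y)"
  proof -
    have "q0 - q = of_real (\<sigma> * (exp (- 2 * pi * y0) - exp (- 2 * pi * y)))" by (simp add: q algebra_simps)
    then have "norm (q0 - q) = \<bar>\<sigma>\<bar> * \<bar>exp (- 2 * pi * y0) - exp (- 2 * pi * y)\<bar>" by (simp only: norm_of_real abs_mult)
    also have "exp (- 2 * pi * y) \<le> exp (- 2 * pi * y0)" using yy by simp
    then have "\<bar>exp (- 2 * pi * y0) - exp (- 2 * pi * y)\<bar> = exp (- 2 * pi * y0) - exp (- 2 * pi * y)" by simp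
    finally show ?thesis by (simp add: \<sigma>_def)
  qed
  ultimately have "pi / y0 - pi / y \<le> 8 * pi^2 * (12/10 * (exp (- 2 * pi * y0) - exp (- 2 * pi * y)))"
    by (metis mult_left_mono zero_le_mult_iff zero_le_numeral zero_le_power2)
  then show False using height_comparison[OF yy(2,1)] by (simp only: mult.assoc)
qed

text \<open>Comparison with the zero at i, whose q is real, makes \<open>lambert q\<close> real.
  Then q and its conjugate have the same image, so the lower bound of
  \<open>lambert_estimate\<close> makes q real.\<close>

lemma E2_basis_zero_real_q:
  assumes "E2_basis t = 0" "Im t \<ge> 8/10"
  shows "\<exists>n::int. 2 * Re t = of_int n"
proof -
  define q where "q = exp (2 * pi * \<i> * t)"
  define q1 where "q1 = exp (2 * pi * \<i> * \<i>)"
  have H1: "E2_basis \<i> = 0" by (rule E2_basis_special[where n = 0]) auto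
  have q1: "cnj q1 = q1" by (simp add: q1_def exp_cnj)
  have "8 * pi^2 * (lambert q1 - lambert q) = of_real (pi / Im t - pi)"
    using assms(1) H1 unfolding E2_basis_def q_def q1_def by (simp add: algebra_simps)
  then have eq: "8 * pi^2 * lambert q = 8 * pi^2 * lambert q1 - of_real (pi / Im t - pi)" by (simp add: algebra_simps)
  have "cnj (8 * pi^2 * lambert q) = 8 * pi^2 * lambert q"
    unfolding eq using lambert_cnj[of q1] by (simp add: q1)
  then have "cnj (lambert q) = lambert q" by simp
  then have "lambert (cnj q) = lambert q" by (simp add: lambert_cnj)
  moreover have "norm q \<le> 1/100" unfolding q_def by (rule norm_q_small[OF assms(2)])
  then have "8/10 * norm (cnj q - q) \<le> norm (lambert (cnj q) - lambert q)" by (intro lambert_estimate(2)) auto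
  ultimately have "cnj q = q" by simp
  then have "Im q = 0" by (simp add: complex_eq_iff)
  moreover have "Im q = exp (- 2 * pi * Im t) * sin (2 * pi * Re t)"
    by (simp add: q_def Im_exp)
  ultimately have "sin (2 * pi * Re t) = 0" by simp
  then obtain n :: int where "2 * pi * Re t = of_int n * pi" using sin_zero_iff_int2 by blast
  then have "2 * Re t = of_int n" by simp
  then show ?thesis by blast
qed

lemma eisE2_zero_unit:
  assumes "cm_lattice w1 w2 L \<mu>" "eisE L 2 0 = 0"
  shows "\<exists>m\<in>multipliers L. norm m = 1 \<and> m^2 \<noteq> 1"
proof -
  interpret A: cm_lattice w1 w2 L \<mu> by fact
  obtain u v where uv: "obasis L u v" and n1: "norm (v / u) \<ge> 1" and re: "\<bar>Re (v / u)\<bar> \<le> 1/2"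
    using A.reduced_basis by blast
  interpret B: oriented_cm_lattice u v L \<mu>
    using uv A.mu by (auto simp: obasis_def oriented_cm_lattice_def cm_lattice_def cm_lattice_axioms_def oriented_cm_lattice_axioms_def)
  define t where "t = v / u"
  have pos: "Im t > 0" using uv by (simp add: obasis_def t_def)
  have H: "E2_basis t = 0" using B.e2_E2_basis assms(2) by (simp add: B.e2_def t_def)
  have "(norm t)^2 \<ge> 1^2" using n1 by (intro power_mono) (auto simp: t_def)
  then have xy: "(Re t)^2 + (Im t)^2 \<ge> 1" by (simp add: cmod_power2)
  have "\<bar>Re t\<bar>^2 \<le> (1/2)^2" using re by (intro power_mono) (auto simp: t_def)
  then have "(Im t)^2 \<ge> 3/4" using xy by (simp add: power2_eq_square)
  \<comment> \<open>8/10 is a rational number below sqrt 3 / 2 that still makes 2 pi Im t at least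
    5, as the estimates require.\<close>
  then have "Im t \<ge> 8/10"
  proof -
    have "(8/10)^2 \<le> (Im t)^2" using \<open>(Im t)^2 \<ge> 3/4\<close> by (simp add: power2_eq_square)
    then show ?thesis using pos by (intro power2_le_imp_le[of "8/10"]) auto
  qed
  then obtain n :: int where n: "2 * Re t = of_int n" using E2_basis_zero_real_q[OF H] by blast
  have "\<bar>real_of_int n\<bar> \<le> 1" using re n by (simp add: t_def)
  then have n': "n = 0 \<or> \<bar>n\<bar> = 1" by auto
  have Ret: "Re t = of_int n / 2" using n by simp
  have nt: "norm t = 1"
  \<comment> \<open>Reducedness puts t at or above the reference zero with the same parity: i for n
    = 0, exp (pi i / 3) for n = 1 and n = - 1. Equal heights then place t on the unit
    circle.\<close>
  proof (cases "n = 0")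
    case True
    then have "(Im t)^2 \<ge> 1^2" using xy Ret by simp
    then have "Im t \<ge> 1" using pos by (intro power2_le_imp_le[of 1]) auto
    then have "Im t = 1"
      using E2_basis_zeros_same_height[of t \<i> n 0] H E2_basis_special[of \<i> 0] n True by auto
    then show ?thesis using Ret True by (simp add: cmod_def)
  next
    case False
    define t0 where "t0 = Complex (1/2) (sqrt 3 / 2)"
    have t0: "norm t0 = 1" "2 * Re t0 = of_int 1" "Im t0 > 0"
      by (auto simp: t0_def cmod_def power_divide)
    have "16/10 \<le> sqrt 3" by (rule real_le_rsqrt) (simp add: power2_eq_square)
    then have s: "sqrt 3 / 2 \<ge> 8/10" by simp
    have sq: "(Re t)^2 = 1/4" using n' False unfolding Ret by (auto simp: power_divide abs_if split: if_splits) 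
    have "(sqrt 3 / 2)^2 \<le> (Im t)^2" using xy sq by (simp add: power_divide)
    then have "Im t \<ge> sqrt 3 / 2" using pos by (intro power2_le_imp_le[of "sqrt 3 / 2"]) auto
    moreover have "odd n" using n' False by (auto simp: abs_if split: if_splits)
    ultimately have It: "Im t = sqrt 3 / 2"
      using E2_basis_zeros_same_height[OF H E2_basis_special[OF t0] n t0(2)] s by (simp add: t0_def)
    have "(Im t)^2 = 3/4" unfolding It by (simp add: power_divide)
    then have "(norm t)^2 = 1" using sq by (simp add: cmod_power2)
    then have "norm t = 1 \<or> norm t = -1" by (simp only: power2_eq_1_iff)
    then show ?thesis using norm_ge_zero[of t] by linarith
  qed
  have "t \<in> multipliers L" using unit_multiplier[OF uv] nt n by (simp add: t_def)
  moreover have "t^2 \<noteq> 1"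
  proof
    assume "t^2 = 1"
    then have "t = 1 \<or> t = -1" by (simp add: power2_eq_1_iff)
    then show False using pos by auto
  qed
  ultimately show ?thesis using nt by blast
qed

section \<open>Dedekind sums of products of parabolic elements\<close>

context cm_lattice
begin

lemma ellDsum_homogeneous:
  assumes a: "a \<in> multipliers L" and c: "c \<in> multipliers L" "c \<noteq> 0"
    and x: "x \<in> multipliers L" and y: "y \<in> multipliers L" "y \<noteq> 0" and eq: "a / c = x / y"
  shows "ellDsum L x y = ellDsum L a c"
proof -
  obtain N where N: "N > 0" "mdvd (c * y) N" using mdvd_exists[of "c * y"] c y multipliers_mult by auto
  have N': "mdvd (y * c) N" using N by (simp add: mult.commute)
  have m: "mdvd c N" "mdvd y N" using mdvd_mult_left[OF N(2) c(1) y(1)] mdvd_mult_right[OF N(2) c(1) y(1)] by auto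
  have e: "y * a = c * x" using eq c y by (simp add: field_simps)
  have "ellDsum L x y = Dsum_mean N x y" by (rule ellDsum_Dsum_mean[OF N(1) m(2) x])
  also have "\<dots> = Dsum_mean N (c * x) (c * y)" by (rule Dsum_mean_homogeneous[OF N(1) N' y(1) c(1) x, symmetric])
  also have "\<dots> = Dsum_mean N (y * a) (y * c)" unfolding e mult.commute[of y c] ..
  also have "\<dots> = Dsum_mean N a c" by (rule Dsum_mean_homogeneous[OF N(1,2) c(1) y(1) a])
  also have "\<dots> = ellDsum L a c" by (rule ellDsum_Dsum_mean[OF N(1) m(1) a, symmetric])
  finally show ?thesis .
qed

lemma ellDsum_three_term:
  assumes A: "a \<in> multipliers L" "b \<in> multipliers L" "c \<in> multipliers L" "d \<in> multipliers L"
    and B: "a' \<in> multipliers L" "b' \<in> multipliers L" "c' \<in> multipliers L" "d' \<in> multipliers L"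
    and detA: "a * d - b * c = 1" and detB: "a' * d' - b' * c' = 1"
    and c2: "c'' = c * a' + d * c'" and a2: "a'' = a * a' + b * c'"
    and nz: "c \<noteq> 0" "c' \<noteq> 0" "c'' \<noteq> 0"
  shows "ellDsum L a'' c'' = ellDsum L a c + ellDsum L a' c' + e2 * ((cnj (c' / (c * c'')) - c' / (c * c''))
      + (cnj (c / (c' * c'')) - c / (c' * c'')) + (cnj (c'' / (c * c')) - c'' / (c * c')))"
proof -
  have O: "a'' \<in> multipliers L" "c'' \<in> multipliers L"
    unfolding a2 c2 using A B by (auto intro!: multipliers_add multipliers_mult)
  have "c * (c' * c'') \<in> multipliers L" using A B O multipliers_mult by auto
  moreover have "c * (c' * c'') \<noteq> 0" using nz by simp
  ultimately obtain N where N: "N > 0" "mdvd (c * (c' * c'')) N" using mdvd_exists by blast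
  have "mdvd c N" "mdvd (c' * c'') N"
    using mdvd_mult_left[OF N(2)] mdvd_mult_right[OF N(2)] A B O multipliers_mult by auto
  moreover from this(2) have "mdvd c' N" "mdvd c'' N"
    using mdvd_mult_left mdvd_mult_right B O by blast+
  ultimately show ?thesis
    using Dsum_mean_three_term[OF N(1) _ A B detA detB c2 a2] N(2) ellDsum_Dsum_mean[OF N(1)] A B O by (simp add: c2)
qed

text \<open>The conjugate \<open>A T A^{-1}\<close> of a translation \<open>T\<close> by the integer \<open>m\<close> is treated as the product of
  \<open>A T\<close> and \<open>A^{-1}\<close>, whose Dedekind sums cancel.\<close>
lemma ellDsum_parabolic:
  fixes m :: int
  assumes A: "a \<in> multipliers L" "b \<in> multipliers L" "c \<in> multipliers L" "d \<in> multipliers L"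
    and det: "a * d - b * c = 1" and c0: "c \<noteq> 0" and m: "m \<noteq> 0"
  shows "ellDsum L (1 - of_int m * a * c) (- of_int m * c^2) = 2 * e2 * (cnj (1 / (of_int m * c^2)) - 1 / (of_int m * c^2))"
proof -
  note O = A multipliers_of_int multipliers_mult multipliers_add multipliers_uminus
  obtain N where N: "N > 0" "mdvd c N" using mdvd_exists[OF A(3) c0] by blast
  have N': "mdvd (- c) N"
  proof -
    obtain n where "n \<in> multipliers L" "of_nat N = c * n" using N(2) by (auto simp: mdvd_def)
    then have "- n \<in> multipliers L" "of_nat N = - c * - n" using multipliers_uminus by auto
    then show ?thesis using multipliers_uminus[OF A(3)] unfolding mdvd_def by blast
  qed
  have inv: "ellDsum L d (- c) = - ellDsum L a c"
    using Dsum_mean_inverse[OF N A(1,2,4) det] ellDsum_Dsum_mean[OF N A(1)] ellDsum_Dsum_mean[OF N(1) N' A(4)] by simp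
  have "ellDsum L (1 - of_int m * a * c) (- of_int m * c^2) = ellDsum L a c + ellDsum L d (- c)
     + e2 * ((cnj ((- c) / (c * (- of_int m * c^2))) - (- c) / (c * (- of_int m * c^2)))
      + (cnj (c / ((- c) * (- of_int m * c^2))) - c / ((- c) * (- of_int m * c^2)))
      + (cnj ((- of_int m * c^2) / (c * (- c))) - (- of_int m * c^2) / (c * (- c))))"
  proof (rule ellDsum_three_term)
    show "a * (of_int m * c + d) - (of_int m * a + b) * c = 1" using det by (simp add: algebra_simps)
    show "d * a - (- b) * (- c) = 1" using det by (simp add: algebra_simps)
    show "- of_int m * c^2 = c * d + (of_int m * c + d) * (- c)" by (simp add: power2_eq_square algebra_simps)
    have "1 - of_int m * a * c = (a * d - b * c) - of_int m * a * c" by (simp add: det)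
    then show "1 - of_int m * a * c = a * d + (of_int m * a + b) * (- c)" by (simp add: algebra_simps)
  qed (use O c0 m in auto)
  also have "(- c) / (c * (- of_int m * c^2)) = 1 / (of_int m * c^2)" using c0 by simp
  also have "c / ((- c) * (- of_int m * c^2)) = 1 / (of_int m * c^2)" using c0 by simp
  \<comment> \<open>This quotient is a rational integer, so subtracting it from its conjugate gives
    0; the two other terms coincide, whence the factor 2.\<close>
  also have "(- of_int m * c^2) / (c * (- c)) = of_int m" using c0 by (simp add: power2_eq_square)
  finally show ?thesis by (simp add: inv algebra_simps)
qed

text \<open>The matrix is the product of two parabolic elements fixing \<open>a / c\<close> and \<open>p / q\<close>.\<close>
lemma ellDsum_two_parabolics:
  assumes A: "a \<in> multipliers L" "b \<in> multipliers L" "c \<in> multipliers L" "d \<in> multipliers L"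
    and B: "p \<in> multipliers L" "r \<in> multipliers L" "q \<in> multipliers L" "s \<in> multipliers L"
    and detA: "a * d - b * c = 1" and detB: "p * s - r * q = 1" and c0: "c \<noteq> 0" and q0: "q \<noteq> 0"
    and ne: "a / c \<noteq> p / q"
  shows "\<exists>\<alpha> S. \<alpha> \<longlonglongrightarrow> a / c \<and> S \<longlonglongrightarrow> - (a / c - p / q) \<and>
     (\<forall>\<^sub>F m in sequentially. \<exists>x y. x \<in> multipliers L \<and> y \<in> multipliers L \<and> y \<noteq> 0 \<and> \<alpha> m = x / y \<and>
        ellDsum L x y = e2 * (cnj (S m) - S m))"
proof -
  define D where "D = a * q - p * c"
  have D0: "D \<noteq> 0" using ne c0 q0 by (simp add: D_def field_simps)
  define M where "M m = (of_nat m :: complex)" for m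
  \<comment> \<open>x m and y m form the first column of the product of the parabolic matrices for m
    and - m.\<close>
  define x where "x m = 1 + M m * (p * q - a * c) + M m^2 * (a * q * D)" for m
  define y where "y m = M m * (q^2 - c^2) + M m^2 * (c * q * D)" for m
  \<comment> \<open>The first two summands come from the two parabolic factors, the other three from
    the three-term relation. As y m is of order m^2, only the last survives in the limit, as - D/(c
    q).\<close>
  define S where "S m = 2 * (1 / (M m * c^2)) + 2 * (1 / (- M m * q^2)) +
     (M m * q^2) / ((- M m * c^2) * y m) + (- M m * c^2) / ((M m * q^2) * y m) + y m / ((- M m * c^2) * (M m * q^2))" for m
  define i where "i m = inverse (M m)" for m
  have i: "i \<longlonglongrightarrow> 0" unfolding i_def M_def by (rule lim_inverse_n)
  have pos: "\<forall>\<^sub>F m in sequentially. m > 0" by (rule eventually_gt_at_top)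
  \<comment> \<open>y m / m^2, whose limit c q D is nonzero because the two fixed points
    differ.\<close>
  define Y where "Y m = i m * (q^2 - c^2) + c * q * D" for m
  have Ylim: "Y \<longlonglongrightarrow> 0 * (q^2 - c^2) + c * q * D" unfolding Y_def by (intro tendsto_intros i)
  have YD: "0 * (q^2 - c^2) + c * q * D \<noteq> 0" using D0 c0 q0 by simp
  have Ynz: "\<forall>\<^sub>F m in sequentially. Y m \<noteq> 0" by (rule tendsto_imp_eventually_ne[OF Ylim YD])
  have yY: "y m = M m^2 * Y m" if "m > 0" for m
    using that by (simp add: y_def Y_def i_def M_def power2_eq_square field_simps)
  have "(\<lambda>m. (i m^2 + i m * (p * q - a * c) + a * q * D) / Y m) \<longlonglongrightarrow>
     (0^2 + 0 * (p * q - a * c) + a * q * D) / (0 * (q^2 - c^2) + c * q * D)"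
    by (intro tendsto_intros i Ylim YD)
  moreover have "\<forall>\<^sub>F m in sequentially. (i m^2 + i m * (p * q - a * c) + a * q * D) / Y m = x m / y m"
    using pos Ynz
  proof eventually_elim
    case (elim m)
    have "x m = M m^2 * (i m^2 + i m * (p * q - a * c) + a * q * D)"
      using elim by (simp add: x_def i_def M_def power2_eq_square field_simps)
    then show ?case using elim yY[of m] by (simp add: M_def)
  qed
  ultimately have "(\<lambda>m. x m / y m) \<longlonglongrightarrow> (0^2 + 0 * (p * q - a * c) + a * q * D) / (0 * (q^2 - c^2) + c * q * D)"
    by (rule Lim_transform_eventually)
  also have "(0^2 + 0 * (p * q - a * c) + a * q * D) / (0 * (q^2 - c^2) + c * q * D) = a / c"
    using D0 q0 c0 by simp
  finally have xlim: "(\<lambda>m. x m / y m) \<longlonglongrightarrow> a / c" .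
  have "(\<lambda>m. 2 * (i m / c^2) - 2 * (i m / q^2) - q^2 * i m^2 / (c^2 * Y m) - c^2 * i m^2 / (q^2 * Y m) - Y m / (c^2 * q^2)) \<longlonglongrightarrow>
     2 * (0 / c^2) - 2 * (0 / q^2) - q^2 * 0^2 / (c^2 * (0 * (q^2 - c^2) + c * q * D)) - c^2 * 0^2 / (q^2 * (0 * (q^2 - c^2) + c * q * D))
       - (0 * (q^2 - c^2) + c * q * D) / (c^2 * q^2)"
    by (intro tendsto_intros i Ylim) (use YD c0 q0 in auto)
  moreover have "\<forall>\<^sub>F m in sequentially. 2 * (i m / c^2) - 2 * (i m / q^2) - q^2 * i m^2 / (c^2 * Y m) - c^2 * i m^2 / (q^2 * Y m) - Y m / (c^2 * q^2) = S m"
    using pos Ynz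
  proof eventually_elim
    case (elim m)
    have M: "M m \<noteq> 0" using elim by (simp add: M_def)
    have t1: "2 * (1 / (M m * c^2)) = 2 * (i m / c^2)" "2 * (1 / (- M m * q^2)) = - (2 * (i m / q^2))"
      by (simp_all add: i_def divide_inverse)
    have t2: "(M m * q^2) / ((- M m * c^2) * y m) = - (q^2 * i m^2 / (c^2 * Y m))"
      "(- M m * c^2) / ((M m * q^2) * y m) = - (c^2 * i m^2 / (q^2 * Y m))"
      "y m / ((- M m * c^2) * (M m * q^2)) = - (Y m / (c^2 * q^2))"
      using M c0 q0 elim yY[of m] by (simp_all add: i_def field_simps power2_eq_square)
    show ?case unfolding S_def t1 t2 by simp
  qed
  ultimately have "S \<longlonglongrightarrow> 2 * (0 / c^2) - 2 * (0 / q^2) - q^2 * 0^2 / (c^2 * (0 * (q^2 - c^2) + c * q * D)) - c^2 * 0^2 / (q^2 * (0 * (q^2 - c^2) + c * q * D))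
       - (0 * (q^2 - c^2) + c * q * D) / (c^2 * q^2)"
    by (rule Lim_transform_eventually)
  also have "2 * (0 / c^2) - 2 * (0 / q^2) - q^2 * 0^2 / (c^2 * (0 * (q^2 - c^2) + c * q * D)) - c^2 * 0^2 / (q^2 * (0 * (q^2 - c^2) + c * q * D))
       - (0 * (q^2 - c^2) + c * q * D) / (c^2 * q^2) = - (a / c - p / q)"
    using c0 q0 by (simp add: D_def field_simps power2_eq_square)
  finally have Slim: "S \<longlonglongrightarrow> - (a / c - p / q)" .
  have O: "M m \<in> multipliers L" "D \<in> multipliers L" for m
    using A B by (auto simp: M_def D_def intro!: multipliers_of_nat multipliers_diff multipliers_mult)
  note Oi = O A B multipliers_1 multipliers_mult multipliers_add multipliers_diff multipliers_uminus
  have "\<forall>\<^sub>F m in sequentially. \<exists>u v. u \<in> multipliers L \<and> v \<in> multipliers L \<and> v \<noteq> 0 \<and> x m / y m = u / v \<and>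
        ellDsum L u v = e2 * (cnj (S m) - S m)"
    using pos Ynz
  proof eventually_elim
    case (elim m)
    have m0: "int m \<noteq> 0" "- int m \<noteq> 0" using elim by auto
    have M: "M m \<noteq> 0" using elim by (simp add: M_def)
    have y0: "y m \<noteq> 0" using yY[of m] M elim by simp
    have P: "ellDsum L (1 - M m * a * c) (- M m * c^2) = 2 * e2 * (cnj (1 / (M m * c^2)) - 1 / (M m * c^2))"
      using ellDsum_parabolic[OF A detA c0 m0(1)] by (simp add: M_def)
    have Q: "ellDsum L (1 + M m * p * q) (M m * q^2) = 2 * e2 * (cnj (1 / (- M m * q^2)) - 1 / (- M m * q^2))"
      using ellDsum_parabolic[OF B detB q0 m0(2)] by (simp add: M_def)
    have "ellDsum L (x m) (y m) = ellDsum L (1 - M m * a * c) (- M m * c^2) + ellDsum L (1 + M m * p * q) (M m * q^2)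
       + e2 * ((cnj ((M m * q^2) / ((- M m * c^2) * y m)) - (M m * q^2) / ((- M m * c^2) * y m))
      + (cnj ((- M m * c^2) / ((M m * q^2) * y m)) - (- M m * c^2) / ((M m * q^2) * y m))
      + (cnj (y m / ((- M m * c^2) * (M m * q^2))) - y m / ((- M m * c^2) * (M m * q^2))))"
    proof (rule ellDsum_three_term)
      show "(1 - M m * a * c) * (1 + M m * a * c) - (M m * a^2) * (- M m * c^2) = 1"
        by (simp add: power2_eq_square algebra_simps)
      show "(1 + M m * p * q) * (1 - M m * p * q) - (- M m * p^2) * (M m * q^2) = 1"
        by (simp add: power2_eq_square algebra_simps)
      show "y m = - M m * c^2 * (1 + M m * p * q) + (1 + M m * a * c) * (M m * q^2)"
        by (simp add: y_def D_def power2_eq_square algebra_simps)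
      show "x m = (1 - M m * a * c) * (1 + M m * p * q) + M m * a^2 * (M m * q^2)"
        by (simp add: x_def D_def power2_eq_square algebra_simps)
    qed (use Oi M c0 q0 y0 in \<open>auto simp: power2_eq_square\<close>)
    also have "\<dots> = e2 * (cnj (S m) - S m)"
      unfolding P Q S_def complex_cnj_add by (simp only: complex_cnj_mult complex_cnj_numeral) (simp add: algebra_simps)
    finally have "ellDsum L (x m) (y m) = e2 * (cnj (S m) - S m)" .
    moreover have "x m \<in> multipliers L" "y m \<in> multipliers L"
      unfolding x_def y_def using Oi by (auto simp: power2_eq_square)
    ultimately show ?case using y0 by blast
  qed
  then show ?thesis using xlim Slim by blast
qed

text \<open>Numerators 1 + 2e are coprime to every power of 2 in O_K, so (1 + 2e)/2^j is the image
  of infinity under a matrix of determinant 1, whatever the class group is.\<close>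

lemma coprime_power_two:
  assumes e: "e \<in> multipliers L"
  shows "\<exists>b d. b \<in> multipliers L \<and> d \<in> multipliers L \<and> (1 + 2 * e) * d - b * 2 ^ j = 1"
proof (induction j)
  case 0
  show ?case using multipliers_0 multipliers_uminus[OF multipliers_1] by (intro exI[of _ "-1"] exI[of _ 0]) auto
next
  case (Suc j)
  then obtain b d where bd: "b \<in> multipliers L" "d \<in> multipliers L" "(1 + 2 * e) * d - b * 2 ^ j = 1" by blast
  define a where "a = 1 + 2 * e"
  have aO: "a \<in> multipliers L" using e multipliers_1 multipliers_of_nat[of 2] multipliers_mult multipliers_add by (auto simp: a_def)
  \<comment> \<open>The relation for j is multiplied by a - 2e = 1: its part b * 2^j * 2e carries
    the next power of 2, and the rest is a multiple of a.\<close>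
  have "a * (d * a - 2 * d * e - b * 2 ^ j) - (- (b * e)) * 2 ^ Suc j = (a * d - b * 2 ^ j) * (a - 2 * e)"
    by (simp add: algebra_simps)
  also have "\<dots> = 1" using bd(3) by (simp add: a_def)
  finally have 1: "a * (d * a - 2 * d * e - b * 2 ^ j) - (- (b * e)) * 2 ^ Suc j = 1" .
  have "(2::complex) ^ j \<in> multipliers L" using multipliers_of_nat[of "2^j"] by simp
  then have "d * a - 2 * d * e - b * 2 ^ j \<in> multipliers L" "- (b * e) \<in> multipliers L"
    using aO bd e multipliers_of_nat[of 2] by (auto intro!: multipliers_diff multipliers_mult multipliers_uminus)
  then show ?case using 1 unfolding a_def by blast
qed

end

section \<open>Density of the graph\<close>

lemma complex_of_rat: "(of_rat r :: complex) = of_real (of_rat r)"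
  by (cases r) (simp add: of_rat_rat)

lemma quadK_divide:
  assumes "x \<in> quadK D" "y \<in> quadK D"
  shows "x / y \<in> quadK D"
proof -
  define w where "w = \<i> * complex_of_real (sqrt (real D))"
  have ww: "w * w = - of_rat (of_nat D)" by (simp add: w_def complex_eq_iff flip: of_real_mult)
  obtain a b where x: "x = of_rat a + of_rat b * w" using assms(1) by (auto simp: quadK_def w_def)
  obtain c d where y: "y = of_rat c + of_rat d * w" using assms(2) by (auto simp: quadK_def w_def)
  define n where "n = c * c + d * d * of_nat D"
  have yn: "y * (of_rat c - of_rat d * w) = of_rat n"
  proof -
    have "y * (of_rat c - of_rat d * w) = of_rat c * of_rat c - of_rat d * of_rat d * (w * w)"
      by (simp add: y algebra_simps)
    then show ?thesis by (simp add: ww n_def of_rat_add of_rat_mult)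
  qed
  show ?thesis
  proof (cases "n = 0")
    case True
    then have "of_rat n = (0 :: complex)" by simp
    then have "y = 0 \<or> of_rat c - of_rat d * w = 0" using yn by simp
    moreover have "of_rat c - of_rat d * w = cnj y"
      by (simp add: y w_def complex_of_rat)
    ultimately have "y = 0" by auto
    then show ?thesis unfolding quadK_def by (auto intro!: exI[of _ 0])
  next
    case False
    have n0: "of_rat n \<noteq> (0 :: complex)" using False by simp
    then have "y \<noteq> 0" "of_rat c - of_rat d * w \<noteq> 0" using yn by auto
    then have "x / y = x * (of_rat c - of_rat d * w) / of_rat n" unfolding yn[symmetric] by simp
    also have "x * (of_rat c - of_rat d * w) = of_rat a * of_rat c - of_rat b * of_rat d * (w * w) + (of_rat b * of_rat c - of_rat a * of_rat d) * w"
      by (simp add: x algebra_simps)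
    also have "\<dots> = of_rat (a * c + b * d * of_nat D) + of_rat (b * c - a * d) * w"
      by (simp add: ww of_rat_add of_rat_mult of_rat_diff)
    also have "\<dots> / of_rat n = of_rat ((a * c + b * d * of_nat D) / n) + of_rat ((b * c - a * d) / n) * w"
      by (simp only: of_rat_divide add_divide_distrib[of _ _ "of_rat n"] times_divide_eq_left)
    finally show ?thesis unfolding quadK_def w_def by blast
  qed
qed

lemma sqrt_generator_in_ringOK: "\<i> * complex_of_real (sqrt (real D)) \<in> ringOK D"
proof -
  define w where "w = \<i> * complex_of_real (sqrt (real D))"
  have ww: "w * w = - of_nat D" by (simp add: w_def complex_eq_iff flip: of_real_mult)
  define P :: "int poly" where "P = [:int D, 0, 1:]"
  have "lead_coeff P = 1" by (simp add: P_def)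
  moreover have "poly (map_poly of_int P) w = 0" by (simp add: P_def map_poly_pCons ww)
  ultimately have "alg_integer w" unfolding alg_integer_def by blast
  moreover have "w = of_rat 0 + of_rat 1 * (\<i> * complex_of_real (sqrt (real D)))" by (simp add: w_def)
  then have "w \<in> quadK D" unfolding quadK_def by blast
  ultimately show ?thesis by (simp add: ringOK_def w_def)
qed

text \<open>By coprimality a^2 divides k, which forces a = 1; then b^2 divides the squarefree D,
  which forces b = 1.\<close>

lemma squarefree_times_square_nat:
  assumes sf: "squarefree D" and k: "prime k \<or> k = 1" and eq: "a^2 * D = k * b^2" and cop: "coprime a (b::nat)"
  shows "D = k"
proof -
  have "a^2 dvd k * b^2" using eq by (metis dvd_triv_left)
  moreover have "coprime (a^2) (b^2)" using cop by simp
  ultimately have "a^2 dvd k" using coprime_dvd_mult_left_iff by blast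
  have a1: "a = 1"
    using k
  proof
    assume p: "prime k"
    have "a dvd k" using \<open>a^2 dvd k\<close> by (metis dvd_trans dvd_triv_left power2_eq_square)
    then have "a = 1 \<or> a = k" using p by (simp add: prime_nat_iff)
    moreover have "\<not> k * k dvd k" using p by (auto simp: prime_nat_iff dest: dvd_imp_le)
    ultimately show ?thesis using \<open>a^2 dvd k\<close> by (auto simp: power2_eq_square)
  next
    assume "k = 1"
    then show ?thesis using \<open>a^2 dvd k\<close> by simp
  qed
  then have "b^2 dvd D" using eq by simp
  then have "b dvd 1" using squarefreeD[OF sf] by simp
  then show ?thesis using a1 eq by simp
qed

lemma rat_square_squarefree:
  assumes sf: "squarefree D" and k: "prime k \<or> k = 1" and eq: "(r::rat)^2 * of_nat D = of_nat k"
  shows "D = k"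
proof -
  obtain a b where ab: "r = of_int a / of_int b" "b > 0" "coprime a b"
    by (metis Fract_of_int_quotient quotient_of_unique)
  have "(of_int a)^2 * of_nat D = (of_nat k * (of_int b)^2 :: rat)"
    using eq ab by (simp add: power_divide field_simps)
  then have "(of_int (a^2 * int D) :: rat) = of_int (int k * b^2)" by simp
  then have "a^2 * int D = int k * b^2" by (simp only: of_int_eq_iff)
  then have "int ((nat \<bar>a\<bar>)^2 * D) = int (k * (nat \<bar>b\<bar>)^2)" by simp
  then have "(nat \<bar>a\<bar>)^2 * D = k * (nat \<bar>b\<bar>)^2" by (simp only: of_nat_eq_iff)
  moreover have "coprime (nat \<bar>a\<bar>) (nat \<bar>b\<bar>)" using ab(3) by (simp add: coprime_int_iff[symmetric])
  ultimately show ?thesis using squarefree_times_square_nat[OF sf k] by blast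
qed

context cm_lattice
begin

text \<open>A unit p + q sqrt (- D) other than 1 and - 1 has integral trace k = 2p with |k| < 2.
  Trace 0 gives q^2 D = 1, hence D = 1; trace 1 or - 1 gives (2q)^2 D = 3, hence D = 3.\<close>

lemma e2_nonzero:
  assumes "squarefree D" "D \<noteq> 1" "D \<noteq> 3" and O: "multipliers L = ringOK D"
  shows "e2 \<noteq> 0"
proof
  assume "e2 = 0"
  then obtain m where m: "m \<in> multipliers L" "norm m = 1" "m^2 \<noteq> 1"
    using eisE2_zero_unit[OF cm_lattice_axioms] by (auto simp: e2_def)
  obtain p q where pq: "m = of_rat p + of_rat q * (\<i> * complex_of_real (sqrt (real D)))"
    using m(1) O by (auto simp: ringOK_def quadK_def)
  have re: "Re (of_rat r :: complex) = of_rat r" "Im (of_rat r :: complex) = 0" for r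
    by (simp_all add: complex_of_rat)
  have R: "Re m = of_rat p" "Im m = of_rat q * sqrt D" by (simp_all add: pq re)
  obtain k :: int where "m + cnj m = of_int k" using multiplier_matrix[OF m(1)] by metis
  then have "Re (m + cnj m) = of_int k" by simp
  then have k: "2 * (of_rat p :: real) = of_int k" by (simp add: R)
  then have "(of_rat (2 * p) :: real) = of_rat (of_int k)" by (simp add: of_rat_mult)
  then have p: "p = of_int k / 2" by (simp only: of_rat_eq_iff)
  have "(Re m)^2 + (Im m)^2 = 1" using m(2) by (simp add: cmod_def)
  then have "(of_rat (p^2 + q^2 * of_nat D) :: real) = of_rat 1"
    by (simp add: R power_mult_distrib of_rat_add of_rat_mult of_rat_power)
  then have n: "p^2 + q^2 * of_nat D = 1" by (simp only: of_rat_eq_iff)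
  have "q \<noteq> 0"
  proof
    assume "q = 0"
    then have "p^2 = 1" using n by simp
    then have "m^2 = 1" using \<open>q = 0\<close> by (simp add: pq flip: of_rat_power)
    then show False using m(3) by simp
  qed
  have "D \<noteq> 0" using assms(1) by (intro notI) simp
  then have "q^2 * of_nat D > 0" using \<open>q \<noteq> 0\<close> by simp
  then have "p^2 < 1" using n by simp
  then have "(of_int (k^2) :: rat) < of_int 4" by (simp add: p power_divide)
  then have "k^2 < 4" by (simp only: of_int_less_iff)
  then have "k^2 < 2^2" by simp
  then have "\<bar>k\<bar> < 2" by (metis abs_le_square_iff abs_numeral not_less)
  then have "k = 0 \<or> \<bar>k\<bar> = 1" by linarith
  then show False
  proof
    assume "k = 0"
    then have "q^2 * of_nat D = of_nat 1" using n p by simp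
    then show False using rat_square_squarefree[OF assms(1), of 1 q] assms(2) by simp
  next
    assume "\<bar>k\<bar> = 1"
    then have "p^2 = 1/4" unfolding p by (auto simp: power_divide abs_if split: if_splits)
    then have "(2 * q)^2 * of_nat D = of_nat 3" using n by (simp add: power_mult_distrib)
    then show False using rat_square_squarefree[OF assms(1), of 3 "2 * q"] assms(3) by simp
  qed
qed

text \<open>Homogeneity makes the fraction picked by \<open>SOME\<close> interchangeable with any
  other.\<close>

lemma normDsum_at_eq:
  assumes O: "multipliers L = ringOK D" and x: "x \<in> multipliers L" "y \<in> multipliers L" "y \<noteq> 0"
  shows "normDsum_at D L (x / y) = normDsum D L x y"
proof -
  define ac where "ac = (SOME (a, c). a \<in> ringOK D \<and> c \<in> ringOK D \<and> c \<noteq> 0 \<and> x / y = a / c)"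
  obtain a c where e: "ac = (a, c)" by (cases ac)
  have "case ac of (a, c) \<Rightarrow> a \<in> ringOK D \<and> c \<in> ringOK D \<and> c \<noteq> 0 \<and> x / y = a / c"
    unfolding ac_def by (rule someI[of _ "(x, y)"]) (use O x in auto)
  then have ac: "a \<in> multipliers L" "c \<in> multipliers L" "c \<noteq> 0" "x / y = a / c" using O by (auto simp: e)
  have "ellDsum L a c = ellDsum L x y" by (rule ellDsum_homogeneous[OF x ac])
  then show ?thesis unfolding normDsum_at_def ac_def[symmetric] by (simp add: e normDsum_def)
qed

definition graphD :: "nat \<Rightarrow> (complex \<times> real) set" where
  "graphD D = {(\<alpha>, Re (normDsum_at D L \<alpha>)) | \<alpha>. \<alpha> \<in> quadK D}"

lemma graph_limit_point:
  assumes sf: "squarefree D" "D \<noteq> 1" "D \<noteq> 3" and O: "multipliers L = ringOK D"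
    and A: "a \<in> multipliers L" "b \<in> multipliers L" "c \<in> multipliers L" "d \<in> multipliers L"
    and B: "p \<in> multipliers L" "r \<in> multipliers L" "q \<in> multipliers L" "s \<in> multipliers L"
    and det: "a * d - b * c = 1" "p * s - r * q = 1" and nz: "c \<noteq> 0" "q \<noteq> 0" "a / c \<noteq> p / q"
  shows "(a / c, 2 * Im (a / c - p / q) / sqrt (real_of_int \<bar>discK D\<bar>)) \<in> closure (graphD D)"
proof -
  define \<delta> where "\<delta> = sqrt (real_of_int \<bar>discK D\<bar>)"
  have "D \<noteq> 0" using sf(1) by (intro notI) simp
  then have \<delta>: "\<delta> \<noteq> 0" by (simp add: \<delta>_def discK_def)
  have e0: "e2 \<noteq> 0" by (rule e2_nonzero[OF sf O])
  obtain \<alpha> S where \<alpha>: "\<alpha> \<longlonglongrightarrow> a / c" and S: "S \<longlonglongrightarrow> - (a / c - p / q)"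
    and ev: "\<forall>\<^sub>F m in sequentially. \<exists>x y. x \<in> multipliers L \<and> y \<in> multipliers L \<and> y \<noteq> 0 \<and> \<alpha> m = x / y \<and>
        ellDsum L x y = e2 * (cnj (S m) - S m)"
    using ellDsum_two_parabolics[OF A B det nz] by blast
  have lim: "(\<lambda>m. (\<alpha> m, - 2 * Im (S m) / \<delta>)) \<longlonglongrightarrow> (a / c, - 2 * Im (- (a / c - p / q)) / \<delta>)"
    by (intro tendsto_intros \<alpha> S \<delta>)
  have "\<forall>\<^sub>F m in sequentially. (\<alpha> m, - 2 * Im (S m) / \<delta>) \<in> closure (graphD D)"
    using ev
  proof eventually_elim
    case (elim m)
    then obtain x y where xy: "x \<in> multipliers L" "y \<in> multipliers L" "y \<noteq> 0" "\<alpha> m = x / y"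
      and E: "ellDsum L x y = e2 * (cnj (S m) - S m)" by blast
    have "cnj (S m) - S m = \<i> * of_real (- 2 * Im (S m))" by (simp add: complex_eq_iff)
    then have "normDsum D L x y = of_real (- 2 * Im (S m) / \<delta>)"
      using e0 \<delta> unfolding normDsum_def E e2_def[symmetric] \<delta>_def[symmetric] by simp
    then have "Re (normDsum_at D L (\<alpha> m)) = - 2 * Im (S m) / \<delta>"
      unfolding xy(4) normDsum_at_eq[OF O xy(1-3)] by simp
    moreover have "\<alpha> m \<in> quadK D" unfolding xy(4) using xy(1,2) O by (intro quadK_divide) (auto simp: ringOK_def)
    ultimately have "(\<alpha> m, - 2 * Im (S m) / \<delta>) \<in> graphD D" unfolding graphD_def by force
    then show ?case using closure_subset by blast
  qed
  then have "(a / c, - 2 * Im (- (a / c - p / q)) / \<delta>) \<in> closure (graphD D)"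
    by (intro Lim_in_closed_set[OF closed_closure _ _ lim]) auto
  then show ?thesis by (simp add: \<delta>_def)
qed

end

section \<open>Dyadic approximation and the final limit\<close>

lemma dyadic_floor_limit:
  fixes x h :: real
  assumes "h > 0"
  shows "(\<lambda>j. of_int \<lfloor>x * 2^j / h\<rfloor> * h / 2^j) \<longlonglongrightarrow> x"
proof -
  have b: "\<bar>of_int \<lfloor>x * 2^j / h\<rfloor> * h / 2^j - x\<bar> \<le> h * (1/2)^j" for j
  proof -
    define n where "n = real_of_int \<lfloor>x * 2^j / h\<rfloor>"
    have "\<bar>n - x * 2^j / h\<bar> \<le> 1" unfolding n_def by linarith
    then have "\<bar>n - x * 2^j / h\<bar> * (h / 2^j) \<le> 1 * (h / 2^j)" using assms by (intro mult_right_mono) auto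
    moreover have "\<bar>n - x * 2^j / h\<bar> * (h / 2^j) = \<bar>n * h / 2^j - x\<bar>"
    proof -
      have "n * h / 2^j - x = (n - x * 2^j / h) * (h / 2^j)" using assms by (simp add: field_simps)
      then show ?thesis using assms by (simp add: abs_mult)
    qed
    ultimately have "\<bar>n * h / 2^j - x\<bar> \<le> 1 * (h / 2^j)" by simp
    then show ?thesis unfolding n_def by (simp add: power_one_over)
  qed
  have "(\<lambda>j. h * (1/2)^j) \<longlonglongrightarrow> h * 0" by (intro tendsto_mult_left LIMSEQ_power_zero) auto
  then have lim: "(\<lambda>j. h * (1/2)^j) \<longlonglongrightarrow> 0" by (simp only: mult_zero_right)
  have "\<forall>\<^sub>F j in sequentially. norm (of_int \<lfloor>x * 2^j / h\<rfloor> * h / 2^j - x) \<le> h * (1/2)^j"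
    by (intro always_eventually allI) (simp only: real_norm_def b)
  from Lim_null_comparison[OF this lim] show ?thesis by (rule LIM_zero_cancel)
qed

text \<open>The numerators are kept of the form 1 + 2e so that \<open>coprime_power_two\<close>
  applies; the extra summand 1/2^j tends to 0.\<close>

lemma dyadic_approximation:
  fixes z :: complex and D :: nat
  assumes "D > 0"
  defines "w \<equiv> \<i> * complex_of_real (sqrt (real D))"
  shows "\<exists>x y :: nat \<Rightarrow> int. (\<lambda>j. (1 + 2 * (of_int (x j) + of_int (y j) * w)) / 2^j) \<longlonglongrightarrow> z"
proof -
  define x where "x j = \<lfloor>Re z * 2^j / 2\<rfloor>" for j :: nat
  define y where "y j = \<lfloor>Im z * 2^j / (2 * sqrt (real D))\<rfloor>" for j :: nat
  have X: "(\<lambda>j. of_int (x j) * 2 / 2^j) \<longlonglongrightarrow> Re z" unfolding x_def by (rule dyadic_floor_limit) simp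
  have Y: "(\<lambda>j. of_int (y j) * (2 * sqrt (real D)) / 2^j) \<longlonglongrightarrow> Im z"
    unfolding y_def by (rule dyadic_floor_limit) (use assms in simp)
  have "(\<lambda>j. (1/2::complex)^j + of_real (of_int (x j) * 2 / 2^j) + \<i> * of_real (of_int (y j) * (2 * sqrt (real D)) / 2^j))
      \<longlonglongrightarrow> 0 + of_real (Re z) + \<i> * of_real (Im z)"
    by (intro tendsto_intros X Y LIMSEQ_power_zero) (simp add: norm_divide)
  moreover have "(1/2::complex)^j + of_real (of_int (x j) * 2 / 2^j) + \<i> * of_real (of_int (y j) * (2 * sqrt (real D)) / 2^j)
     = (1 + 2 * (of_int (x j) + of_int (y j) * w)) / 2^j" for j
    by (simp add: w_def add_divide_distrib power_one_over ring_distribs mult_ac)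
  ultimately show ?thesis by (auto simp: complex_eq[symmetric])
qed

theorem theorem1:
  fixes D :: nat and L :: "complex set"
  assumes "squarefree D" and "D > 0" and "D \<noteq> 1" and "D \<noteq> 3"
    and "lattice L" and "multipliers L = ringOK D"
  shows "closure {(\<alpha>, Re (normDsum_at D L \<alpha>)) | \<alpha>. \<alpha> \<in> quadK D} = (UNIV :: (complex \<times> real) set)"
proof -
  define w where "w = \<i> * complex_of_real (sqrt (real D))"
  obtain w1 w2 where W: "w1 \<noteq> 0" "Im (w2 / w1) \<noteq> 0" "L = {of_int m * w1 + of_int n * w2 | m n. True}"
    using \<open>lattice L\<close> by (auto simp: lattice_def)
  have wO: "w \<in> multipliers L" using sqrt_generator_in_ringOK[of D] assms(6) by (simp add: w_def)
  interpret cm_lattice w1 w2 L w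
    by unfold_locales (use W wO assms(2) in \<open>auto simp: w_def\<close>)
  define \<delta> where "\<delta> = sqrt (real_of_int \<bar>discK D\<bar>)"
  have \<delta>: "\<delta> \<noteq> 0" using assms(2) by (simp add: \<delta>_def discK_def)
  have "(\<alpha>, t) \<in> closure (graphD D)" for \<alpha> t
  proof -
    \<comment> \<open>Chosen so that 2 Im (\<alpha> - \<beta>) / \<delta> = t; the summand 1 keeps
      \<alpha> and \<beta> distinct also for t = 0.\<close>
    define \<beta> where "\<beta> = \<alpha> - \<i> * of_real (t * \<delta> / 2) + 1"
    obtain x y :: "nat \<Rightarrow> int" where xy: "(\<lambda>j. (1 + 2 * (of_int (x j) + of_int (y j) * w)) / 2^j) \<longlonglongrightarrow> \<alpha>"
      using dyadic_approximation[OF assms(2)] unfolding w_def by blast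
    obtain x' y' :: "nat \<Rightarrow> int" where xy': "(\<lambda>j. (1 + 2 * (of_int (x' j) + of_int (y' j) * w)) / 2^j) \<longlonglongrightarrow> \<beta>"
      using dyadic_approximation[OF assms(2)] unfolding w_def by blast
    define f where "f j = (1 + 2 * (of_int (x j) + of_int (y j) * w)) / 2^j" for j
    define g where "g j = (1 + 2 * (of_int (x' j) + of_int (y' j) * w)) / 2^j" for j
    have f: "f \<longlonglongrightarrow> \<alpha>" and g: "g \<longlonglongrightarrow> \<beta>" using xy xy' by (simp_all add: f_def[abs_def] g_def[abs_def])
    have lim: "(\<lambda>j. (f j, 2 * Im (f j - g j) / \<delta>)) \<longlonglongrightarrow> (\<alpha>, 2 * Im (\<alpha> - \<beta>) / \<delta>)"
      by (intro tendsto_intros f g \<delta>)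
    have "\<alpha> - \<beta> \<noteq> 0" by (auto simp: \<beta>_def complex_eq_iff)
    moreover have "(\<lambda>j. f j - g j) \<longlonglongrightarrow> \<alpha> - \<beta>" by (intro tendsto_intros f g)
    ultimately have "\<forall>\<^sub>F j in sequentially. f j - g j \<noteq> 0" by (intro tendsto_imp_eventually_ne)
    \<comment> \<open>These points are themselves only limits of graph points, so the closure is
      used at this stage and again for the limit in j.\<close>
    then have "\<forall>\<^sub>F j in sequentially. (f j, 2 * Im (f j - g j) / \<delta>) \<in> closure (graphD D)"
    proof eventually_elim
      case (elim j)
      define e where "e = of_int (x j) + of_int (y j) * w"
      define e' where "e' = of_int (x' j) + of_int (y' j) * w"
      have eO: "e \<in> multipliers L" "e' \<in> multipliers L"
        unfolding e_def e'_def by (intro multipliers_add multipliers_mult multipliers_of_int wO)+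
      obtain b d where bd: "b \<in> multipliers L" "d \<in> multipliers L" "(1 + 2 * e) * d - b * 2 ^ j = 1"
        using coprime_power_two[OF eO(1)] by blast
      obtain r s where rs: "r \<in> multipliers L" "s \<in> multipliers L" "(1 + 2 * e') * s - r * 2 ^ j = 1"
        using coprime_power_two[OF eO(2)] by blast
      have O: "1 + 2 * e \<in> multipliers L" "1 + 2 * e' \<in> multipliers L" "(2::complex)^j \<in> multipliers L"
        using eO multipliers_of_nat[of 2] multipliers_of_nat[of "2^j"]
        by (auto intro!: multipliers_add multipliers_mult multipliers_1)
      have "((1 + 2 * e) / 2^j, 2 * Im ((1 + 2 * e) / 2^j - (1 + 2 * e') / 2^j) / sqrt (real_of_int \<bar>discK D\<bar>)) \<in> closure (graphD D)"
        by (rule graph_limit_point[OF assms(1,3,4,6) O(1) bd(1) O(3) bd(2) O(2) rs(1) O(3) rs(2) bd(3) rs(3)])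
           (use elim in \<open>auto simp: f_def g_def e_def e'_def\<close>)
      then show ?case by (simp add: f_def g_def e_def e'_def \<delta>_def)
    qed
    then have "(\<alpha>, 2 * Im (\<alpha> - \<beta>) / \<delta>) \<in> closure (graphD D)"
      by (intro Lim_in_closed_set[OF closed_closure _ _ lim]) auto
    moreover have "2 * Im (\<alpha> - \<beta>) / \<delta> = t" using \<delta> by (simp add: \<beta>_def)
    ultimately show ?thesis by simp
  qed
  then show ?thesis unfolding graphD_def by auto
qed

end
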